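(* Assume $a$ is (WD) or (SD), let $\beta,\gamma\ge0$, and let $y$ be a mild solution of problem (P). Let $\varepsilon_0>0$ with $\varepsilon_0\le 2-K$. Then for all $t>0$ and all $\delta\in\big(0,\min\{\nu,\varepsilon_0/C_1\}\big)$, $$E_y(t)\le E_y(0)\,e^{1-\frac tM},$$ where $M:=\frac{C_2}{\varepsilon_0-\delta C_1}$, $$C_1:=\frac2{C_\delta}\Big(\frac{K\beta}2+\frac K4+\beta+\varepsilon_0\frac\beta2+\beta+1+2\gamma^2+\varepsilon_0\frac\gamma2\Big),\qquad C_2:=4\vartheta+\varrho+\frac{C_\gamma}2\Big(2-\frac K2\Big)+C_3,$$ $$C_3:=\frac1{C_\delta}\Big(2+2(4C_{HP}+1)(C_\beta+C_\gamma)+\frac1\delta(8C_{HP}+3)\Big)\Big(\frac{K\beta}2+\frac K4+\beta+\varepsilon_0\frac\beta2+\beta+1+2\gamma^2+\varepsilon_0\frac\gamma2\Big),$$ $\vartheta:=\max\{\frac4{a(1)}+KC_{HP},1+\frac K4\}$, $\varrho:=\max\{2,\frac K4+1+\frac1{a(1)}\}$, and $\nu$, $C_\delta$, $C_\beta$, $C_\gamma$ are as defined below.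
   Context: $K:=\sup_{x\in(0,1]}\frac{x|a'(x)|}{a(x)}$. $a$ is weakly degenerate (WD) if $a\in C[0,1]\cap C^1(0,1]$, $a(0)=0$, $a>0$ on $(0,1]$ and $K\in(0,1)$; $a$ is strongly degenerate (SD) if $a\in C^1[0,1]$, $a(0)=0$, $a>0$ on $(0,1]$ and $K\in[1,2)$. Spaces: $L^2_{\frac1a}(0,1):=\{u\in L^2(0,1):\int_0^1u^2/a<\infty\}$; $H^1_{\frac1a,0}(0,1):=\{u\in L^2_{\frac1a}(0,1)\cap H^1(0,1):u(0)=0\}$; $H^2_{\frac1a,0}(0,1):=\{u\in H^1_{\frac1a,0}(0,1)\cap H^2(0,1):u'(0)=0\}$; $D(A):=\{u\in H^2_{\frac1a,0}(0,1):au''''\in L^2_{\frac1a}(0,1)\}$, $Au:=au''''$. $C_{HP}>0$ is the best constant in $\int_0^1u^2/a\,dx\le C\int_0^1(u')^2dx$ for $u\in H^1_{\frac1a,0}(0,1)$. Problem (P): $y_{tt}+a(x)y_{xxxx}=0$ for $t>0$, $x\in(0,1)$; $y(t,0)=y_x(t,0)=0$; $\beta y(t,1)-y_{xxx}(t,1)+y_t(t,1)=0$; $\gamma y_x(t,1)+y_{xx}(t,1)+y_{tx}(t,1)=0$; $y(0,\cdot)=y_0$, $y_t(0,\cdot)=y_1$. Let $\mathcal H_0:=H^2_{\frac1a,0}(0,1)\times L^2_{\frac1a}(0,1)$ with norm $\|(u,v)\|^2_{\mathcal H_0}=\int_0^1(u'')^2+\int_0^1v^2/a+\beta u^2(1)+\gamma(u'(1))^2$,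 and $\mathcal A(u,v):=(v,-Au)$ with domain $D(\mathcal A):=\{(u,v)\in D(A)\times H^2_{\frac1a,0}(0,1):\beta u(1)-u'''(1)+v(1)=0,\ \gamma u'(1)+u''(1)+v'(1)=0\}$; $\mathcal A$ generates a contraction semigroup $(S(t))_{t\ge0}$ on $\mathcal H_0$. For $(y_0,y_1)\in\mathcal H_0$ the mild solution of (P) is $y(t):=$ first component of $S(t)(y_0,y_1)$, so $y\in C^1([0,\infty);L^2_{\frac1a})\cap C([0,\infty);H^2_{\frac1a,0})$. Energy: $E_y(t):=\frac12\int_0^1\big(\frac{y_t^2}{a}+y_{xx}^2\big)dx+\frac\beta2y^2(t,1)+\frac\gamma2y_x^2(t,1)$. $C_\beta:=\min\{2,2/\beta\}$ if $\beta\ne0$, $C_\beta:=2$ if $\beta=0$; $C_\gamma$ analogously. $\nu:=\frac{\beta\gamma}{2(\beta+\gamma)}$ if $\beta,\gamma>1$; $\frac{\gamma}{2(1+\gamma)}$ if $\beta\in[0,1],\gamma>1$; $\frac{\beta}{2(\beta+1)}$ if $\beta>1,\gamma\in[0,1]$; $\frac14$ if $\beta,\gamma\in[0,1]$. $C_\delta:=1-2\delta(\frac1\beta+\frac1\gamma)$ if $\beta,\gamma>1$; $1-2\delta(1+\frac1\gamma)$ if $\beta\in[0,1],\gamma>1$; $1-2\delta(\frac1\beta+1)$ if $\beta>1,\gamma\in[0,1]$; $1-4\delta$ if $\beta,\gamma\in[0,1]$. *)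

theory Defs
  imports "HOL-Analysis.Analysis"
begin

text \<open>One-sided (within [0,1]) classical derivative; Sobolev functions are represented
 by their continuous representatives, derivatives of order k are iterates of Dx.\<close>
definition Dx :: "(real \<Rightarrow> real) \<Rightarrow> real \<Rightarrow> real" where
  "Dx f = (\<lambda>x. vector_derivative f (at x within {0..1}))"

definition L2 :: "(real \<Rightarrow> real) \<Rightarrow> bool" where
  "L2 f \<longleftrightarrow> f measurable_on {0..1} \<and> (\<lambda>x. (f x)^2) integrable_on {0..1}"

definition L2w :: "(real \<Rightarrow> real) \<Rightarrow> (real \<Rightarrow> real) \<Rightarrow> bool" where
  "L2w a f \<longleftrightarrow> L2 f \<and> (\<lambda>x. (f x)^2 / a x) integrable_on {0..1}"

definition H1 :: "(real \<Rightarrow> real) \<Rightarrow> bool" where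
  "H1 f \<longleftrightarrow> L2 (Dx f) \<and> (\<forall>x\<in>{0..1}. f x = f 0 + integral {0..x} (Dx f))"

definition H2 :: "(real \<Rightarrow> real) \<Rightarrow> bool" where
  "H2 f \<longleftrightarrow> H1 f \<and> H1 (Dx f)"

definition H1w0 :: "(real \<Rightarrow> real) \<Rightarrow> (real \<Rightarrow> real) \<Rightarrow> bool" where
  "H1w0 a u \<longleftrightarrow> L2w a u \<and> H1 u \<and> u 0 = 0"

definition H2w0 :: "(real \<Rightarrow> real) \<Rightarrow> (real \<Rightarrow> real) \<Rightarrow> bool" where
  "H2w0 a u \<longleftrightarrow> H1w0 a u \<and> H2 u \<and> Dx u 0 = 0"

text \<open>Absolutely continuous on every [c,1], 0<c<=1, with derivative Dx f
  (i.e. distributional derivative in L^1_loc(0,1]).\<close>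
definition AC_loc :: "(real \<Rightarrow> real) \<Rightarrow> bool" where
  "AC_loc f \<longleftrightarrow> (\<forall>c\<in>{0<..1}. Dx f integrable_on {c..1} \<and>
       (\<forall>x\<in>{c..1}. f x = f c + integral {c..x} (Dx f)))"

definition DomA :: "(real \<Rightarrow> real) \<Rightarrow> (real \<Rightarrow> real) \<Rightarrow> bool" where
  "DomA a u \<longleftrightarrow> H2w0 a u \<and> AC_loc (Dx (Dx u)) \<and> AC_loc (Dx (Dx (Dx u))) \<and>
       L2w a (\<lambda>x. a x * Dx (Dx (Dx (Dx u))) x)"

definition C1_on :: "real set \<Rightarrow> (real \<Rightarrow> real) \<Rightarrow> bool" where
  "C1_on S f \<longleftrightarrow> (\<exists>f'. continuous_on S f' \<and> (\<forall>x\<in>S. (f has_real_derivative f' x) (at x within S)))"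

definition Kset :: "(real \<Rightarrow> real) \<Rightarrow> real set" where
  "Kset a = (\<lambda>x. x * \<bar>vector_derivative a (at x within {0<..1})\<bar> / a x) ` {0<..1}"

definition Kc :: "(real \<Rightarrow> real) \<Rightarrow> real" where
  "Kc a = Sup (Kset a)"

definition WD :: "(real \<Rightarrow> real) \<Rightarrow> bool" where
  "WD a \<longleftrightarrow> continuous_on {0..1} a \<and> C1_on {0<..1} a \<and> a 0 = 0 \<and>
     (\<forall>x\<in>{0<..1}. a x > 0) \<and> bdd_above (Kset a) \<and> 0 < Kc a \<and> Kc a < 1"

definition SD :: "(real \<Rightarrow> real) \<Rightarrow> bool" where
  "SD a \<longleftrightarrow> C1_on {0..1} a \<and> a 0 = 0 \<and>
     (\<forall>x\<in>{0<..1}. a x > 0) \<and> bdd_above (Kset a) \<and> 1 \<le> Kc a \<and> Kc a < 2"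

definition CHP :: "(real \<Rightarrow> real) \<Rightarrow> real" where
  "CHP a = Inf {C. \<forall>u. H1w0 a u \<longrightarrow>
      integral {0..1} (\<lambda>x. (u x)^2 / a x) \<le> C * integral {0..1} (\<lambda>x. (Dx u x)^2)}"

type_synonym pr = "(real \<Rightarrow> real) \<times> (real \<Rightarrow> real)"

definition psub :: "pr \<Rightarrow> pr \<Rightarrow> pr" where
  "psub p q = (\<lambda>x. fst p x - fst q x, \<lambda>x. snd p x - snd q x)"

definition padd :: "pr \<Rightarrow> pr \<Rightarrow> pr" where
  "padd p q = (\<lambda>x. fst p x + fst q x, \<lambda>x. snd p x + snd q x)"

definition pscale :: "real \<Rightarrow> pr \<Rightarrow> pr" where
  "pscale c p = (\<lambda>x. c * fst p x, \<lambda>x. c * snd p x)"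

definition H0 :: "(real \<Rightarrow> real) \<Rightarrow> pr set" where
  "H0 a = {p. H2w0 a (fst p) \<and> L2w a (snd p)}"

definition nH :: "(real \<Rightarrow> real) \<Rightarrow> real \<Rightarrow> real \<Rightarrow> pr \<Rightarrow> real" where
  "nH a \<beta> \<gamma> p = sqrt (integral {0..1} (\<lambda>x. (Dx (Dx (fst p)) x)^2)
      + integral {0..1} (\<lambda>x. (snd p x)^2 / a x)
      + \<beta> * (fst p 1)^2 + \<gamma> * (Dx (fst p) 1)^2)"

definition DomAA :: "(real \<Rightarrow> real) \<Rightarrow> real \<Rightarrow> real \<Rightarrow> pr set" where
  "DomAA a \<beta> \<gamma> = {p. DomA a (fst p) \<and> H2w0 a (snd p) \<and>
      \<beta> * fst p 1 - Dx (Dx (Dx (fst p))) 1 + snd p 1 = 0 \<and>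
      \<gamma> * Dx (fst p) 1 + Dx (Dx (fst p)) 1 + Dx (snd p) 1 = 0}"

definition AA :: "(real \<Rightarrow> real) \<Rightarrow> pr \<Rightarrow> pr" where
  "AA a p = (snd p, \<lambda>x. - (a x * Dx (Dx (Dx (Dx (fst p)))) x))"

text \<open>S is the contraction C_0-semigroup on H_0 generated by \<A> (elements of H_0
  are identified when their H_0-distance is 0).\<close>
definition gen_contr_semigroup ::
  "(real \<Rightarrow> real) \<Rightarrow> real \<Rightarrow> real \<Rightarrow> (real \<Rightarrow> pr \<Rightarrow> pr) \<Rightarrow> bool" where
  "gen_contr_semigroup a \<beta> \<gamma> S \<longleftrightarrow>
     (\<forall>t\<ge>0. \<forall>p\<in>H0 a. S t p \<in> H0 a) \<and>
     (\<forall>p\<in>H0 a. nH a \<beta> \<gamma> (psub (S 0 p) p) = 0) \<and>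
     (\<forall>t\<ge>0. \<forall>s\<ge>0. \<forall>p\<in>H0 a. nH a \<beta> \<gamma> (psub (S (t + s) p) (S t (S s p))) = 0) \<and>
     (\<forall>t\<ge>0. \<forall>p\<in>H0 a. \<forall>q\<in>H0 a. \<forall>c.
        nH a \<beta> \<gamma> (psub (S t (padd p (pscale c q))) (padd (S t p) (pscale c (S t q)))) = 0) \<and>
     (\<forall>t\<ge>0. \<forall>p\<in>H0 a. nH a \<beta> \<gamma> (S t p) \<le> nH a \<beta> \<gamma> p) \<and>
     (\<forall>p\<in>H0 a. ((\<lambda>t. nH a \<beta> \<gamma> (psub (S t p) p)) \<longlongrightarrow> 0) (at_right 0)) \<and>
     (\<forall>p\<in>DomAA a \<beta> \<gamma>.
        ((\<lambda>h. nH a \<beta> \<gamma> (psub (pscale (1/h) (psub (S h p) p)) (AA a p))) \<longlongrightarrow> 0) (at_right 0)) \<and>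
     (\<forall>p\<in>H0 a. (\<exists>z\<in>H0 a.
        ((\<lambda>h. nH a \<beta> \<gamma> (psub (pscale (1/h) (psub (S h p) p)) z)) \<longlongrightarrow> 0) (at_right 0))
        \<longrightarrow> (\<exists>q\<in>DomAA a \<beta> \<gamma>. nH a \<beta> \<gamma> (psub p q) = 0))"

text \<open>Energy of y, with y_t the second component of S(t)(y0,y1).\<close>
definition Energy :: "(real \<Rightarrow> real) \<Rightarrow> real \<Rightarrow> real \<Rightarrow> (real \<Rightarrow> real \<Rightarrow> real)
    \<Rightarrow> (real \<Rightarrow> real \<Rightarrow> real) \<Rightarrow> real \<Rightarrow> real" where
  "Energy a \<beta> \<gamma> y yt t = 1/2 * integral {0..1} (\<lambda>x. (yt t x)^2 / a x + (Dx (Dx (y t)) x)^2)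
      + \<beta>/2 * (y t 1)^2 + \<gamma>/2 * (Dx (y t) 1)^2"

definition Cb :: "real \<Rightarrow> real" where
  "Cb b = (if b \<noteq> 0 then min 2 (2 / b) else 2)"

definition nu :: "real \<Rightarrow> real \<Rightarrow> real" where
  "nu \<beta> \<gamma> = (if \<beta> > 1 \<and> \<gamma> > 1 then \<beta> * \<gamma> / (2 * (\<beta> + \<gamma>))
     else if \<beta> \<le> 1 \<and> \<gamma> > 1 then \<gamma> / (2 * (1 + \<gamma>))
     else if \<beta> > 1 \<and> \<gamma> \<le> 1 then \<beta> / (2 * (\<beta> + 1))
     else 1/4)"

definition Cdelta :: "real \<Rightarrow> real \<Rightarrow> real \<Rightarrow> real" where
  "Cdelta \<beta> \<gamma> \<delta> = (if \<beta> > 1 \<and> \<gamma> > 1 then 1 - 2 * \<delta> * (1/\<beta> + 1/\<gamma>)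
     else if \<beta> \<le> 1 \<and> \<gamma> > 1 then 1 - 2 * \<delta> * (1 + 1/\<gamma>)
     else if \<beta> > 1 \<and> \<gamma> \<le> 1 then 1 - 2 * \<delta> * (1/\<beta> + 1)
     else 1 - 4 * \<delta>)"

definition Pc :: "(real \<Rightarrow> real) \<Rightarrow> real \<Rightarrow> real \<Rightarrow> real \<Rightarrow> real" where
  "Pc a \<beta> \<gamma> \<epsilon>0 = Kc a * \<beta> / 2 + Kc a / 4 + \<beta> + \<epsilon>0 * \<beta> / 2 + \<beta> + 1 + 2 * \<gamma>^2 + \<epsilon>0 * \<gamma> / 2"

definition Cone :: "(real \<Rightarrow> real) \<Rightarrow> real \<Rightarrow> real \<Rightarrow> real \<Rightarrow> real \<Rightarrow> real" where
  "Cone a \<beta> \<gamma> \<epsilon>0 \<delta> = 2 / Cdelta \<beta> \<gamma> \<delta> * Pc a \<beta> \<gamma> \<epsilon>0"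

definition Cthree :: "(real \<Rightarrow> real) \<Rightarrow> real \<Rightarrow> real \<Rightarrow> real \<Rightarrow> real \<Rightarrow> real" where
  "Cthree a \<beta> \<gamma> \<epsilon>0 \<delta> = 1 / Cdelta \<beta> \<gamma> \<delta> *
     (2 + 2 * (4 * CHP a + 1) * (Cb \<beta> + Cb \<gamma>) + (1/\<delta>) * (8 * CHP a + 3)) * Pc a \<beta> \<gamma> \<epsilon>0"

definition vartheta :: "(real \<Rightarrow> real) \<Rightarrow> real" where
  "vartheta a = max (4 / a 1 + Kc a * CHP a) (1 + Kc a / 4)"

definition varrho :: "(real \<Rightarrow> real) \<Rightarrow> real" where
  "varrho a = max 2 (Kc a / 4 + 1 + 1 / a 1)"

definition Ctwo :: "(real \<Rightarrow> real) \<Rightarrow> real \<Rightarrow> real \<Rightarrow> real \<Rightarrow> real \<Rightarrow> real" where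
  "Ctwo a \<beta> \<gamma> \<epsilon>0 \<delta> = 4 * vartheta a + varrho a + Cb \<gamma> / 2 * (2 - Kc a / 2) + Cthree a \<beta> \<gamma> \<epsilon>0 \<delta>"

definition Mc :: "(real \<Rightarrow> real) \<Rightarrow> real \<Rightarrow> real \<Rightarrow> real \<Rightarrow> real \<Rightarrow> real" where
  "Mc a \<beta> \<gamma> \<epsilon>0 \<delta> = Ctwo a \<beta> \<gamma> \<epsilon>0 \<delta> / (\<epsilon>0 - \<delta> * Cone a \<beta> \<gamma> \<epsilon>0 \<delta>)"

end

(* For initial data in the domain of the generator the orbit U(t) = (y, y_t) is differentiable in the
   energy space, so every bounded bilinear form b gives a differentiable function b(U, U).  The
   energy E satisfies E' = - (y_t(1)^2 + y_tx(1)^2).  Consider the form X assembled from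
     * the multiplier 2 x y_x - (K/2) y tested against y_t / a (controls E up to boundary terms, since
       x |a'| <= K a),
     * (1 - K/4) y_x(1)^2 (absorbs the indefinite product y_x(1) y_tx(1)),
     * the test function z = c1 x^2 + c2 x^3 solving z'''' = 0 with the boundary conditions
       beta z(1) - z'''(1) = y(1), gamma z'(1) + z''(1) = y_x(1) (controls y(1)^2 + y_x(1)^2),
     * a multiple of E (absorbs y_t(1)^2 + y_tx(1)^2).
   Then X' <= - (epsilon0 - delta C1) E, while X(s) - X(t) <= C2 E(s) for s <= t.  Hence
   int_s^T E <= M E(s), and the classical argument of Haraux and Komornik gives the decay.
   Mild solutions follow because the domain is dense and the semigroup is contractive. *)

theory Submission
  imports Defs
begin

section \<open>Differentiation and integration by parts of indefinite integrals\<close>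

text \<open>Apart from the multiplier estimate, the degeneracy is used through one fact: x |a'| <= K
  a makes x^K / a nondecreasing, hence 1/a <= x^(-K) / a(1) with K < 2. A displacement vanishes with
  its slope at 0, so its weighted norms are finite and every boundary term at 0 either tends to 0 or
  has the right sign. The weight K/2 of y is dictated by the kinetic term. The multiplier 2 x y_x
  alone gives it the factor -(1 - K), of no use when K >= 1; the product with y turns this into -(1
  - K/2) <= -epsilon0/2, while the bending term can afford to drop from 3 to 3 - K/2. delta is the
  Young weight in the estimate of the form with z. It leaves delta times a kinetic term behind, and
  this is the loss delta C1 in the rate. The other obstacle is representation. Points of the energy
  space are functions, the semigroup laws hold up to distance zero, and \<open>Dx\<close> is a
  pointwise derivative that is additive only almost everywhere. This accounts for the
  differentiation theorem at the start and for bounded forms, which cannot see a distance of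
  zero.\<close>

text \<open>Lebesgue differentiation for gauge integrals. Where the difference quotient at x is off
  by at least 1/(k+1) for arbitrarily near y, the intervals between x and y form a Vitali cover;
  Henstock's lemma bounds the summed errors over disjoint such intervals, hence their total length.
  With this theorem the pointwise \<open>Dx\<close> behaves like a weak derivative.\<close>

lemma negligible_nondifferentiable_indefinite_integral:
  fixes f :: "real \<Rightarrow> real"
  assumes f: "f integrable_on {a..b}"
  shows "negligible {x \<in> {a..b}. \<not> ((\<lambda>x. integral {a..x} f) has_real_derivative f x) (at x within {a..b})}"
proof -
  define F where "F = (\<lambda>x. integral {a..x} f)"
  define J where "J = (\<lambda>(x::real, y). {min x y..max x y})"
  define bad where "bad k x y \<longleftrightarrow> \<bar>y - x\<bar> / real (Suc k) \<le> \<bar>F y - F x - f x * (y - x)\<bar>" for k x y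
  define Bad where "Bad k = {x \<in> {a..b}. \<forall>d>0. \<exists>y\<in>{a..b}. y \<noteq> x \<and> \<bar>y - x\<bar> < d \<and> bad k x y}" for k
  have FJ: "\<bar>measure lborel (J (x, y)) * f x - integral (J (x, y)) f\<bar> = \<bar>F y - F x - f x * (y - x)\<bar>"
    if "x \<in> {a..b}" "y \<in> {a..b}" for x y
  proof (cases "x \<le> y")
    case True
    have "F x + integral {x..y} f = F y"
      unfolding F_def using that True
      by (intro Henstock_Kurzweil_Integration.integral_combine integrable_on_subinterval[OF f]) auto
    then show ?thesis using True by (simp add: J_def algebra_simps)
  next
    case False
    have "F y + integral {y..x} f = F x"
      unfolding F_def using that False
      by (intro Henstock_Kurzweil_Integration.integral_combine integrable_on_subinterval[OF f]) auto
    then show ?thesis using False by (simp add: J_def algebra_simps)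
  qed
  have "negligible (Bad k)" for k
  proof (subst negligible_outer_le, intro allI impI)
    fix e :: real assume e0: "e > 0"
    \<comment> \<open>A bad interval has an error of at least its length over k+1, so an error total
      below e/(k+1) keeps the total length below e.\<close>
    then have e': "e / real (Suc k) > 0" by simp
    from f have f': "f integrable_on cbox a b" by simp
    obtain \<gamma> where g: "gauge \<gamma>" and
      hen: "\<And>p. \<lbrakk>p tagged_partial_division_of (cbox a b); \<gamma> fine p\<rbrakk> \<Longrightarrow>
             sum (\<lambda>(x,k). norm(measure lborel k *\<^sub>R f x - integral k f)) p < e / real (Suc k)"
      using Henstock_lemma[OF f' e'] by blast
    \<comment> \<open>The tag x is an endpoint of its interval. The covering theorem only asks that
      x lie in the closed ball, not that it be the centre, so quotients from either side are
      covered.\<close>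
    define I where "I = {(x,y). x \<in> {a..b} \<and> y \<in> {a..b} \<and> y \<noteq> x \<and> J (x,y) \<subseteq> \<gamma> x \<and> bad k x y}"
    define cen where "cen = (\<lambda>(x::real, y). (x + y) / 2)"
    define rad where "rad = (\<lambda>(x::real, y). \<bar>y - x\<bar> / 2)"
    have cb: "cball (cen i) (rad i) = J i" for i
      by (cases i) (auto simp: cen_def rad_def J_def cball_eq_atLeastAtMost min_def max_def field_simps abs_if)
    obtain C where C: "countable C" "C \<subseteq> I"
      "pairwise (\<lambda>i j. disjnt (cball (cen i) (rad i)) (cball (cen j) (rad j))) C"
      "negligible (Bad k - (\<Union>i \<in> C. cball (cen i) (rad i)))"
    proof (rule Vitali_covering_theorem_cballs[of I rad "Bad k" cen])
      show "0 < rad i" if "i \<in> I" for i using that by (auto simp: I_def rad_def)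
    next
      fix x d :: real assume x: "x \<in> Bad k" and d: "0 < d"
      obtain r where r: "r > 0" "ball x r \<subseteq> \<gamma> x"
        using g by (meson gauge_def open_contains_ball)
      obtain y where y: "y \<in> {a..b}" "y \<noteq> x" "\<bar>y - x\<bar> < min r d" "bad k x y"
        using x r(1) d unfolding Bad_def by (smt (verit, best) mem_Collect_eq)
      have "J (x,y) \<subseteq> ball x r" using y by (auto simp: J_def dist_real_def min_def max_def split: if_splits)
      then have "(x,y) \<in> I" using y x r by (auto simp: I_def Bad_def)
      moreover have "x \<in> cball (cen (x,y)) (rad (x,y))" unfolding cb by (auto simp: J_def)
      moreover have "rad (x,y) < d" using y d by (simp add: rad_def)
      ultimately show "\<exists>i. i \<in> I \<and> x \<in> cball (cen i) (rad i) \<and> rad i < d" by blast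
    qed
    have le: "(measure lebesgue (\<Union>i\<in>D. J i)) \<le> e" if D: "D \<subseteq> C" "finite D" for D
    proof -
      \<comment> \<open>Since the tag is an endpoint, tag and interval determine the other endpoint;
        a sum over the partial division is thus a sum over D.\<close>
      have inj: "inj_on (\<lambda>i. (fst i, J i)) D"
        by (rule inj_onI) (auto simp: J_def min_def max_def split: if_splits)
      define p where "p = (\<lambda>i. (fst i, J i)) ` D"
      have "p tagged_partial_division_of (cbox a b)"
        unfolding tagged_partial_division_of_def
      proof (intro conjI allI impI)
        show "finite p" using D by (simp add: p_def)
      next
        fix x K assume "(x,K) \<in> p"
        then obtain y where y: "(x,y) \<in> I" "K = J (x,y)" using D C(2) by (auto simp: p_def)
        then show "x \<in> K" "K \<subseteq> cbox a b" "\<exists>a b. K = cbox a b"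
          by (auto simp: J_def I_def min_def max_def split: if_splits)
      next
        fix x1 K1 x2 K2
        assume "(x1,K1) \<in> p \<and> (x2,K2) \<in> p \<and> (x1,K1) \<noteq> (x2,K2)"
        then obtain i j where ij: "i \<in> D" "j \<in> D" "K1 = J i" "K2 = J j" "i \<noteq> j"
          by (auto simp: p_def)
        then have "disjnt K1 K2" using C(3) D(1) unfolding cb pairwise_def by blast
        then show "interior K1 \<inter> interior K2 = {}"
          using interior_subset unfolding disjnt_def by blast
      qed
      moreover have "\<gamma> fine p"
        unfolding fine_def p_def
      proof clarsimp
        fix x y z assume "(x, y) \<in> D" "z \<in> J (x, y)"
        moreover from this have "(x,y) \<in> I" using D C(2) by auto
        ultimately show "z \<in> \<gamma> x" by (auto simp: I_def)
      qed
      ultimately have "sum (\<lambda>(x,k). norm(measure lborel k *\<^sub>R f x - integral k f)) p < e / real (Suc k)"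
        by (rule hen)
      also have "sum (\<lambda>(x,k). norm(measure lborel k *\<^sub>R f x - integral k f)) p
          = (\<Sum>i\<in>D. \<bar>measure lborel (J i) * f (fst i) - integral (J i) f\<bar>)"
        unfolding p_def by (subst sum.reindex[OF inj]) simp
      finally have 1: "(\<Sum>i\<in>D. \<bar>measure lborel (J i) * f (fst i) - integral (J i) f\<bar>) < e / real (Suc k)" .
      have "(\<Sum>i\<in>D. measure lborel (J i) / real (Suc k)) \<le> (\<Sum>i\<in>D. \<bar>measure lborel (J i) * f (fst i) - integral (J i) f\<bar>)"
      proof (rule sum_mono)
        fix i assume "i \<in> D"
        then have "i \<in> I" using D C by auto
        then obtain x y where xy: "i = (x,y)" "x \<in> {a..b}" "y \<in> {a..b}" "bad k x y"
          by (auto simp: I_def)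
        have "measure lborel (J i) = \<bar>y - x\<bar>" by (auto simp: J_def xy min_def max_def)
        then show "measure lborel (J i) / real (Suc k) \<le> \<bar>measure lborel (J i) * f (fst i) - integral (J i) f\<bar>"
          using FJ[OF xy(2,3)] xy by (simp add: bad_def)
      qed
      with 1 have "(\<Sum>i\<in>D. measure lborel (J i)) / real (Suc k) < e / real (Suc k)"
        by (simp only: sum_divide_distrib[symmetric])
      then have 2: "(\<Sum>i\<in>D. measure lborel (J i)) < e" by (simp add: divide_less_cancel)
      have "measure lebesgue (\<Union>i\<in>D. J i) \<le> (\<Sum>i\<in>D. measure lebesgue (J i))"
        using D by (intro measure_UNION_le) (auto simp: J_def)
      also have "\<dots> = (\<Sum>i\<in>D. measure lborel (J i))"
        by (auto simp: J_def intro!: sum.cong)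
      finally show ?thesis using 2 by simp
    qed
    have m: "J i \<in> lmeasurable" for i by (cases i) (simp add: J_def)
    have U: "(\<Union>i\<in>C. J i) \<in> lmeasurable" "measure lebesgue (\<Union>i\<in>C. J i) \<le> e"
      by (rule fmeasurable_UN_bound[OF C(1) m le] measure_UN_bound[OF C(1) m le]; assumption)+
    define N where "N = Bad k - (\<Union>i\<in>C. J i)"
    have N: "negligible N" using C(4) by (simp add: N_def cb)
    show "\<exists>T. Bad k \<subseteq> T \<and> T \<in> lmeasurable \<and> measure lebesgue T \<le> e"
    proof (intro exI conjI)
      show "Bad k \<subseteq> N \<union> (\<Union>i\<in>C. J i)" by (auto simp: N_def)
      show "N \<union> (\<Union>i\<in>C. J i) \<in> lmeasurable"
        using N U by (simp add: negligible_imp_measurable fmeasurable.Un)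
      show "measure lebesgue (N \<union> (\<Union>i\<in>C. J i)) \<le> e"
        using measure_Un_le[of N lebesgue "\<Union>i\<in>C. J i"] N U
        by (simp add: negligible_imp_measure0 fmeasurableD negligible_imp_sets)
    qed
  qed
  then have "negligible (\<Union>k. Bad k)" by (auto intro!: negligible_countable_Union)
  moreover have "{x \<in> {a..b}. \<not> (F has_real_derivative f x) (at x within {a..b})} \<subseteq> (\<Union>k. Bad k)"
  proof (intro subsetI, rule ccontr)
    fix x assume x: "x \<in> {x \<in> {a..b}. \<not> (F has_real_derivative f x) (at x within {a..b})}"
      and nB: "x \<notin> (\<Union>k. Bad k)"
    have "((\<lambda>y. (F y - F x) / (y - x)) \<longlongrightarrow> f x) (at x within {a..b})"
    proof (rule tendstoI)
      fix e :: real assume "e > 0"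
      then obtain k where k: "1 / real (Suc k) < e" using nat_approx_posE by blast
      from nB have "x \<notin> Bad k" by auto
      with x obtain d where d: "d > 0" "\<And>y. y \<in> {a..b} \<Longrightarrow> y \<noteq> x \<Longrightarrow> \<bar>y - x\<bar> < d \<Longrightarrow> \<not> bad k x y"
        unfolding Bad_def by blast
      show "\<forall>\<^sub>F y in at x within {a..b}. dist ((F y - F x) / (y - x)) (f x) < e"
        unfolding eventually_at
      proof (intro exI[of _ d] conjI ballI impI d(1))
        fix y assume y: "y \<in> {a..b}" "y \<noteq> x \<and> dist y x < d"
        then have "\<bar>F y - F x - f x * (y - x)\<bar> < \<bar>y - x\<bar> / real (Suc k)"
          using d(2)[of y] by (auto simp: bad_def dist_real_def)
        moreover have "(F y - F x) / (y - x) - f x = (F y - F x - f x * (y - x)) / (y - x)"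
          using y by (simp add: diff_divide_distrib)
        ultimately have "\<bar>(F y - F x) / (y - x) - f x\<bar> < 1 / real (Suc k)"
          using y by (simp add: abs_divide field_simps)
        then show "dist ((F y - F x) / (y - x)) (f x) < e" using k by (simp add: dist_real_def)
      qed
    qed
    then show False using x by (simp add: has_field_derivative_iff)
  qed
  ultimately show ?thesis unfolding F_def by (rule negligible_subset)
qed

lemma integration_by_parts_AC:
  fixes f g f' g' :: "real \<Rightarrow> real"
  assumes cd: "c \<le> d" and f': "f' absolutely_integrable_on {c..d}"
    and f: "\<And>x. x \<in> {c..d} \<Longrightarrow> f x = f c + integral {c..x} f'"
    and g: "\<And>x. x \<in> {c..d} \<Longrightarrow> (g has_real_derivative g' x) (at x within {c..d})"
    and g': "continuous_on {c..d} g'"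
  shows "((\<lambda>x. f' x * g x + f x * g' x) has_integral (f d * g d - f c * g c)) {c..d}"
proof -
  have f'i: "f' integrable_on {c..d}" and fa: "(\<lambda>x. \<bar>f' x\<bar>) integrable_on {c..d}"
    using f' by (auto simp: absolutely_integrable_on_def)
  have cg: "continuous_on {c..d} g" using g by (rule DERIV_continuous_on)
  have cf: "continuous_on {c..d} f"
  proof -
    have "continuous_on {c..d} (\<lambda>x. f c + integral {c..x} f')"
      by (intro continuous_intros indefinite_integral_continuous_1[OF f'i])
    then show ?thesis by (rule continuous_on_eq) (rule f[symmetric])
  qed
  define k where "k = (\<lambda>x. f' x * g x + f x * g' x)"
  have "(\<lambda>x. g x *\<^sub>R f' x) absolutely_integrable_on {c..d}"
    unfolding real_scaleR_def using f'
    by (intro absolutely_integrable_bounded_measurable_product_real)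
       (auto intro!: continuous_imp_measurable_on_sets_lebesgue cg compact_imp_bounded compact_continuous_image)
  then have ai: "(\<lambda>x. f' x * g x) integrable_on {c..d}"
    by (simp add: mult.commute set_lebesgue_integral_eq_integral)
  have k: "k integrable_on {c..d}" unfolding k_def
    by (intro integrable_add ai integrable_continuous_real continuous_intros cf g')
  define h where "h = (\<lambda>x. f x * g x - integral {c..x} k)"
  define \<Phi> where "\<Phi> = (\<lambda>x. integral {c..x} (\<lambda>x. \<bar>f' x\<bar>))"
  obtain B where B: "\<And>x. x \<in> {c..d} \<Longrightarrow> \<bar>g' x\<bar> \<le> B"
    using compact_imp_bounded[OF compact_continuous_image[OF g' compact_Icc]]
    unfolding bounded_iff real_norm_def by (metis imageI)
  have c\<Phi>: "continuous_on {c..d} \<Phi>" unfolding \<Phi>_def by (rule indefinite_integral_continuous_1[OF fa])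
  have lip: "\<bar>g y - g x\<bar> \<le> B * \<bar>y - x\<bar>" if "x \<in> {c..d}" "y \<in> {c..d}" for x y
    using field_differentiable_bound[of "{c..d}" g g' B y x] g B that by (simp add: abs_minus_commute)
  have main: "\<bar>h y - h x\<bar> \<le> 2 * B * \<bar>y - x\<bar> * \<bar>\<Phi> y - \<Phi> x\<bar>" if xy: "c \<le> x" "x \<le> y" "y \<le> d" for x y
  proof -
    have sub: "u integrable_on {x..y}" if "u integrable_on {c..d}" for u :: "real \<Rightarrow> real"
      using that xy by (auto intro: integrable_on_subinterval)
    have comb: "integral {c..y} u - integral {c..x} u = integral {x..y} u" if "u integrable_on {c..d}" for u :: "real \<Rightarrow> real"
      using Henstock_Kurzweil_Integration.integral_combine[of c x y u] xy that
      by (smt (verit) atLeastatMost_subset_iff integrable_on_subinterval)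
    have df: "\<bar>f s - f x\<bar> \<le> \<Phi> y - \<Phi> x" if s: "s \<in> {x..y}" for s
    proof -
      have "f s - f x = integral {x..s} f'"
        using f[of s] f[of x] s xy Henstock_Kurzweil_Integration.integral_combine[of c x s f'] integrable_on_subinterval[OF f'i, of c s] by auto
      also have "\<bar>\<dots>\<bar> \<le> integral {x..s} (\<lambda>x. \<bar>f' x\<bar>)"
        using integral_norm_bound_integral[of f' "{x..s}" "\<lambda>x. \<bar>f' x\<bar>"] s xy integrable_on_subinterval[OF f'i, of x s] integrable_on_subinterval[OF fa, of x s] by auto
      also have "\<dots> \<le> integral {x..y} (\<lambda>x. \<bar>f' x\<bar>)"
        using s xy integrable_on_subinterval[OF fa, of x s] integrable_on_subinterval[OF fa, of x y]
        by (intro integral_subset_le) auto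
      also have "\<dots> = \<Phi> y - \<Phi> x" unfolding \<Phi>_def using comb[OF fa] by simp
      finally show ?thesis .
    qed
    have \<Phi>0: "0 \<le> \<Phi> y - \<Phi> x" using df[of x] xy by auto
    have e1: "h y - h x = f y * g y - f x * g x - integral {x..y} k"
      using comb[OF k] by (simp add: h_def)
    have gd: "(g' has_integral g y - g x) {x..y}"
      using xy by (intro fundamental_theorem_of_calculus)
        (auto simp: has_real_derivative_iff_has_vector_derivative[symmetric] intro!: DERIV_subset[OF g])
    have fd: "(f' has_integral f y - f x) {x..y}"
      using f[of y] f[of x] xy comb[OF f'i] sub[OF f'i] by (auto simp: has_integral_iff)
    \<comment> \<open>Freezing g at y and f at x integrates to exactly f y g y - f x g x; the
      difference to \<open>k\<close> then contains only the small quantities g y - g s and f x - f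
      s.\<close>
    have i1: "((\<lambda>s. f' s * g y + g' s * f x) has_integral (f y - f x) * g y + (g y - g x) * f x) {x..y}"
      by (intro has_integral_add has_integral_mult_left gd fd)
    have i2: "((\<lambda>s. f' s * g y + g' s * f x - k s) has_integral (f y - f x) * g y + (g y - g x) * f x - integral {x..y} k) {x..y}"
      by (intro has_integral_diff i1) (use sub[OF k] in auto)
    have "(f y - f x) * g y + (g y - g x) * f x - integral {x..y} k = h y - h x"
      unfolding e1 by (simp add: algebra_simps)
    moreover have "(\<lambda>s. f' s * g y + g' s * f x - k s) = (\<lambda>s. f' s * (g y - g s) + g' s * (f x - f s))"
      by (simp add: k_def algebra_simps fun_eq_iff)
    ultimately have i3: "((\<lambda>s. f' s * (g y - g s) + g' s * (f x - f s)) has_integral h y - h x) {x..y}"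
      using i2 by metis
    have i4: "((\<lambda>s. B * (y - x) * \<bar>f' s\<bar> + B * (\<Phi> y - \<Phi> x)) has_integral B * (y - x) * (\<Phi> y - \<Phi> x) + (y - x) *\<^sub>R (B * (\<Phi> y - \<Phi> x))) {x..y}"
      using comb[OF fa] sub[OF fa] xy has_integral_const_real[of "B * (\<Phi> y - \<Phi> x)" x y]
      by (intro has_integral_add has_integral_mult_right) (auto simp: has_integral_iff \<Phi>_def)
    have "\<bar>h y - h x\<bar> \<le> B * (y - x) * (\<Phi> y - \<Phi> x) + (y - x) *\<^sub>R (B * (\<Phi> y - \<Phi> x))"
    proof -
      have "norm (integral {x..y} (\<lambda>s. f' s * (g y - g s) + g' s * (f x - f s))) \<le> integral {x..y} (\<lambda>s. B * (y - x) * \<bar>f' s\<bar> + B * (\<Phi> y - \<Phi> x))"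
      proof (rule integral_norm_bound_integral)
        fix s assume s: "s \<in> {x..y}"
        have B0: "0 \<le> B" using B[of x] xy by auto
        have "\<bar>f' s * (g y - g s)\<bar> \<le> \<bar>f' s\<bar> * (B * (y - x))"
        proof -
          have "\<bar>g y - g s\<bar> \<le> B * \<bar>y - s\<bar>" using lip[of s y] s xy by auto
          also have "\<dots> \<le> B * (y - x)" using s B0 by (intro mult_left_mono) auto
          finally show ?thesis unfolding abs_mult by (intro mult_left_mono) auto
        qed
        moreover have "\<bar>g' s * (f x - f s)\<bar> \<le> B * (\<Phi> y - \<Phi> x)"
          unfolding abs_mult using df[OF s] B[of s] s xy B0 by (intro mult_mono) auto
        moreover have "\<bar>f' s\<bar> * (B * (y - x)) = B * (y - x) * \<bar>f' s\<bar>" by simp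
        ultimately show "norm (f' s * (g y - g s) + g' s * (f x - f s)) \<le> B * (y - x) * \<bar>f' s\<bar> + B * (\<Phi> y - \<Phi> x)"
          using abs_triangle_ineq[of "f' s * (g y - g s)" "g' s * (f x - f s)"] unfolding real_norm_def by linarith
      qed (use i3 i4 in auto)
      then show ?thesis using i3 i4 by (simp add: integral_unique)
    qed
    also have "\<dots> = 2 * B * \<bar>y - x\<bar> * \<bar>\<Phi> y - \<Phi> x\<bar>" using xy \<Phi>0 by simp
    finally show ?thesis .
  qed
  have main2: "\<bar>h y - h x\<bar> \<le> 2 * B * \<bar>y - x\<bar> * \<bar>\<Phi> y - \<Phi> x\<bar>" if xy: "x \<in> {c..d}" "y \<in> {c..d}" for x y
    using main[of x y] main[of y x] that by (cases "x \<le> y") (auto simp: abs_minus_commute)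
  have "(h has_real_derivative 0) (at x within {c..d})" if x: "x \<in> {c..d}" for x
    unfolding has_field_derivative_iff
  proof (rule tendsto_0_le[where K = 1])
    have "((\<lambda>y. \<Phi> y - \<Phi> x) \<longlongrightarrow> \<Phi> x - \<Phi> x) (at x within {c..d})"
      using c\<Phi> x by (intro tendsto_intros) (auto simp: continuous_on_def)
    then have "((\<lambda>y. \<Phi> y - \<Phi> x) \<longlongrightarrow> 0) (at x within {c..d})" by (simp only: diff_self)
    from tendsto_mult_right_zero[OF tendsto_rabs_zero[OF this], of "2 * B"]
    show "((\<lambda>y. 2 * B * \<bar>\<Phi> y - \<Phi> x\<bar>) \<longlongrightarrow> 0) (at x within {c..d})" .
    show "\<forall>\<^sub>F y in at x within {c..d}. norm ((h y - h x) / (y - x)) \<le> norm (2 * B * \<bar>\<Phi> y - \<Phi> x\<bar>) * 1"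
      unfolding eventually_at
    proof (intro exI[of _ 1] conjI ballI impI)
      fix y assume y: "y \<in> {c..d}" "y \<noteq> x \<and> dist y x < 1"
      then have "\<bar>h y - h x\<bar> / \<bar>y - x\<bar> \<le> 2 * B * \<bar>\<Phi> y - \<Phi> x\<bar>"
        using main2[OF x y(1)] by (simp add: divide_le_eq mult_ac)
      then show "norm ((h y - h x) / (y - x)) \<le> norm (2 * B * \<bar>\<Phi> y - \<Phi> x\<bar>) * 1" by simp
    qed simp
  qed
  then have "h d = h c"
    using has_field_derivative_zero_constant[of "{c..d}" h] cd by force
  then have "integral {c..d} k = f d * g d - f c * g c" by (simp add: h_def)
  then show ?thesis using k unfolding k_def by (auto simp: has_integral_iff)
qed

section \<open>Weighted square-integrable functions\<close>

text \<open>A quadratic in t that is never negative has nonpositive discriminant. The cases C = 0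
  and C < 0 need witnesses of their own, because completing the square divides by C. Both
  Cauchy-Schwarz inequalities below are instances.\<close>

lemma discriminant_le:
  fixes A B C :: real
  assumes "\<And>t. A + 2 * t * B + t\<^sup>2 * C \<ge> 0"
  shows "B\<^sup>2 \<le> A * C"
proof (cases "C = 0")
  case True
  have "B = 0"
  proof (rule ccontr)
    assume "B \<noteq> 0"
    \<comment> \<open>With C = 0 this t gives the value -1.\<close>
    then show False using assms[of "- (A + 1) / (2 * B)"] True by (simp add: field_simps)
  qed
  then show ?thesis using True by simp
next
  case False
  have "C \<ge> 0"
  proof (rule ccontr)
    assume C: "\<not> C \<ge> 0"
    \<comment> \<open>Chosen so that t |C| = |A| + 2 |B| + |C| and t >= 1, which makes the quadratic
      term outweigh the other two.\<close>
    define t where "t = (\<bar>A\<bar> + 2 * \<bar>B\<bar>) / \<bar>C\<bar> + 1"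
    have "0 \<le> (\<bar>A\<bar> + 2 * \<bar>B\<bar>) / \<bar>C\<bar>" by (intro divide_nonneg_nonneg) auto
    then have t: "t \<ge> 1" unfolding t_def by linarith
    have "t * \<bar>C\<bar> = \<bar>A\<bar> + 2 * \<bar>B\<bar> + \<bar>C\<bar>" using C by (simp add: t_def field_simps)
    then have "t * (t * \<bar>C\<bar>) = t * (\<bar>A\<bar> + 2 * \<bar>B\<bar> + \<bar>C\<bar>)" by simp
    also have "\<dots> \<ge> 1 * \<bar>A\<bar> + t * (2 * \<bar>B\<bar>) + 1 * \<bar>C\<bar>"
      unfolding distrib_left using t by (intro add_mono mult_right_mono) auto
    finally have "t\<^sup>2 * \<bar>C\<bar> \<ge> \<bar>A\<bar> + 2 * t * \<bar>B\<bar> + \<bar>C\<bar>" by (simp add: power2_eq_square mult_ac)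
    moreover have "2 * t * B \<le> 2 * t * \<bar>B\<bar>" using t by (intro mult_left_mono) auto
    moreover have "t\<^sup>2 * C = - (t\<^sup>2 * \<bar>C\<bar>)" using C by simp
    ultimately show False using assms[of t] C abs_ge_self[of A] by linarith
  qed
  with False have C: "C > 0" by simp
  have "A - B\<^sup>2 / C \<ge> 0"
    using assms[of "- B / C"] C by (simp add: field_simps power2_eq_square)
  then show ?thesis using C by (simp add: field_simps)
qed

lemma L2_iff_borel:
  "L2 f \<longleftrightarrow> f \<in> borel_measurable (lebesgue_on {0..1}) \<and> (\<lambda>x. (f x)\<^sup>2) integrable_on {0..1}"
  unfolding L2_def by (simp add: measurable_on_iff_borel_measurable)

text \<open>One theory serves the plain space (weight 1) and the space weighted by 1/a. Zeros of the
  weight are allowed because a(0) = 0: division by zero yields 0, which for a concerns only the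
  point 0.\<close>

definition weight :: "(real \<Rightarrow> real) \<Rightarrow> bool" where
  "weight w \<longleftrightarrow> w \<in> borel_measurable (lebesgue_on {0..1}) \<and> (\<forall>x\<in>{0..1}. 0 \<le> w x)"

definition ipw :: "(real \<Rightarrow> real) \<Rightarrow> (real \<Rightarrow> real) \<Rightarrow> (real \<Rightarrow> real) \<Rightarrow> real" where
  "ipw w f g = integral {0..1} (\<lambda>x. f x * g x / w x)"

lemma weight_one [simp]: "weight (\<lambda>_. 1)" by (simp add: weight_def)

lemma L2w_one [simp]: "L2w (\<lambda>_. 1) f \<longleftrightarrow> L2 f" by (auto simp: L2w_def L2_def)

lemma absolutely_integrable_weighted_product:
  assumes w: "weight w" and f: "L2w w f" and g: "L2w w g"
  shows "(\<lambda>x. f x * g x / w x) absolutely_integrable_on {0..1}"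
proof (rule measurable_bounded_by_integrable_imp_absolutely_integrable)
  show "(\<lambda>x. f x * g x / w x) \<in> borel_measurable (lebesgue_on {0..1})"
    using w f g by (auto simp: weight_def L2w_def L2_iff_borel)
  show "(\<lambda>x. (f x)\<^sup>2 / w x + (g x)\<^sup>2 / w x) integrable_on {0..1}"
    using f g by (intro integrable_add) (auto simp: L2w_def)
  fix x :: real assume x: "x \<in> {0..1}"
  have "\<bar>f x * g x\<bar> \<le> (f x)\<^sup>2 + (g x)\<^sup>2"
    using sum_squares_bound[of "\<bar>f x\<bar>" "\<bar>g x\<bar>"] mult_nonneg_nonneg[of "\<bar>f x\<bar>" "\<bar>g x\<bar>"]
    unfolding abs_mult power2_abs by linarith
  then have "\<bar>f x * g x\<bar> / w x \<le> ((f x)\<^sup>2 + (g x)\<^sup>2) / w x"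
    using w x by (intro divide_right_mono) (auto simp: weight_def)
  then show "norm (f x * g x / w x) \<le> (f x)\<^sup>2 / w x + (g x)\<^sup>2 / w x"
    using w x by (simp add: weight_def add_divide_distrib)
qed auto

lemma integrable_weighted_product:
  assumes "weight w" "L2w w f" "L2w w g"
  shows "(\<lambda>x. f x * g x / w x) integrable_on {0..1}"
  using absolutely_integrable_weighted_product[OF assms] set_lebesgue_integral_eq_integral(1) by blast

lemma has_integral_ipw:
  assumes "weight w" "L2w w f" "L2w w g"
  shows "((\<lambda>x. f x * g x / w x) has_integral ipw w f g) {0..1}"
  unfolding ipw_def using integrable_weighted_product[OF assms] by auto

lemma L2_lin:
  assumes "L2 f" "L2 g" shows "L2 (\<lambda>x. f x + c * g x)"
  unfolding L2_iff_borel
proof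
  show "(\<lambda>x. f x + c * g x) \<in> borel_measurable (lebesgue_on {0..1})"
    using assms by (auto simp: L2_iff_borel)
  have "(\<lambda>x. (f x)\<^sup>2 + 2 * c * (f x * g x / 1) + c\<^sup>2 * (g x)\<^sup>2) integrable_on {0..1}"
    using assms integrable_weighted_product[of "\<lambda>_. 1" f g]
    by (intro integrable_add integrable_on_mult_right) (auto simp: L2_def)
  then show "(\<lambda>x. (f x + c * g x)\<^sup>2) integrable_on {0..1}"
    by (simp add: power2_eq_square algebra_simps)
qed

lemma L2w_lin:
  assumes "weight w" "L2w w f" "L2w w g" shows "L2w w (\<lambda>x. f x + c * g x)"
  unfolding L2w_def
proof
  show "L2 (\<lambda>x. f x + c * g x)" using assms by (auto simp: L2w_def intro: L2_lin)
  have "(\<lambda>x. (f x)\<^sup>2 / w x + 2 * c * (f x * g x / w x) + c\<^sup>2 * ((g x)\<^sup>2 / w x)) integrable_on {0..1}"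
    using assms integrable_weighted_product[of w f g]
    by (intro integrable_add integrable_on_mult_right) (auto simp: L2w_def)
  then show "(\<lambda>x. (f x + c * g x)\<^sup>2 / w x) integrable_on {0..1}"
    by (simp add: power2_eq_square algebra_simps add_divide_distrib)
qed

lemma L2w_cmul:
  assumes "weight w" "L2w w f" shows "L2w w (\<lambda>x. c * f x)"
  using L2w_lin[OF assms(1,2,2), of "c - 1"] by (simp add: algebra_simps)

lemma ipw_commute: "ipw w f g = ipw w g f" by (simp add: ipw_def mult.commute)

lemma ipw_lin_left:
  assumes "weight w" "L2w w f" "L2w w g" "L2w w h"
  shows "ipw w (\<lambda>x. f x + c * g x) h = ipw w f h + c * ipw w g h"
proof -
  have "((\<lambda>x. f x * h x / w x + c * (g x * h x / w x)) has_integral ipw w f h + c * ipw w g h) {0..1}"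
    using assms by (intro has_integral_add has_integral_mult_right has_integral_ipw)
  then show ?thesis unfolding ipw_def
    by (intro integral_unique) (simp add: algebra_simps add_divide_distrib)
qed

lemma ipw_lin_right:
  assumes "weight w" "L2w w f" "L2w w g" "L2w w h"
  shows "ipw w h (\<lambda>x. f x + c * g x) = ipw w h f + c * ipw w h g"
  using ipw_lin_left[OF assms, of c] by (simp add: ipw_commute)

lemma ipw_nonneg: "weight w \<Longrightarrow> 0 \<le> ipw w f f"
  unfolding ipw_def
  by (cases "(\<lambda>x. f x * f x / w x) integrable_on {0..1}")
     (auto simp: weight_def not_integrable_integral intro!: integral_nonneg)

lemma ipw_square_sum:
  assumes "weight w" "L2w w f" "L2w w g"
  shows "ipw w (\<lambda>x. f x + t * g x) (\<lambda>x. f x + t * g x) = ipw w f f + 2 * t * ipw w f g + t\<^sup>2 * ipw w g g"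
  using assms L2w_lin[OF assms, of t]
  by (simp add: ipw_lin_left ipw_lin_right ipw_commute[of w g f] algebra_simps power2_eq_square)

lemma ipw_Cauchy_Schwarz:
  assumes "weight w" "L2w w f" "L2w w g"
  shows "(ipw w f g)\<^sup>2 \<le> ipw w f f * ipw w g g"
  by (rule discriminant_le) (metis ipw_square_sum[OF assms] ipw_nonneg[OF assms(1)])

text \<open>Nonnegativity of the square norm of f + t g at t = 1/(2d) and t = -1/(2d).\<close>

lemma ipw_Young:
  assumes "weight w" "L2w w f" "L2w w g" "d > 0"
  shows "\<bar>ipw w f g\<bar> \<le> d * ipw w f f + 1 / (4 * d) * ipw w g g"
proof -
  have *: "0 \<le> ipw w f f + 2 * t * ipw w f g + t\<^sup>2 * ipw w g g" for t
    by (metis ipw_square_sum[OF assms(1-3)] ipw_nonneg[OF assms(1)])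
  have "0 \<le> d * ipw w f f + s * ipw w f g + s\<^sup>2 / (4 * d) * ipw w g g" for s
  proof -
    have "0 \<le> d * (ipw w f f + 2 * (s / (2 * d)) * ipw w f g + (s / (2 * d))\<^sup>2 * ipw w g g)"
      using assms(4) by (intro mult_nonneg_nonneg *) auto
    also have "\<dots> = d * ipw w f f + s * ipw w f g + s\<^sup>2 / (4 * d) * ipw w g g"
      using assms(4) by (simp add: field_simps power2_eq_square)
    finally show ?thesis .
  qed
  from this[of 1] this[of "-1"] show ?thesis by (simp add: abs_le_iff)
qed

lemma ipw_cong:
  assumes "negligible N" "\<And>x. x \<in> {0..1} - N \<Longrightarrow> f x = f' x" "\<And>x. x \<in> {0..1} - N \<Longrightarrow> g x = g' x"
  shows "ipw w f g = ipw w f' g'"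
  unfolding ipw_def using assms by (intro integral_spike[of N]) auto

lemma L2_cong:
  assumes "L2 f" "negligible N" "\<And>x. x \<in> {0..1} - N \<Longrightarrow> f x = g x"
  shows "L2 g"
  unfolding L2_def
proof
  have "(\<lambda>x. if x \<in> {0..1} then f x else 0) measurable_on UNIV"
    using assms(1) by (subst measurable_on_UNIV) (simp add: L2_def)
  then have "(\<lambda>x. if x \<in> {0..1} then g x else 0) measurable_on UNIV"
    by (rule measurable_on_spike[of _ _ N]) (use assms in auto)
  then show "g measurable_on {0..1}" by (subst (asm) measurable_on_UNIV)
  have "(\<lambda>x. (f x)\<^sup>2) integrable_on {0..1}" using assms(1) by (simp add: L2_def)
  then show "(\<lambda>x. (g x)\<^sup>2) integrable_on {0..1}"
    by (rule integrable_spike[OF _ assms(2)]) (simp add: assms(3))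
qed

lemma L2w_cong:
  assumes "L2w w f" "negligible N" "\<And>x. x \<in> {0..1} - N \<Longrightarrow> f x = g x"
  shows "L2w w g"
  unfolding L2w_def
proof
  show "L2 g" using assms L2_cong[of f N g] by (auto simp: L2w_def)
  have "(\<lambda>x. (f x)\<^sup>2 / w x) integrable_on {0..1}" using assms(1) by (simp add: L2w_def)
  then show "(\<lambda>x. (g x)\<^sup>2 / w x) integrable_on {0..1}"
    by (rule integrable_spike[OF _ assms(2)]) (simp add: assms(3))
qed

lemma L2_continuous:
  assumes "continuous_on {0..1} f" shows "L2 f"
  unfolding L2_iff_borel using assms
  by (auto intro!: integrable_continuous_real continuous_intros continuous_imp_measurable_on_sets_lebesgue)

lemma L2_bounded:
  assumes "f \<in> borel_measurable (lebesgue_on {0..1})" "\<And>x. x \<in> {0..1} \<Longrightarrow> \<bar>f x\<bar> \<le> B"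
  shows "L2 f"
  unfolding L2_iff_borel
proof
  show "(\<lambda>x. (f x)\<^sup>2) integrable_on {0..1}"
  proof (rule measurable_bounded_by_integrable_imp_integrable)
    show "(\<lambda>x. (f x)\<^sup>2) \<in> borel_measurable (lebesgue_on {0..1})" using assms(1) by auto
    show "norm ((f x)\<^sup>2) \<le> B\<^sup>2" if "x \<in> {0..1}" for x
      using power_mono[OF assms(2)[OF that], of 2] by simp
  qed auto
qed (rule assms(1))

lemma L2_absolutely_integrable:
  assumes "L2 f" shows "f absolutely_integrable_on {0..1}"
  using absolutely_integrable_weighted_product[of "\<lambda>_. 1" f "\<lambda>_. 1"] assms
  by (simp add: L2_continuous)

lemma L2_integrable:
  assumes "L2 f" shows "f integrable_on {0..1}"
  using L2_absolutely_integrable[OF assms] set_lebesgue_integral_eq_integral(1) by blast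

section \<open>One-dimensional Sobolev functions\<close>

abbreviation "Dx2 u \<equiv> Dx (Dx u)"

abbreviation "Dx3 u \<equiv> Dx (Dx (Dx u))"

abbreviation "Dx4 u \<equiv> Dx (Dx (Dx (Dx u)))"

abbreviation "ipw1 \<equiv> ipw (\<lambda>_. 1)"

abbreviation "bending u \<equiv> ipw (\<lambda>_. 1) (Dx (Dx u)) (Dx (Dx u))"

lemma Dx_eqI:
  assumes "x \<in> {0..1}" "(f has_real_derivative d) (at x within {0..1})"
  shows "Dx f x = d"
  unfolding Dx_def
  using assms by (intro vector_derivative_within_closed_interval) (auto simp: has_real_derivative_iff_has_vector_derivative)

lemma Dx_cong:
  assumes "\<And>x. x \<in> {0..1} \<Longrightarrow> f x = g x" "x \<in> {0..1}"
  shows "Dx f x = Dx g x"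
  unfolding Dx_def by (rule vector_derivative_cong_eq) (use assms in \<open>auto simp: eventually_at_filter\<close>)

lemma H1_cong:
  assumes "H1 f" "\<And>x. x \<in> {0..1} \<Longrightarrow> f x = g x"
  shows "H1 g"
  unfolding H1_def
proof (intro conjI ballI)
  have D: "Dx f x = Dx g x" if "x \<in> {0..1}" for x using Dx_cong[OF assms(2) that] .
  show "L2 (Dx g)" using assms(1) D by (auto simp: H1_def intro: L2_cong[of _ "{}"])
  fix x :: real assume x: "x \<in> {0..1}"
  have "integral {0..x} (Dx f) = integral {0..x} (Dx g)"
    using x by (intro Henstock_Kurzweil_Integration.integral_cong D) auto
  moreover have "f x = f 0 + integral {0..x} (Dx f)" using assms(1) x unfolding H1_def by blast
  moreover have "f x = g x" "f 0 = g 0" using assms(2) x by auto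
  ultimately show "g x = g 0 + integral {0..x} (Dx g)" by argo
qed

lemma H1_D:
  assumes "H1 f"
  shows "L2 (Dx f)" "\<And>x. x \<in> {0..1} \<Longrightarrow> f x = f 0 + integral {0..x} (Dx f)"
  using assms unfolding H1_def by (blast, metis)

lemma has_real_derivative_cong_within:
  fixes f g :: "real \<Rightarrow> real"
  assumes "(f has_real_derivative d) (at x within S)" "x \<in> S" "\<And>y. y \<in> S \<Longrightarrow> f y = g y"
  shows "(g has_real_derivative d) (at x within S)"
  by (rule has_field_derivative_transform_within[OF assms(1) zero_less_one assms(2)]) (rule assms(3))

lemma H1_continuous:
  assumes "H1 f" shows "continuous_on {0..1} f"
proof -
  have "continuous_on {0..1} (\<lambda>x. f 0 + integral {0..x} (Dx f))"
    by (intro continuous_intros indefinite_integral_continuous_1 L2_integrable H1_D(1)[OF assms])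
  then show ?thesis by (rule continuous_on_eq) (rule H1_D(2)[OF assms, symmetric])
qed

text \<open>\<open>Dx f\<close> is an arbitrary choice wherever f has no derivative; the integral
  representation in \<open>H1\<close> together with the differentiation theorem confines those
  points to a null set.\<close>

lemma H1_derivative_ae:
  assumes "H1 f"
  obtains N where "negligible N"
    "\<And>x. x \<in> {0..1} - N \<Longrightarrow> (f has_real_derivative Dx f x) (at x within {0..1})"
proof
  define N where "N = {x \<in> {0..1}. \<not> ((\<lambda>x. integral {0..x} (Dx f)) has_real_derivative Dx f x) (at x within {0..1})}"
  show "negligible N" unfolding N_def
    by (intro negligible_nondifferentiable_indefinite_integral L2_integrable H1_D(1)[OF assms])
  fix x assume x: "x \<in> {0..1} - N"
  then have "((\<lambda>x. f 0 + integral {0..x} (Dx f)) has_real_derivative Dx f x) (at x within {0..1})"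
    by (auto simp: N_def intro!: derivative_eq_intros)
  then show "(f has_real_derivative Dx f x) (at x within {0..1})"
    by (rule has_real_derivative_cong_within) (use x H1_D(2)[OF assms, symmetric] in auto)
qed

text \<open>Lets a candidate derivative g stand in for the choice values of \<open>Dx f\<close>,
  from which it may differ on a null set.\<close>

lemma H1I:
  assumes L: "L2 g" and f: "\<And>x. x \<in> {0..1} \<Longrightarrow> f x = f 0 + integral {0..x} g"
    and N: "negligible N" "\<And>x. x \<in> {0..1} - N \<Longrightarrow> (f has_real_derivative g x) (at x within {0..1})"
  shows "H1 f" "\<And>x. x \<in> {0..1} - N \<Longrightarrow> Dx f x = g x"
proof -
  show D: "Dx f x = g x" if "x \<in> {0..1} - N" for x using N(2)[OF that] Dx_eqI[of x f] that by auto
  show "H1 f" unfolding H1_def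
  proof (intro conjI ballI)
    show "L2 (Dx f)" by (rule L2_cong[OF L N(1)]) (use D in auto)
    fix x :: real assume x: "x \<in> {0..1}"
    have "integral {0..x} (Dx f) = integral {0..x} g"
      using x D by (intro integral_spike[OF N(1)]) auto
    then show "f x = f 0 + integral {0..x} (Dx f)" using f[OF x] by simp
  qed
qed

lemma H1_C1:
  assumes d: "\<And>x. x \<in> {0..1} \<Longrightarrow> (f has_real_derivative g x) (at x within {0..1})"
    and c: "continuous_on {0..1} g"
  shows "H1 f" "\<And>x. x \<in> {0..1} \<Longrightarrow> Dx f x = g x"
proof -
  have "f x = f 0 + integral {0..x} g" if x: "x \<in> {0..1}" for x
  proof -
    have "(g has_integral (f x - f 0)) {0..x}"
      using x by (intro fundamental_theorem_of_calculus)
       (auto simp: has_real_derivative_iff_has_vector_derivative[symmetric] intro!: DERIV_subset[OF d])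
    then show ?thesis by (simp add: integral_unique)
  qed
  from H1I[OF L2_continuous[OF c] this, of "{}"] d
  show "H1 f" "\<And>x. x \<in> {0..1} \<Longrightarrow> Dx f x = g x" by auto
qed

text \<open>\<open>Dx\<close> is additive only almost everywhere: a sum may be differentiable where
  neither summand is, so the exceptional null set is part of the conclusion.\<close>

lemma H1_lin:
  assumes f: "H1 f" and g: "H1 g"
  obtains N where "H1 (\<lambda>x. f x + c * g x)" "negligible N"
    "\<And>x. x \<in> {0..1} - N \<Longrightarrow> Dx (\<lambda>x. f x + c * g x) x = Dx f x + c * Dx g x"
proof -
  obtain M where M: "negligible M" "\<And>x. x \<in> {0..1} - M \<Longrightarrow> (f has_real_derivative Dx f x) (at x within {0..1})"
    using H1_derivative_ae[OF f] by blast
  obtain N where N: "negligible N" "\<And>x. x \<in> {0..1} - N \<Longrightarrow> (g has_real_derivative Dx g x) (at x within {0..1})"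
    using H1_derivative_ae[OF g] by blast
  have L: "L2 (\<lambda>x. Dx f x + c * Dx g x)" using f g by (intro L2_lin H1_D)
  have e: "f x + c * g x = f 0 + c * g 0 + integral {0..x} (\<lambda>x. Dx f x + c * Dx g x)" if x: "x \<in> {0..1}" for x
  proof -
    have "integral {0..x} (\<lambda>x. Dx f x + c * Dx g x) = integral {0..x} (Dx f) + integral {0..x} (\<lambda>x. c * Dx g x)"
      using x integrable_on_subinterval[OF L2_integrable[OF H1_D(1)[OF f]], of 0 x]
        integrable_on_subinterval[OF L2_integrable[OF H1_D(1)[OF g]], of 0 x]
      by (intro integral_add integrable_on_mult_right) auto
    then show ?thesis using H1_D(2)[OF f x] H1_D(2)[OF g x] by (simp add: algebra_simps)
  qed
  have d: "((\<lambda>x. f x + c * g x) has_real_derivative Dx f x + c * Dx g x) (at x within {0..1})"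
    if "x \<in> {0..1} - (M \<union> N)" for x
    using M(2)[of x] N(2)[of x] that by (auto intro!: derivative_eq_intros)
  have n: "negligible (M \<union> N)" using M N by auto
  show thesis
  proof (rule that[OF _ n])
    show "H1 (\<lambda>x. f x + c * g x)" by (rule H1I(1)[OF L e n d])
    show "Dx (\<lambda>x. f x + c * g x) x = Dx f x + c * Dx g x" if "x \<in> {0..1} - (M \<union> N)" for x
      by (rule H1I(2)[OF L e n d that])
  qed
qed

lemma continuous_AC_derivative:
  assumes "\<And>x. x \<in> {c..d} \<Longrightarrow> f x = f c + integral {c..x} g" "continuous_on {c..d} g" "x \<in> {c..d}"
  shows "(f has_real_derivative g x) (at x within {c..d})"
proof -
  have "((\<lambda>x. f c + integral {c..x} g) has_real_derivative g x) (at x within {c..d})"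
    using integral_has_real_derivative[OF assms(2,3)] by (auto intro!: derivative_eq_intros)
  then show ?thesis
    by (rule has_real_derivative_cong_within) (rule assms(3), rule assms(1)[symmetric])
qed

lemma H2_derivative:
  assumes "H2 u" "x \<in> {0..1}"
  shows "(u has_real_derivative Dx u x) (at x within {0..1})"
proof (rule continuous_AC_derivative[where c = 0 and d = 1])
  show "u x = u 0 + integral {0..x} (Dx u)" if "x \<in> {0..1}" for x
    using H1_D(2)[OF _ that] assms(1) unfolding H2_def by metis
  show "continuous_on {0..1} (Dx u)" using assms(1) H1_continuous unfolding H2_def by metis
qed (rule assms(2))

text \<open>Cauchy-Schwarz for \<open>Dx f\<close> against the indicator of [0, x], whose square
  norm is x. This factor x later compensates the weight 1/a near 0.\<close>

lemma H1_zero_bound: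
  assumes "H1 f" "f 0 = 0" "x \<in> {0..1}"
  shows "(f x)\<^sup>2 \<le> x * ipw1 (Dx f) (Dx f)"
proof -
  define h where "h = (\<lambda>t. indicator {0..x} t :: real)"
  have "h \<in> borel_measurable (lebesgue_on {0..1})"
    unfolding h_def by (intro measurable_restrict_space1 borel_measurable_indicator) auto
  then have h: "L2 h" by (rule L2_bounded[of _ 1]) (auto simp: h_def indicator_def)
  have sub: "{0..x} \<inter> {0..1} = {0..x}" using assms(3) by auto
  have "ipw1 h (Dx f) = integral {0..1} (\<lambda>t. if t \<in> {0..x} then Dx f t else 0)"
    unfolding ipw_def by (intro Henstock_Kurzweil_Integration.integral_cong) (auto simp: h_def)
  also have "\<dots> = integral {0..x} (Dx f)" by (simp only: integral_restrict_Int sub)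
  finally have 1: "ipw1 h (Dx f) = f x" using H1_D(2)[OF assms(1,3)] assms(2) by simp
  have "ipw1 h h = integral {0..1} (\<lambda>t. if t \<in> {0..x} then 1 else 0)"
    unfolding ipw_def by (intro Henstock_Kurzweil_Integration.integral_cong) (auto simp: h_def)
  also have "\<dots> = integral {0..x} (\<lambda>t. 1)" by (simp only: integral_restrict_Int sub)
  also have "\<dots> = x" using assms(3) by simp
  finally show ?thesis
    using ipw_Cauchy_Schwarz[of "\<lambda>_. 1" h "Dx f"] h H1_D(1)[OF assms(1)] 1 by simp
qed

section \<open>The degenerate coefficient\<close>

locale degenerate =
  fixes a :: "real \<Rightarrow> real"
  assumes deg: "WD a \<or> SD a"
begin

abbreviation "K \<equiv> Kc a"

lemma K_bounds: "0 < K" "K < 2"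
  using deg by (auto simp: WD_def SD_def)

lemma a_pos: "x \<in> {0<..1} \<Longrightarrow> 0 < a x"
  using deg by (auto simp: WD_def SD_def)

lemma a_zero: "a 0 = 0"
  using deg by (auto simp: WD_def SD_def)

lemma a1_pos: "0 < a 1" by (rule a_pos) simp

lemma a_continuous: "continuous_on {0..1} a"
  using deg
proof
  assume "SD a"
  then obtain f' where "\<forall>x\<in>{0..1}. (a has_real_derivative f' x) (at x within {0..1})"
    by (auto simp: SD_def C1_on_def)
  then show ?thesis by (intro DERIV_continuous_on) auto
qed (auto simp: WD_def)

lemma a_nonneg: "x \<in> {0..1} \<Longrightarrow> 0 \<le> a x"
  using a_pos[of x] a_zero by (cases "x = 0") (auto simp: less_imp_le)

lemma weight_a: "weight a"
  by (auto simp: weight_def a_nonneg a_continuous intro!: continuous_imp_measurable_on_sets_lebesgue)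

text \<open>Puts (WD) and (SD) on the same footing: the C1 structure on (0, 1] and the bound that
  defines K are common to both.\<close>

lemma a_derivative:
  "\<exists>a'. continuous_on {0<..1} a' \<and> (\<forall>x\<in>{0<..1}.
     (a has_real_derivative a' x) (at x within {0<..1}) \<and> x * \<bar>a' x\<bar> \<le> K * a x)"
proof -
  obtain a' where c: "continuous_on {0<..1} a'"
    and d: "\<And>x. x \<in> {0<..1} \<Longrightarrow> (a has_real_derivative a' x) (at x within {0<..1})"
    using deg
  proof
    assume "SD a"
    then obtain f' where f: "continuous_on {0..1} f'" "\<forall>x\<in>{0..1}. (a has_real_derivative f' x) (at x within {0..1})"
      by (auto simp: SD_def C1_on_def)
    show thesis
    proof (rule that)
      show "continuous_on {0<..1} f'" using f(1) by (rule continuous_on_subset) auto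
      show "(a has_real_derivative f' x) (at x within {0<..1})" if "x \<in> {0<..1}" for x
      proof (rule DERIV_subset)
        show "(a has_real_derivative f' x) (at x within {0..1})" using f(2) that by simp
      qed auto
    qed
  qed (auto simp: WD_def C1_on_def)
  have b: "x * \<bar>a' x\<bar> \<le> K * a x" if x: "x \<in> {0<..1}" for x
  proof -
    \<comment> \<open>A derivative within a set is unique at a limit point; uniqueness identifies a'
      with the derivative that occurs in \<open>Kset\<close>.\<close>
    have "x islimpt {0<..1}"
    proof (rule connected_imp_perfect[OF _ x])
      show "{0<..1} \<noteq> {b}" for b :: real
      proof
        assume eq: "{0<..1} = {b}"
        have "1/2 \<in> {0<..1::real}" "1 \<in> {0<..1::real}" by auto
        then show False unfolding eq by auto
      qed
    qed auto
    then have "vector_derivative a (at x within {0<..1}) = a' x"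
      using d[OF x] by (intro vector_derivative_within)
        (auto simp: has_real_derivative_iff_has_vector_derivative trivial_limit_within)
    moreover have "x * \<bar>vector_derivative a (at x within {0<..1})\<bar> / a x \<le> K"
      unfolding Kc_def
      by (rule cSup_upper) (use x deg in \<open>auto simp: Kset_def WD_def SD_def\<close>)
    ultimately show ?thesis using a_pos[OF x] by (simp add: divide_le_eq)
  qed
  show ?thesis using c d b by blast
qed

text \<open>The derivative of x^K / a has the sign of K a - x a', which the definition of K makes
  nonnegative. This is the quantitative form of the degeneracy: a vanishes at 0 no faster than
  x^K.\<close>

lemma powr_over_a_mono:
  assumes "0 < x" "x \<le> y" "y \<le> 1"
  shows "x powr K / a x \<le> y powr K / a y"
proof -
  obtain a' where *: "\<forall>x\<in>{0<..1}.
     (a has_real_derivative a' x) (at x within {0<..1}) \<and> x * \<bar>a' x\<bar> \<le> K * a x"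
    using a_derivative by blast
  then have a': "\<And>x. x \<in> {0<..1} \<Longrightarrow> (a has_real_derivative a' x) (at x within {0<..1})"
    "\<And>x. x \<in> {0<..1} \<Longrightarrow> x * \<bar>a' x\<bar> \<le> K * a x"
    by blast+
  show ?thesis
  proof (rule DERIV_nonneg_imp_increasing_open[OF assms(2)])
    fix s assume s: "x < s" "s < y"
    then have s1: "s \<in> {0<..1}" "s > 0" "a s > 0" using assms a_pos[of s] by auto
    have "at s within {0<..1} = at s" using s assms by (intro at_within_interior) auto
    then have "DERIV a s :> a' s" using a'(1)[OF s1(1)] by simp
    then have "DERIV (\<lambda>s. s powr K / a s) s :> (K * s powr (K - 1) * a s - s powr K * a' s) / (a s * a s)"
      using s1 by (auto intro!: derivative_eq_intros)
    moreover have "s powr K = s powr (K - 1) * s" using s1 by (simp add: powr_diff)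
    then have "K * s powr (K - 1) * a s - s powr K * a' s = s powr (K - 1) * (K * a s - s * a' s)"
      by (simp add: algebra_simps)
    moreover have "s * a' s \<le> K * a s"
      using a'(2)[OF s1(1)] mult_left_mono[OF abs_ge_self[of "a' s"], of s] s1 by linarith
    then have "0 \<le> s powr (K - 1) * (K * a s - s * a' s)" by (intro mult_nonneg_nonneg) auto
    ultimately show "\<exists>z. DERIV (\<lambda>s. s powr K / a s) s :> z \<and> 0 \<le> z"
      by (intro exI[of _ "(K * s powr (K - 1) * a s - s powr K * a' s) / (a s * a s)"]) auto
  next
    have "a s \<noteq> 0" if "s \<in> {x..y}" for s using a_pos[of s] that assms by auto
    then show "continuous_on {x..y} (\<lambda>s. s powr K / a s)"
      using assms by (intro continuous_intros continuous_on_subset[OF a_continuous]) auto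
  qed
qed

lemma powr_over_a_le: "x \<in> {0<..1} \<Longrightarrow> x powr K / a x \<le> 1 / a 1"
  using powr_over_a_mono[of x 1] by auto

text \<open>K < 2, so x^2 = x^K x^(2-K) <= x^K on (0, 1]; the point 0 costs nothing, since division
  by a(0) = 0 yields 0.\<close>

lemma square_over_a_le:
  assumes "x \<in> {0..1}" shows "x\<^sup>2 / a x \<le> 1 / a 1"
proof (cases "x = 0")
  case False
  then have x: "x \<in> {0<..1}" using assms by auto
  have "x\<^sup>2 = x powr K * x powr (2 - K)" using x by (simp add: powr_add[symmetric] flip: powr_numeral)
  also have "\<dots> \<le> x powr K * 1" using x K_bounds by (intro mult_left_mono powr_le1) auto
  finally have "x\<^sup>2 / a x \<le> x powr K / a x" using a_pos[OF x] by (simp add: divide_right_mono)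
  then show ?thesis using powr_over_a_le[OF x] by linarith
qed (use a1_pos in simp)

text \<open>Dominated by x^(1-K) / a(1), where 1 - K > -1. In the (SD) case 1/a itself is not
  integrable because a(x) = O(x); the factor x is essential.\<close>

lemma x_over_a_integrable: "(\<lambda>x. x / a x) integrable_on {0..1}"
proof (rule measurable_bounded_by_integrable_imp_integrable)
  show "(\<lambda>x. x / a x) \<in> borel_measurable (lebesgue_on {0..1})"
  proof (rule borel_measurable_divide)
    show "(\<lambda>x. x) \<in> borel_measurable (lebesgue_on {0..1::real})"
      by (intro continuous_imp_measurable_on_sets_lebesgue continuous_intros) auto
  qed (use weight_a in \<open>simp add: weight_def\<close>)
  show "(\<lambda>x. x powr (1 - K) * (1 / a 1)) integrable_on {0..1}"
    using K_bounds by (intro integrable_on_mult_left integrable_on_powr_from_0) auto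
  fix x :: real assume x: "x \<in> {0..1}"
  show "norm (x / a x) \<le> x powr (1 - K) * (1 / a 1)"
  proof (cases "x = 0")
    case False
    then have x: "x \<in> {0<..1}" using x by auto
    have "x / a x = x powr (1 - K) * (x powr K / a x)" using x by (simp add: powr_add[symmetric])
    also have "\<dots> \<le> x powr (1 - K) * (1 / a 1)" by (intro mult_left_mono powr_over_a_le x) auto
    finally show ?thesis using x a_pos[OF x] by simp
  qed auto
qed auto

lemma ipw_square: "ipw w f f = integral {0..1} (\<lambda>x. (f x)\<^sup>2 / w x)"
  by (simp add: ipw_def power2_eq_square)

lemma ipw_square_one: "ipw1 f f = integral {0..1} (\<lambda>x. (f x)\<^sup>2)"
  by (simp add: ipw_def power2_eq_square)

text \<open>A crude constant, from integrating the pointwise bound of u(x)^2 by x times the integral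
  of u'^2. It shows that some constant is admissible, so that the infimum \<open>CHP a\<close> is
  taken over a nonempty set.\<close>

lemma Hardy:
  assumes "H1w0 a u"
  shows "ipw a u u \<le> integral {0..1} (\<lambda>x. x / a x) * ipw1 (Dx u) (Dx u)"
proof -
  have u: "H1 u" "u 0 = 0" "(\<lambda>x. (u x)\<^sup>2 / a x) integrable_on {0..1}"
    using assms by (auto simp: H1w0_def L2w_def)
  have "ipw a u u \<le> integral {0..1} (\<lambda>x. x / a x * ipw1 (Dx u) (Dx u))"
    unfolding ipw_square[of a]
  proof (rule integral_le[OF u(3)])
    show "(\<lambda>x. x / a x * ipw1 (Dx u) (Dx u)) integrable_on {0..1}"
      by (intro integrable_on_mult_left x_over_a_integrable)
    fix x :: real assume x: "x \<in> {0..1}"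
    show "(u x)\<^sup>2 / a x \<le> x / a x * ipw1 (Dx u) (Dx u)"
      using divide_right_mono[OF H1_zero_bound[OF u(1,2) x] a_nonneg[OF x]] by simp
  qed
  also have "\<dots> = integral {0..1} (\<lambda>x. x / a x) * ipw1 (Dx u) (Dx u)"
    by (rule Henstock_Kurzweil_Integration.integral_mult_left)
  finally show ?thesis .
qed

abbreviation "CHPset \<equiv> {C. \<forall>u. H1w0 a u \<longrightarrow>
      integral {0..1} (\<lambda>x. (u x)^2 / a x) \<le> C * integral {0..1} (\<lambda>x. (Dx u x)^2)}"

lemma L2w_linear_bound:
  assumes "continuous_on {0..1} f" "\<And>x. x \<in> {0..1} \<Longrightarrow> \<bar>f x\<bar> \<le> C * x"
  shows "L2w a f"
  unfolding L2w_def
proof (rule conjI)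
  show "L2 f" by (rule L2_continuous[OF assms(1)])
  have m: "(\<lambda>x. (f x)\<^sup>2 / a x) \<in> borel_measurable (lebesgue_on {0..1})"
  proof (rule borel_measurable_divide)
    show "(\<lambda>x. (f x)\<^sup>2) \<in> borel_measurable (lebesgue_on {0..1})"
      by (intro continuous_imp_measurable_on_sets_lebesgue continuous_intros assms(1)) auto
  qed (use weight_a in \<open>simp add: weight_def\<close>)
  have b: "norm ((f x)\<^sup>2 / a x) \<le> C\<^sup>2 * (1 / a 1)" if x: "x \<in> {0..1}" for x
  proof -
    have "(f x)\<^sup>2 \<le> C\<^sup>2 * x\<^sup>2" using power_mono[OF assms(2)[OF x], of 2] by (simp add: power_mult_distrib)
    then have "(f x)\<^sup>2 / a x \<le> C\<^sup>2 * (x\<^sup>2 / a x)"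
      using divide_right_mono[OF _ a_nonneg[OF x]] by fastforce
    also have "\<dots> \<le> C\<^sup>2 * (1 / a 1)" by (intro mult_left_mono square_over_a_le x) auto
    finally show "norm ((f x)\<^sup>2 / a x) \<le> C\<^sup>2 * (1 / a 1)" using a_nonneg[OF x] by simp
  qed
  show "(\<lambda>x. (f x)\<^sup>2 / a x) integrable_on {0..1}"
    by (rule measurable_bounded_by_integrable_imp_integrable[OF m _ b]) auto
qed

text \<open>Tested with u(x) = x, for which the integral of u'^2 equals 1.\<close>

lemma CHPset_nonneg: "C \<in> CHPset \<Longrightarrow> 0 \<le> C"
proof -
  assume C: "C \<in> CHPset"
  have id: "H1 (\<lambda>x. x)" "\<And>x. x \<in> {0..1} \<Longrightarrow> Dx (\<lambda>x. x) x = 1"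
    using H1_C1[of "\<lambda>x. x" "\<lambda>_. 1"] by auto
  have "H1w0 a (\<lambda>x. x)"
    unfolding H1w0_def using id L2w_linear_bound[of "\<lambda>x. x" 1] by auto
  then have "integral {0..1} (\<lambda>x. x\<^sup>2 / a x) \<le> C * integral {0..1} (\<lambda>x. (Dx (\<lambda>x. x) x)^2)"
    using C by auto
  also have "integral {0..1} (\<lambda>x. (Dx (\<lambda>x. x) x)^2) = integral {0..1} (\<lambda>x::real. 1 :: real)"
    by (intro Henstock_Kurzweil_Integration.integral_cong) (simp add: id)
  finally show "0 \<le> C" using ipw_nonneg[OF weight_a, of "\<lambda>x. x"] by (simp add: ipw_square)
qed

lemma CHPset_nonempty: "integral {0..1} (\<lambda>x. x / a x) \<in> CHPset"
  using Hardy by (auto simp: ipw_square ipw_square_one)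

lemma CHP_nonneg: "0 \<le> CHP a"
  unfolding CHP_def
proof (rule cInf_greatest)
  show "CHPset \<noteq> {}" using CHPset_nonempty by blast
  show "0 \<le> C" if "C \<in> CHPset" for C by (rule CHPset_nonneg[OF that])
qed

text \<open>The infimum is itself admissible: for fixed u the quotient of the two integrals is a
  lower bound of all admissible constants. When the integral of u'^2 vanishes there is no such
  quotient, and the crude inequality decides.\<close>

lemma Hardy_Poincare:
  assumes "H1w0 a u" shows "ipw a u u \<le> CHP a * ipw1 (Dx u) (Dx u)"
proof (cases "ipw1 (Dx u) (Dx u) = 0")
  case True
  then show ?thesis using Hardy[OF assms] by simp
next
  case False
  then have p: "0 < ipw1 (Dx u) (Dx u)" using ipw_nonneg[of "\<lambda>_. 1" "Dx u"] by simp
  have "ipw a u u / ipw1 (Dx u) (Dx u) \<le> CHP a"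
    unfolding CHP_def
  proof (rule cInf_greatest)
    show "CHPset \<noteq> {}" using CHPset_nonempty by blast
    fix C assume "C \<in> CHPset"
    then have "ipw a u u \<le> C * ipw1 (Dx u) (Dx u)"
      using assms by (auto simp: ipw_square ipw_square_one)
    then show "ipw a u u / ipw1 (Dx u) (Dx u) \<le> C" using p by (simp add: divide_le_eq)
  qed
  then show ?thesis using p by (simp add: divide_le_eq)
qed

end

section \<open>Functions clamped at 0\<close>

text \<open>For u(0) = u'(0) = 0 the bending integral controls everything: u' by the Cauchy-Schwarz
  bound applied to u'', and u by the mean value inequality, which gives linear vanishing at
  0.\<close>

lemma H2_zero_bounds:
  assumes "H2 u" "u 0 = 0" "Dx u 0 = 0" "x \<in> {0..1}"
  shows "(Dx u x)\<^sup>2 \<le> x * bending u"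
    and "\<bar>Dx u x\<bar> \<le> sqrt (bending u)"
    and "\<bar>u x\<bar> \<le> sqrt (bending u) * x"
    and "ipw1 (Dx u) (Dx u) \<le> bending u"
proof -
  define B where "B = bending u"
  have B0: "0 \<le> B" unfolding B_def by (rule ipw_nonneg) simp
  have h: "H1 u" "H1 (Dx u)" using assms(1) by (auto simp: H2_def)
  have b1: "(Dx u x)\<^sup>2 \<le> x * B" if "x \<in> {0..1}" for x
    unfolding B_def by (rule H1_zero_bound[OF h(2) assms(3) that])
  then show "(Dx u x)\<^sup>2 \<le> x * bending u" using assms(4) B_def by blast
  have b1': "(Dx u x)\<^sup>2 \<le> B" if "x \<in> {0..1}" for x
    using b1[OF that] mult_right_mono[of x 1 B] that B0 by auto
  have b2: "\<bar>Dx u x\<bar> \<le> sqrt B" if "x \<in> {0..1}" for x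
    using real_sqrt_le_mono[OF b1'[OF that]] by simp
  then show "\<bar>Dx u x\<bar> \<le> sqrt (bending u)" using assms(4) B_def by blast
  have "norm (u x - u 0) \<le> sqrt B * norm (x - 0)"
    by (rule field_differentiable_bound[of "{0..1}" u "Dx u"])
       (use H2_derivative[OF assms(1)] b2 assms(4) in auto)
  then show "\<bar>u x\<bar> \<le> sqrt (bending u) * x"
    using assms(2,4) by (simp add: B_def)
  have "integral {0..1} (\<lambda>x. (Dx u x)\<^sup>2) \<le> integral {0..1} (\<lambda>x::real. B)"
    using h(1) b1' by (intro integral_le) (auto simp: H1_def L2_def)
  then show "ipw1 (Dx u) (Dx u) \<le> bending u"
    by (simp add: ipw_def B_def power2_eq_square)
qed

lemma Dx_lin:
  assumes u: "H2 u" and w: "H2 w" and x: "x \<in> {0..1}"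
  shows "Dx (\<lambda>x. u x + c * w x) x = Dx u x + c * Dx w x"
  by (rule Dx_eqI[OF x])
    (use H2_derivative[OF u x] H2_derivative[OF w x] in \<open>auto intro!: derivative_eq_intros\<close>)

lemma H2_lin:
  assumes u: "H2 u" and w: "H2 w"
  shows "H2 (\<lambda>x. u x + c * w x)"
    and "\<exists>N. negligible N \<and> (\<forall>x\<in>{0..1} - N.
      Dx2 (\<lambda>x. u x + c * w x) x = Dx2 u x + c * Dx2 w x)"
proof -
  have h: "H1 u" "H1 (Dx u)" "H1 w" "H1 (Dx w)" using u w by (auto simp: H2_def)
  have h1: "H1 (\<lambda>x. u x + c * w x)" using H1_lin[OF h(1,3)] by metis
  obtain N where N: "H1 (\<lambda>x. Dx u x + c * Dx w x)" "negligible N"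
    "\<And>x. x \<in> {0..1} - N \<Longrightarrow> Dx (\<lambda>x. Dx u x + c * Dx w x) x = Dx2 u x + c * Dx2 w x"
    using H1_lin[OF h(2,4), of c] by blast
  have "H1 (Dx (\<lambda>x. u x + c * w x))" by (rule H1_cong[OF N(1)]) (simp add: Dx_lin[OF u w])
  with h1 show "H2 (\<lambda>x. u x + c * w x)" by (simp add: H2_def)
  have "Dx2 (\<lambda>x. u x + c * w x) x = Dx2 u x + c * Dx2 w x" if x: "x \<in> {0..1} - N" for x
  proof -
    have "Dx2 (\<lambda>x. u x + c * w x) x = Dx (\<lambda>x. Dx u x + c * Dx w x) x"
      using x by (intro Dx_cong Dx_lin u w) auto
    then show ?thesis using N(3)[OF x] by simp
  qed
  with N(2) show "\<exists>N. negligible N \<and> (\<forall>x\<in>{0..1} - N.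
      Dx2 (\<lambda>x. u x + c * w x) x = Dx2 u x + c * Dx2 w x)" by blast
qed

context degenerate begin

text \<open>Weighted square integrability is automatic: u vanishes at least linearly at 0 and x^2 /
  a is bounded. Checking a test function thus reduces to regularity and two values at 0.\<close>

lemma H2w0_iff: "H2w0 a u \<longleftrightarrow> H2 u \<and> u 0 = 0 \<and> Dx u 0 = 0"
proof
  assume u: "H2 u \<and> u 0 = 0 \<and> Dx u 0 = 0"
  then have "L2w a u"
    using H2_zero_bounds(3) H1_continuous by (intro L2w_linear_bound) (auto simp: H2_def)
  then show "H2w0 a u" using u by (auto simp: H2w0_def H1w0_def H2_def)
qed (auto simp: H2w0_def H1w0_def)

lemma H2w0_D:
  assumes "H2w0 a u"
  shows "H2 u" "u 0 = 0" "Dx u 0 = 0" "L2w a u" "H1w0 a u" "L2 (Dx2 u)" "H1 u" "H1 (Dx u)"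
  using assms by (auto simp: H2w0_def H1w0_def H2_def H1_def)

lemma H2w0_lin:
  assumes "H2w0 a u" "H2w0 a w" shows "H2w0 a (\<lambda>x. u x + c * w x)"
proof -
  note h = H2w0_D[OF assms(1)] H2w0_D[OF assms(2)]
  show ?thesis unfolding H2w0_iff using H2_lin(1)[OF h(1) h(9)] Dx_lin[OF h(1) h(9), of 0 c] by (simp add: h)
qed

lemma L2w_xDx:
  assumes "H2w0 a u" shows "L2w a (\<lambda>x. x * Dx u x)"
proof (rule L2w_linear_bound)
  note h = H2w0_D[OF assms]
  show "continuous_on {0..1} (\<lambda>x. x * Dx u x)" by (intro continuous_intros H1_continuous h)
  show "\<bar>x * Dx u x\<bar> \<le> sqrt (bending u) * x" if "x \<in> {0..1}" for x
    using mult_left_mono[OF H2_zero_bounds(2)[OF h(1-3) that], of x] that by (simp add: abs_mult mult.commute)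
qed

lemma ipw_xDx_le:
  assumes "H2w0 a u"
  shows "ipw a (\<lambda>x. x * Dx u x) (\<lambda>x. x * Dx u x) \<le> 1 / a 1 * ipw1 (Dx u) (Dx u)"
proof -
  have "integral {0..1} (\<lambda>x. (x * Dx u x)\<^sup>2 / a x) \<le> integral {0..1} (\<lambda>x. 1 / a 1 * (Dx u x)\<^sup>2)"
  proof (rule integral_le)
    show "(\<lambda>x. (x * Dx u x)\<^sup>2 / a x) integrable_on {0..1}"
      using L2w_xDx[OF assms] by (simp add: L2w_def)
    show "(\<lambda>x. 1 / a 1 * (Dx u x)\<^sup>2) integrable_on {0..1}"
      using H2w0_D(7)[OF assms] by (intro integrable_on_mult_right) (auto simp: H1_def L2_def)
    fix x :: real assume "x \<in> {0..1}"
    from mult_right_mono[OF square_over_a_le[OF this], of "(Dx u x)\<^sup>2"]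
    show "(x * Dx u x)\<^sup>2 / a x \<le> 1 / a 1 * (Dx u x)\<^sup>2" by (simp add: power_mult_distrib)
  qed
  then show ?thesis by (simp add: ipw_def power2_eq_square)
qed

end

lemma H2_C2:
  assumes "\<And>x. x \<in> {0..1} \<Longrightarrow> (f has_real_derivative f1 x) (at x within {0..1})"
    and "\<And>x. x \<in> {0..1} \<Longrightarrow> (f1 has_real_derivative f2 x) (at x within {0..1})"
    and "continuous_on {0..1} f2"
  shows "H2 f" "\<And>x. x \<in> {0..1} \<Longrightarrow> Dx f x = f1 x" "\<And>x. x \<in> {0..1} \<Longrightarrow> Dx2 f x = f2 x"
proof -
  have c: "continuous_on {0..1} f1" using assms(2) by (rule DERIV_continuous_on)
  have f: "H1 f" "\<And>x. x \<in> {0..1} \<Longrightarrow> Dx f x = f1 x"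
    by (rule H1_C1[OF assms(1) c]; assumption)+
  have f1: "H1 f1" "\<And>x. x \<in> {0..1} \<Longrightarrow> Dx f1 x = f2 x"
    by (rule H1_C1[OF assms(2,3)]; assumption)+
  show D: "Dx f x = f1 x" if "x \<in> {0..1}" for x using f(2)[OF that] .
  have "H1 (Dx f)" by (rule H1_cong[OF f1(1)]) (simp add: D)
  then show "H2 f" using f(1) by (simp add: H2_def)
  show "Dx2 f x = f2 x" if "x \<in> {0..1}" for x
    using f1(2)[OF that] Dx_cong[of "Dx f" f1 x] D that by simp
qed

section \<open>The energy space and semigroup orbits\<close>

text \<open>Sums, differences and scalar multiples all have the form p + c q, so one linearity law
  per object suffices.\<close>

definition lc :: "pr \<Rightarrow> real \<Rightarrow> pr \<Rightarrow> pr" where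
  "lc p c q = (\<lambda>x. fst p x + c * fst q x, \<lambda>x. snd p x + c * snd q x)"

lemma lc_simps [simp]:
  "fst (lc p c q) = (\<lambda>x. fst p x + c * fst q x)" "snd (lc p c q) = (\<lambda>x. snd p x + c * snd q x)"
  by (simp_all add: lc_def)

lemma psub_lc: "psub p q = lc p (-1) q" by (simp add: psub_def lc_def)

lemma padd_pscale_lc: "padd p (pscale c q) = lc p c q" by (simp add: padd_def pscale_def lc_def)

lemma pscale_lc: "pscale c p = lc p (c - 1) p" by (simp add: pscale_def lc_def algebra_simps)

locale beam = degenerate +
  fixes \<beta> \<gamma> :: real
  assumes beta_nonneg: "0 \<le> \<beta>" and gamma_nonneg: "0 \<le> \<gamma>"
begin

abbreviation "N \<equiv> nH a \<beta> \<gamma>"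

definition ip :: "pr \<Rightarrow> pr \<Rightarrow> real" where
  "ip p q = ipw1 (Dx2 (fst p)) (Dx2 (fst q)) + ipw a (snd p) (snd q)
     + \<beta> * (fst p 1 * fst q 1) + \<gamma> * (Dx (fst p) 1 * Dx (fst q) 1)"

lemma H0_D:
  assumes "p \<in> H0 a"
  shows "H2w0 a (fst p)" "L2w a (snd p)" "H2 (fst p)" "L2 (Dx2 (fst p))"
  using assms by (auto simp: H0_def dest: H2w0_D)

lemma H0_lc: "p \<in> H0 a \<Longrightarrow> q \<in> H0 a \<Longrightarrow> lc p c q \<in> H0 a"
  by (auto simp: H0_def intro: H2w0_lin L2w_lin weight_a)

lemma H0_psub: "p \<in> H0 a \<Longrightarrow> q \<in> H0 a \<Longrightarrow> psub p q \<in> H0 a"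
  by (simp add: psub_lc H0_lc)

lemma H0_pscale: "p \<in> H0 a \<Longrightarrow> pscale c p \<in> H0 a"
  by (simp add: pscale_lc H0_lc)

lemma ip_commute: "ip p q = ip q p"
  by (simp add: ip_def ipw_commute mult.commute)

lemma Dx_lc:
  assumes "p \<in> H0 a" "q \<in> H0 a" "x \<in> {0..1}"
  shows "Dx (fst (lc p c q)) x = Dx (fst p) x + c * Dx (fst q) x"
  using Dx_lin[OF H0_D(3)[OF assms(1)] H0_D(3)[OF assms(2)] assms(3)] by simp

lemma ip_lin_left:
  assumes "p \<in> H0 a" "q \<in> H0 a" "r \<in> H0 a"
  shows "ip (lc p c q) r = ip p r + c * ip q r"
proof -
  note h = H0_D[OF assms(1)] H0_D[OF assms(2)] H0_D[OF assms(3)]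
  obtain M where M: "negligible M"
    "\<And>x. x \<in> {0..1} - M \<Longrightarrow> Dx2 (\<lambda>x. fst p x + c * fst q x) x = Dx2 (fst p) x + c * Dx2 (fst q) x"
    using H2_lin(2)[OF H0_D(3)[OF assms(1)] H0_D(3)[OF assms(2)], of c] by blast
  have "ipw1 (Dx2 (fst (lc p c q))) (Dx2 (fst r))
      = ipw1 (\<lambda>x. Dx2 (fst p) x + c * Dx2 (fst q) x) (Dx2 (fst r))"
    by (rule ipw_cong[OF M(1)]) (use M(2) in auto)
  also have "\<dots> = ipw1 (Dx2 (fst p)) (Dx2 (fst r)) + c * ipw1 (Dx2 (fst q)) (Dx2 (fst r))"
    using h by (intro ipw_lin_left) auto
  finally show ?thesis
    unfolding ip_def using Dx_lc[OF assms(1,2), of 1 c] h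
    by (simp add: ipw_lin_left weight_a algebra_simps)
qed

lemma ip_lin_right:
  assumes "p \<in> H0 a" "q \<in> H0 a" "r \<in> H0 a"
  shows "ip r (lc p c q) = ip r p + c * ip r q"
  using ip_lin_left[OF assms, of c] by (simp add: ip_commute)

lemma ip_nonneg: "0 \<le> ip p p"
  unfolding ip_def using beta_nonneg gamma_nonneg by (intro add_nonneg_nonneg ipw_nonneg weight_a) auto

lemma N_ip: "N p = sqrt (ip p p)"
  by (simp add: nH_def ip_def ipw_def power2_eq_square)

lemma N_nonneg: "0 \<le> N p" by (simp add: N_ip ip_nonneg)

lemma N_square: "(N p)\<^sup>2 = ip p p" by (simp add: N_ip ip_nonneg)

lemma ip_square_sum:
  assumes "p \<in> H0 a" "q \<in> H0 a"
  shows "ip (lc p c q) (lc p c q) = ip p p + 2 * c * ip p q + c\<^sup>2 * ip q q"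
  using assms H0_lc[OF assms, of c]
  by (simp add: ip_lin_left ip_lin_right ip_commute[of q p] algebra_simps power2_eq_square)

lemma ip_Cauchy_Schwarz:
  assumes "p \<in> H0 a" "q \<in> H0 a" shows "\<bar>ip p q\<bar> \<le> N p * N q"
proof -
  have "(ip p q)\<^sup>2 \<le> ip p p * ip q q"
    by (rule discriminant_le) (metis ip_square_sum[OF assms] ip_nonneg)
  also have "\<dots> = (N p * N q)\<^sup>2" by (simp add: power_mult_distrib N_square)
  finally have "\<bar>ip p q\<bar> \<le> \<bar>N p * N q\<bar>" by (simp only: abs_le_square_iff)
  then show ?thesis using N_nonneg[of p] N_nonneg[of q] by (simp add: abs_mult)
qed

lemma N_lc:
  assumes "p \<in> H0 a" "q \<in> H0 a" shows "N (lc p c q) \<le> N p + \<bar>c\<bar> * N q"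
proof (rule power2_le_imp_le)
  have "c * ip p q \<le> \<bar>c\<bar> * (N p * N q)"
    using mult_left_mono[OF ip_Cauchy_Schwarz[OF assms], of "\<bar>c\<bar>"] abs_ge_self[of "c * ip p q"]
    by (simp add: abs_mult)
  then show "(N (lc p c q))\<^sup>2 \<le> (N p + \<bar>c\<bar> * N q)\<^sup>2"
    by (simp add: N_square ip_square_sum[OF assms] power2_sum power_mult_distrib mult_ac)
  show "0 \<le> N p + \<bar>c\<bar> * N q" by (simp add: N_nonneg)
qed

lemma N_psub: "p \<in> H0 a \<Longrightarrow> q \<in> H0 a \<Longrightarrow> N (psub p q) \<le> N p + N q"
  using N_lc[of p q "-1"] by (simp add: psub_lc)

lemma N_pscale: "p \<in> H0 a \<Longrightarrow> N (pscale c p) = \<bar>c\<bar> * N p"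
proof -
  assume p: "p \<in> H0 a"
  have "(N (pscale c p))\<^sup>2 = c\<^sup>2 * (N p)\<^sup>2"
    unfolding N_square pscale_lc ip_square_sum[OF p p] by (simp add: algebra_simps power2_eq_square)
  then have "sqrt ((N (pscale c p))\<^sup>2) = sqrt (c\<^sup>2 * (N p)\<^sup>2)" by simp
  then show ?thesis by (simp add: real_sqrt_mult N_nonneg)
qed

lemma N_triangle:
  assumes "p \<in> H0 a" "q \<in> H0 a" "r \<in> H0 a"
  shows "N (psub p r) \<le> N (psub p q) + N (psub q r)"
proof -
  have "psub p r = lc (psub p q) 1 (psub q r)" by (simp add: psub_def lc_def)
  then show ?thesis using N_lc[OF H0_psub[OF assms(1,2)] H0_psub[OF assms(2,3)], of 1] by simp
qed

lemma N_psub_commute: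
  assumes "p \<in> H0 a" "q \<in> H0 a" shows "N (psub p q) = N (psub q p)"
proof -
  have "psub p q = pscale (-1) (psub q p)" by (simp add: psub_def pscale_def)
  then show ?thesis using N_pscale[OF H0_psub[OF assms(2,1)], of "-1"] by simp
qed

lemma N_le_psub:
  assumes "p \<in> H0 a" "q \<in> H0 a" shows "N p \<le> N q + N (psub p q)"
proof -
  have "p = lc q 1 (psub p q)" by (simp add: psub_def lc_def)
  then show ?thesis using N_lc[OF assms(2) H0_psub[OF assms], of 1] by simp
qed

text \<open>Equality in the energy space. The semigroup laws are available only up to distance zero;
  membership is built in because symmetry and transitivity rest on norm laws that require
  it.\<close>

definition eqv :: "pr \<Rightarrow> pr \<Rightarrow> bool" where
  "eqv p q \<longleftrightarrow> p \<in> H0 a \<and> q \<in> H0 a \<and> N (psub p q) = 0"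

lemma eqv_refl: "p \<in> H0 a \<Longrightarrow> eqv p p"
  using N_pscale[of p 0] by (simp add: eqv_def psub_def pscale_def)

lemma eqv_sym: "eqv p q \<Longrightarrow> eqv q p"
  using N_psub_commute by (simp add: eqv_def)

lemma eqv_trans: "eqv p q \<Longrightarrow> eqv q r \<Longrightarrow> eqv p r"
  unfolding eqv_def using N_triangle[of p q r] N_nonneg[of "psub p r"] by auto

lemma eqv_lc: "eqv p p' \<Longrightarrow> eqv q q' \<Longrightarrow> eqv (lc p c q) (lc p' c q')"
proof -
  assume a: "eqv p p'" "eqv q q'"
  have "psub (lc p c q) (lc p' c q') = lc (psub p p') c (psub q q')" by (simp add: psub_def lc_def algebra_simps)
  moreover have h: "p \<in> H0 a" "p' \<in> H0 a" "q \<in> H0 a" "q' \<in> H0 a" "N (psub p p') = 0" "N (psub q q') = 0"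
    using a by (simp_all add: eqv_def)
  moreover have "N (lc (psub p p') c (psub q q')) \<le> 0"
    using N_lc[OF H0_psub[OF h(1,2)] H0_psub[OF h(3,4)], of c] h(5,6) by simp
  ultimately show ?thesis using N_nonneg[of "lc (psub p p') c (psub q q')"]
    by (simp add: eqv_def H0_lc)
qed

lemma eqv_N: "eqv p q \<Longrightarrow> N p = N q"
  using N_le_psub[of p q] N_le_psub[of q p] N_psub_commute[of p q] by (simp add: eqv_def)

section \<open>Bounded bilinear forms and their product rule\<close>

text \<open>Symmetry is left out since most forms used later pair the velocity of one argument with
  the displacement of the other. Boundedness makes a form blind to distance zero and differentiable
  along orbits.\<close>

definition bounded_bilinear_form :: "(pr \<Rightarrow> pr \<Rightarrow> real) \<Rightarrow> bool" where
  "bounded_bilinear_form b \<longleftrightarrow>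
     (\<forall>p\<in>H0 a. \<forall>q\<in>H0 a. \<forall>r\<in>H0 a. \<forall>c. b (lc p c q) r = b p r + c * b q r \<and> b r (lc p c q) = b r p + c * b r q)
     \<and> (\<exists>C\<ge>0. \<forall>p\<in>H0 a. \<forall>q\<in>H0 a. \<bar>b p q\<bar> \<le> C * N p * N q)"

lemma bounded_bilinear_formD:
  assumes "bounded_bilinear_form b" "p \<in> H0 a" "q \<in> H0 a" "r \<in> H0 a"
  shows "b (lc p c q) r = b p r + c * b q r" "b r (lc p c q) = b r p + c * b r q"
  using assms by (auto simp: bounded_bilinear_form_def)

lemma bounded_bilinear_form_ip: "bounded_bilinear_form ip"
  unfolding bounded_bilinear_form_def
  using ip_lin_left ip_lin_right ip_Cauchy_Schwarz by (auto intro!: exI[of _ 1])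

lemma bounded_bilinear_form_add:
  assumes b: "bounded_bilinear_form b" and d: "bounded_bilinear_form d"
  shows "bounded_bilinear_form (\<lambda>p q. b p q + k * d p q)"
proof -
  obtain B where B: "B \<ge> 0" "\<And>p q. p \<in> H0 a \<Longrightarrow> q \<in> H0 a \<Longrightarrow> \<bar>b p q\<bar> \<le> B * N p * N q"
    using b by (auto simp: bounded_bilinear_form_def)
  obtain D where D: "D \<ge> 0" "\<And>p q. p \<in> H0 a \<Longrightarrow> q \<in> H0 a \<Longrightarrow> \<bar>d p q\<bar> \<le> D * N p * N q"
    using d by (auto simp: bounded_bilinear_form_def)
  have bound: "\<bar>b p q + k * d p q\<bar> \<le> (B + \<bar>k\<bar> * D) * N p * N q" if "p \<in> H0 a" "q \<in> H0 a" for p q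
  proof -
    have "\<bar>k * d p q\<bar> \<le> \<bar>k\<bar> * (D * N p * N q)"
      unfolding abs_mult by (intro mult_left_mono D(2) that) auto
    then show ?thesis using B(2)[OF that] abs_triangle_ineq[of "b p q" "k * d p q"]
      by (simp add: algebra_simps)
  qed
  show ?thesis
    unfolding bounded_bilinear_form_def
  proof (intro conjI ballI allI exI[of _ "B + \<bar>k\<bar> * D"])
    show "0 \<le> B + \<bar>k\<bar> * D" using B(1) D(1) by simp
  qed (use bound bounded_bilinear_formD[OF b] bounded_bilinear_formD[OF d] in \<open>simp_all add: algebra_simps\<close>)
qed

lemma bilinear_eqv:
  assumes b: "bounded_bilinear_form b" and e: "eqv p p'" "eqv q q'"
  shows "b p q = b p' q'"
proof -
  obtain B where B: "\<And>p q. p \<in> H0 a \<Longrightarrow> q \<in> H0 a \<Longrightarrow> \<bar>b p q\<bar> \<le> B * N p * N q"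
    using b unfolding bounded_bilinear_form_def by blast
  have h: "p \<in> H0 a" "p' \<in> H0 a" "q \<in> H0 a" "q' \<in> H0 a" "N (psub p p') = 0" "N (psub q q') = 0"
    using e by (auto simp: eqv_def)
  have "b (psub p p') q = 0" using B[OF H0_psub[OF h(1,2)] h(3)] h by simp
  moreover have "b p' (psub q q') = 0" using B[OF h(2) H0_psub[OF h(3,4)]] h by simp
  ultimately show ?thesis using h by (simp add: psub_lc bounded_bilinear_formD[OF b])
qed

text \<open>With Q the difference quotient, b(U s, U s) - b(U t, U t) equals (s - t) (b(Q, U s) +
  b(U t, Q)) exactly, and Q tends to W in norm. The set T allows a one-sided derivative at time
  0.\<close>

lemma bilinear_derivative:
  assumes b: "bounded_bilinear_form b" and U: "\<And>s. s \<in> T \<Longrightarrow> U s \<in> H0 a"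
    and W: "W \<in> H0 a" and t: "t \<in> T"
    and lim: "((\<lambda>s. N (psub (pscale (1 / (s - t)) (psub (U s) (U t))) W)) \<longlongrightarrow> 0) (at t within T)"
  shows "((\<lambda>s. b (U s) (U s)) has_real_derivative b W (U t) + b (U t) W) (at t within T)"
proof -
  obtain C where C: "C \<ge> 0" "\<And>p q. p \<in> H0 a \<Longrightarrow> q \<in> H0 a \<Longrightarrow> \<bar>b p q\<bar> \<le> C * N p * N q"
    using b by (auto simp: bounded_bilinear_form_def)
  define Q where "Q s = pscale (1 / (s - t)) (psub (U s) (U t))" for s
  define e where "e s = N (psub (Q s) W)" for s
  \<comment> \<open>Bounds for the three error terms left after inserting Q = W + (Q - W) and U s =
    U t + (s - t) Q.\<close>
  define R where "R s = C * e s * (N (U t) + \<bar>s - t\<bar> * (e s + N W)) + C * N W * (\<bar>s - t\<bar> * (e s + N W)) + C * N (U t) * e s" for s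
  have e0: "(e \<longlongrightarrow> 0) (at t within T)" using lim unfolding e_def Q_def .
  have "((\<lambda>s. \<bar>s - t\<bar>) \<longlongrightarrow> \<bar>t - t\<bar>) (at t within T)" by (intro tendsto_intros)
  then have st0: "((\<lambda>s. \<bar>s - t\<bar>) \<longlongrightarrow> 0) (at t within T)" by simp
  have "(R \<longlongrightarrow> C * 0 * (N (U t) + 0 * (0 + N W)) + C * N W * (0 * (0 + N W)) + C * N (U t) * 0) (at t within T)"
    unfolding R_def by (intro tendsto_intros e0 st0)
  then have R0: "(R \<longlongrightarrow> 0) (at t within T)" by simp
  have main: "\<bar>(b (U s) (U s) - b (U t) (U t)) / (s - t) - (b W (U t) + b (U t) W)\<bar> \<le> R s"
    if s: "s \<in> T" "s \<noteq> t" for s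
  proof -
    note hs = U[OF s(1)] and ht = U[OF t]
    have hQ: "Q s \<in> H0 a" unfolding Q_def by (intro H0_pscale H0_psub hs ht)
    have Us: "U s = lc (U t) (s - t) (Q s)"
      using s by (simp add: Q_def pscale_def psub_def lc_def)
    have Q: "Q s = lc W 1 (psub (Q s) W)" by (simp add: psub_def lc_def)
    have NQ: "N (Q s) \<le> e s + N W"
      using N_le_psub[OF hQ W] by (simp add: e_def)
    have NUs: "N (U s) \<le> N (U t) + \<bar>s - t\<bar> * (e s + N W)"
    proof -
      have "N (U s) \<le> N (U t) + \<bar>s - t\<bar> * N (Q s)"
        using N_lc[OF ht hQ, of "s - t"] Us by simp
      also have "\<dots> \<le> N (U t) + \<bar>s - t\<bar> * (e s + N W)" using NQ by (intro add_left_mono mult_left_mono) auto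
      finally show ?thesis .
    qed
    have he: "psub (Q s) W \<in> H0 a" by (intro H0_psub hQ W)
    have d: "b (U s) (U s) - b (U t) (U t) = (s - t) * (b (Q s) (U s) + b (U t) (Q s))"
    proof -
      have "b (U s) (U s) = b (lc (U t) (s - t) (Q s)) (U s)" using Us by simp
      also have "\<dots> = b (U t) (U s) + (s - t) * b (Q s) (U s)"
        by (rule bounded_bilinear_formD(1)[OF b ht hQ hs])
      also have "b (U t) (U s) = b (U t) (lc (U t) (s - t) (Q s))" using Us by simp
      also have "\<dots> = b (U t) (U t) + (s - t) * b (U t) (Q s)"
        by (rule bounded_bilinear_formD(2)[OF b ht hQ ht])
      finally show ?thesis by (simp add: algebra_simps)
    qed
    have 1: "b (Q s) (U s) = b W (U s) + b (psub (Q s) W) (U s)"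
      using bounded_bilinear_formD(1)[OF b W he hs, of 1] Q by simp
    have 2: "b (U t) (Q s) = b (U t) W + b (U t) (psub (Q s) W)"
      using bounded_bilinear_formD(2)[OF b W he ht, of 1] Q by simp
    have 3: "b W (U s) = b W (U t) + (s - t) * b W (Q s)"
      using bounded_bilinear_formD(2)[OF b ht hQ W, of "s - t"] Us by simp
    have eq: "(b (U s) (U s) - b (U t) (U t)) / (s - t) - (b W (U t) + b (U t) W)
       = b (psub (Q s) W) (U s) + (s - t) * b W (Q s) + b (U t) (psub (Q s) W)"
      using s unfolding d by (simp add: 1 2 3)
    have i1: "\<bar>b (psub (Q s) W) (U s)\<bar> \<le> C * e s * (N (U t) + \<bar>s - t\<bar> * (e s + N W))"
    proof -
      have "\<bar>b (psub (Q s) W) (U s)\<bar> \<le> C * e s * N (U s)" using C(2)[OF he hs] by (simp add: e_def)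
      also have "\<dots> \<le> C * e s * (N (U t) + \<bar>s - t\<bar> * (e s + N W))"
        using NUs C(1) by (intro mult_left_mono) (auto simp: e_def N_nonneg)
      finally show ?thesis .
    qed
    have i2: "\<bar>(s - t) * b W (Q s)\<bar> \<le> C * N W * (\<bar>s - t\<bar> * (e s + N W))"
    proof -
      have "\<bar>(s - t) * b W (Q s)\<bar> \<le> \<bar>s - t\<bar> * (C * N W * N (Q s))"
        unfolding abs_mult by (intro mult_left_mono C(2) W hQ) auto
      also have "\<dots> \<le> \<bar>s - t\<bar> * (C * N W * (e s + N W))"
        using NQ C(1) by (intro mult_left_mono) (auto simp: N_nonneg)
      finally show ?thesis by (simp add: mult_ac)
    qed
    have i3: "\<bar>b (U t) (psub (Q s) W)\<bar> \<le> C * N (U t) * e s"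
      using C(2)[OF ht he] by (simp add: e_def)
    show ?thesis unfolding eq R_def using i1 i2 i3 by linarith
  qed
  have "((\<lambda>s. (b (U s) (U s) - b (U t) (U t)) / (s - t) - (b W (U t) + b (U t) W)) \<longlongrightarrow> 0) (at t within T)"
    by (rule Lim_null_comparison[OF _ R0]) (use main in \<open>auto simp: eventually_at intro!: exI[of _ 1]\<close>)
  then show ?thesis unfolding has_field_derivative_iff by (simp add: LIM_zero_iff)
qed

lemma H0_AA: "q \<in> DomAA a \<beta> \<gamma> \<Longrightarrow> AA a q \<in> H0 a"
  using L2w_cmul[OF weight_a, of "\<lambda>x. a x * Dx4 (fst q) x" "-1"]
  by (auto simp: DomAA_def H0_def AA_def DomA_def)

lemma DomAA_H0: "q \<in> DomAA a \<beta> \<gamma> \<Longrightarrow> q \<in> H0 a"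
  using H2w0_D(4) by (auto simp: DomAA_def H0_def DomA_def)

end

section \<open>Orbits of the contraction semigroup\<close>

locale beam_semigroup = beam +
  fixes S :: "real \<Rightarrow> pr \<Rightarrow> pr"
  assumes semigroup: "gen_contr_semigroup a \<beta> \<gamma> S"
begin

lemma S_H0: "t \<ge> 0 \<Longrightarrow> p \<in> H0 a \<Longrightarrow> S t p \<in> H0 a"
  using semigroup unfolding gen_contr_semigroup_def by blast

lemma S_0: "p \<in> H0 a \<Longrightarrow> eqv (S 0 p) p"
  using semigroup S_H0[of 0 p] unfolding gen_contr_semigroup_def eqv_def by blast

lemma S_add: "t \<ge> 0 \<Longrightarrow> s \<ge> 0 \<Longrightarrow> p \<in> H0 a \<Longrightarrow> eqv (S (t + s) p) (S t (S s p))"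
proof -
  assume a: "t \<ge> 0" "s \<ge> 0" "p \<in> H0 a"
  then have "N (psub (S (t + s) p) (S t (S s p))) = 0"
    using semigroup unfolding gen_contr_semigroup_def by blast
  with a show ?thesis by (simp add: eqv_def S_H0)
qed

lemma S_lc: "t \<ge> 0 \<Longrightarrow> p \<in> H0 a \<Longrightarrow> q \<in> H0 a \<Longrightarrow> eqv (S t (lc p c q)) (lc (S t p) c (S t q))"
proof -
  assume a: "t \<ge> 0" "p \<in> H0 a" "q \<in> H0 a"
  then have "N (psub (S t (padd p (pscale c q))) (padd (S t p) (pscale c (S t q)))) = 0"
    using semigroup unfolding gen_contr_semigroup_def by blast
  with a show ?thesis by (simp add: eqv_def S_H0 H0_lc padd_pscale_lc)
qed

lemma S_contraction: "t \<ge> 0 \<Longrightarrow> p \<in> H0 a \<Longrightarrow> N (S t p) \<le> N p"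
  using semigroup unfolding gen_contr_semigroup_def by blast

lemma S_continuous: "p \<in> H0 a \<Longrightarrow> ((\<lambda>t. N (psub (S t p) p)) \<longlongrightarrow> 0) (at_right 0)"
  using semigroup unfolding gen_contr_semigroup_def by blast

lemma S_derivative: "p \<in> DomAA a \<beta> \<gamma> \<Longrightarrow>
   ((\<lambda>h. N (psub (pscale (1/h) (psub (S h p) p)) (AA a p))) \<longlongrightarrow> 0) (at_right 0)"
  using semigroup unfolding gen_contr_semigroup_def by blast

lemma S_generator: "p \<in> H0 a \<Longrightarrow> z \<in> H0 a \<Longrightarrow>
   ((\<lambda>h. N (psub (pscale (1/h) (psub (S h p) p)) z)) \<longlongrightarrow> 0) (at_right 0) \<Longrightarrow>
   \<exists>q\<in>DomAA a \<beta> \<gamma>. N (psub p q) = 0"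
  using semigroup unfolding gen_contr_semigroup_def by blast

lemma S_eqv: "t \<ge> 0 \<Longrightarrow> eqv p q \<Longrightarrow> eqv (S t p) (S t q)"
proof -
  assume t: "t \<ge> 0" and e: "eqv p q"
  then have h: "p \<in> H0 a" "q \<in> H0 a" "N (psub p q) = 0" by (auto simp: eqv_def)
  have "N (psub (S t p) (S t q)) = N (S t (psub p q))"
    using eqv_N[OF S_lc[OF t h(1,2), of "-1"]] by (simp add: psub_lc)
  also have "\<dots> \<le> 0" using S_contraction[OF t H0_psub[OF h(1,2)]] h(3) by simp
  finally show ?thesis using N_nonneg[of "psub (S t p) (S t q)"] t h by (auto simp: eqv_def S_H0)
qed

text \<open>Clearing the denominator leaves X - Y - h Z, a combination of type \<open>lc\<close>, to
  which \<open>S_lc\<close> and \<open>eqv_lc\<close> apply.\<close>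

lemma N_difference_quotient:
  assumes "h > 0" "X \<in> H0 a" "Y \<in> H0 a" "Z \<in> H0 a"
  shows "N (psub (pscale (1 / h) (psub X Y)) Z) = N (lc (psub X Y) (- h) Z) / h"
proof -
  have "psub (pscale (1 / h) (psub X Y)) Z = pscale (1 / h) (lc (psub X Y) (- h) Z)"
    using assms(1) by (simp add: psub_def pscale_def lc_def field_simps)
  then show ?thesis using assms N_pscale[of "lc (psub X Y) (- h) Z" "1 / h"] by (simp add: H0_lc H0_psub)
qed

text \<open>S(r) commutes with difference quotients and contracts, so the error at time r is at most
  the error at time 0: right quotients converge uniformly along the orbit.\<close>

lemma difference_quotient_le:
  assumes q: "q \<in> DomAA a \<beta> \<gamma>" and r: "r \<ge> 0" and h: "h > 0"
  shows "N (psub (pscale (1 / h) (psub (S (r + h) q) (S r q))) (S r (AA a q)))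
    \<le> N (psub (pscale (1 / h) (psub (S h q) q)) (AA a q))"
proof -
  note q0 = DomAA_H0[OF q] and z = H0_AA[OF q]
  have hS: "S h q \<in> H0 a" using h q0 by (simp add: S_H0)
  have "eqv (lc (psub (S (r + h) q) (S r q)) (- h) (S r (AA a q)))
          (lc (psub (S r (S h q)) (S r q)) (- h) (S r (AA a q)))"
    unfolding psub_lc using r h q0 z by (intro eqv_lc S_add eqv_refl S_H0) auto
  moreover have "eqv (lc (psub (S r (S h q)) (S r q)) (- h) (S r (AA a q)))
      (S r (lc (psub (S h q) q) (- h) (AA a q)))"
  proof -
    have "eqv (S r (lc (psub (S h q) q) (- h) (AA a q))) (lc (S r (psub (S h q) q)) (- h) (S r (AA a q)))"
      by (intro S_lc r H0_psub hS q0 z)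
    moreover have "eqv (lc (S r (psub (S h q) q)) (- h) (S r (AA a q))) (lc (psub (S r (S h q)) (S r q)) (- h) (S r (AA a q)))"
      unfolding psub_lc by (intro eqv_lc S_lc r hS q0 z eqv_refl S_H0)
    ultimately show ?thesis by (meson eqv_trans eqv_sym)
  qed
  ultimately have "N (lc (psub (S (r + h) q) (S r q)) (- h) (S r (AA a q))) = N (S r (lc (psub (S h q) q) (- h) (AA a q)))"
    by (metis eqv_N)
  also have "\<dots> \<le> N (lc (psub (S h q) q) (- h) (AA a q))"
    by (intro S_contraction r H0_lc H0_psub hS q0 z)
  finally show ?thesis using h r q0 z hS
    by (simp add: N_difference_quotient S_H0 divide_right_mono)
qed

text \<open>The generator only provides right derivatives at time 0. A left quotient at t is a right
  quotient at some s < t, hence close to S(s) A q by the uniform bound, and strong continuity moves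
  this to S(t) A q.\<close>

lemma orbit_derivative:
  assumes q: "q \<in> DomAA a \<beta> \<gamma>" and t: "t \<ge> 0"
  shows "((\<lambda>s. N (psub (pscale (1 / (s - t)) (psub (S s q) (S t q))) (S t (AA a q)))) \<longlongrightarrow> 0) (at t within {0..})"
proof -
  note q0 = DomAA_H0[OF q] and z = H0_AA[OF q]
  define w1 where "w1 h = N (psub (pscale (1 / h) (psub (S h q) q)) (AA a q))" for h
  define w2 where "w2 h = N (psub (S h (AA a q)) (AA a q))" for h
  have lim: "((\<lambda>h. w1 h + w2 h) \<longlongrightarrow> 0) (at_right 0)"
    using tendsto_add[OF S_derivative[OF q] S_continuous[OF z]] by (simp add: w1_def w2_def)
  have "filterlim (\<lambda>s. \<bar>s - t\<bar>) (at_right 0) (at t within {0..})"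
    unfolding filterlim_at
  proof
    have "((\<lambda>s. \<bar>s - t\<bar>) \<longlongrightarrow> \<bar>t - t\<bar>) (at t within {0..})" by (intro tendsto_intros)
    then show "((\<lambda>s. \<bar>s - t\<bar>) \<longlongrightarrow> 0) (at t within {0..})" by simp
    show "\<forall>\<^sub>F s in at t within {0..}. \<bar>s - t\<bar> \<in> {0<..} \<and> \<bar>s - t\<bar> \<noteq> 0"
      by (auto simp: eventually_at intro!: exI[of _ 1])
  qed
  then have lim': "((\<lambda>s. w1 \<bar>s - t\<bar> + w2 \<bar>s - t\<bar>) \<longlongrightarrow> 0) (at t within {0..})"
    by (rule filterlim_compose[OF lim])
  have main: "N (psub (pscale (1 / (s - t)) (psub (S s q) (S t q))) (S t (AA a q))) \<le> w1 \<bar>s - t\<bar> + w2 \<bar>s - t\<bar>"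
    if s: "s \<ge> 0" "s \<noteq> t" for s
  proof (cases "s > t")
    case True
    then show ?thesis
      using difference_quotient_le[OF q t, of "s - t"] N_nonneg[of "psub (S (s - t) (AA a q)) (AA a q)"]
      by (simp add: w1_def w2_def)
  next
    case False
    define h where "h = t - s"
    have h: "h > 0" "t = s + h" using False s by (auto simp: h_def)
    have eq: "pscale (1 / (s - t)) (psub (S s q) (S t q)) = pscale (1 / h) (psub (S (s + h) q) (S s q))"
      using h by (simp add: pscale_def psub_def fun_eq_iff field_simps)
    define Q where "Q = pscale (1 / h) (psub (S (s + h) q) (S s q))"
    have hQ: "Q \<in> H0 a" unfolding Q_def using h s q0 by (intro H0_pscale H0_psub S_H0) auto
    have "N (psub Q (S t (AA a q))) \<le> N (psub Q (S s (AA a q))) + N (psub (S s (AA a q)) (S t (AA a q)))"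
      using s t z hQ by (intro N_triangle S_H0) auto
    moreover have "N (psub Q (S s (AA a q))) \<le> w1 h"
      unfolding Q_def w1_def by (rule difference_quotient_le[OF q s(1) h(1)])
    moreover have "N (psub (S s (AA a q)) (S t (AA a q))) \<le> w2 h"
    proof -
      have hz: "S h (AA a q) \<in> H0 a" using h z by (simp add: S_H0)
      have "eqv (psub (S t (AA a q)) (S s (AA a q))) (psub (S s (S h (AA a q))) (S s (AA a q)))"
        unfolding psub_lc h(2) using h s z by (intro eqv_lc S_add eqv_refl S_H0) auto
      moreover have "eqv (S s (psub (S h (AA a q)) (AA a q))) (psub (S s (S h (AA a q))) (S s (AA a q)))"
        unfolding psub_lc by (intro S_lc s hz z)
      ultimately have "N (psub (S t (AA a q)) (S s (AA a q))) = N (S s (psub (S h (AA a q)) (AA a q)))"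
        by (metis eqv_N)
      also have "\<dots> \<le> w2 h" unfolding w2_def by (intro S_contraction s H0_psub hz z)
      finally show ?thesis using s t z by (simp add: N_psub_commute S_H0)
    qed
    ultimately show ?thesis using False s eq by (simp add: Q_def h_def abs_if)
  qed
  show ?thesis
    by (rule Lim_null_comparison[OF _ lim'])
       (use main N_nonneg in \<open>auto simp: eventually_at intro!: exI[of _ 1]\<close>)
qed

text \<open>S(t) q need not satisfy the domain conditions as a function. Its quotients converge, so
  maximality of the generator yields a domain element r at distance zero; the quotients of r have
  the same limit, which identifies S(t) A q with A r.\<close>

lemma orbit_in_domain:
  assumes q: "q \<in> DomAA a \<beta> \<gamma>" and t: "t \<ge> 0"
  obtains r where "r \<in> DomAA a \<beta> \<gamma>" "eqv (S t q) r" "eqv (S t (AA a q)) (AA a r)"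
proof -
  note q0 = DomAA_H0[OF q] and z = H0_AA[OF q]
  have St: "S t q \<in> H0 a" "S t (AA a q) \<in> H0 a" using t q0 z by (auto simp: S_H0)
  have le: "N (psub (pscale (1 / h) (psub (S h (S t q)) (S t q))) (S t (AA a q)))
      \<le> N (psub (pscale (1 / h) (psub (S h q) q)) (AA a q))" if h: "h > 0" for h
  proof -
    have "eqv (S h (S t q)) (S (t + h) q)"
      using eqv_sym[OF S_add[of h t q]] h t q0 by (simp add: add.commute)
    from eqv_lc[OF eqv_lc[OF this eqv_refl[OF St(1)]] eqv_refl[OF St(2)]]
    have "eqv (lc (psub (S h (S t q)) (S t q)) (- h) (S t (AA a q))) (lc (psub (S (t + h) q) (S t q)) (- h) (S t (AA a q)))"
      unfolding psub_lc .
    from eqv_N[OF this] show ?thesis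
      using difference_quotient_le[OF q t h] h t q0 z St by (simp add: N_difference_quotient S_H0)
  qed
  have lim: "((\<lambda>h. N (psub (pscale (1 / h) (psub (S h (S t q)) (S t q))) (S t (AA a q)))) \<longlongrightarrow> 0) (at_right 0)"
    by (rule Lim_null_comparison[OF _ S_derivative[OF q]])
       (rule eventually_mono[OF eventually_at_right_less], simp add: le N_nonneg)
  obtain r where r: "r \<in> DomAA a \<beta> \<gamma>" "N (psub (S t q) r) = 0"
    using S_generator[OF St lim] by blast
  note r0 = DomAA_H0[OF r(1)] and zr = H0_AA[OF r(1)]
  have e: "eqv (S t q) r" using r St r0 by (simp add: eqv_def)
  have le2: "N (psub (S t (AA a q)) (AA a r)) \<le>
     N (psub (pscale (1 / h) (psub (S h (S t q)) (S t q))) (S t (AA a q))) + N (psub (pscale (1 / h) (psub (S h r) r)) (AA a r))"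
    if h: "h > 0" for h
  proof -
    define Q where "Q = pscale (1 / h) (psub (S h (S t q)) (S t q))"
    have hQ: "Q \<in> H0 a"
      unfolding Q_def by (intro H0_pscale H0_psub St(1) S_H0[OF less_imp_le[OF h]])
    have "eqv (lc (psub (S h (S t q)) (S t q)) (- h) (AA a r)) (lc (psub (S h r) r) (- h) (AA a r))"
      unfolding psub_lc using h by (intro eqv_lc e eqv_refl zr S_eqv) auto
    from eqv_N[OF this] have "N (psub Q (AA a r)) = N (psub (pscale (1 / h) (psub (S h r) r)) (AA a r))"
      using h St r0 zr unfolding Q_def by (simp add: N_difference_quotient S_H0)
    then show ?thesis using N_triangle[OF St(2) hQ zr] N_psub_commute[OF St(2) hQ] unfolding Q_def by simp
  qed
  have lim2: "((\<lambda>h. N (psub (pscale (1 / h) (psub (S h (S t q)) (S t q))) (S t (AA a q))) + N (psub (pscale (1 / h) (psub (S h r) r)) (AA a r))) \<longlongrightarrow> 0 + 0) (at_right 0)"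
    by (intro tendsto_add lim S_derivative r)
  have "N (psub (S t (AA a q)) (AA a r)) \<le> 0 + 0"
  proof (rule tendsto_lowerbound[OF lim2])
    show "\<forall>\<^sub>F h in at_right 0. N (psub (S t (AA a q)) (AA a r)) \<le>
     N (psub (pscale (1 / h) (psub (S h (S t q)) (S t q))) (S t (AA a q))) + N (psub (pscale (1 / h) (psub (S h r) r)) (AA a r))"
      by (rule eventually_mono[OF eventually_at_right_less]) (rule le2)
  qed simp
  then have "eqv (S t (AA a q)) (AA a r)"
    using N_nonneg[of "psub (S t (AA a q)) (AA a r)"] St zr by (simp add: eqv_def)
  with r e that show thesis by blast
qed

lemma orbit_form_derivative:
  assumes q: "q \<in> DomAA a \<beta> \<gamma>" and t: "t \<ge> 0" and b: "bounded_bilinear_form b"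
    and r: "r \<in> DomAA a \<beta> \<gamma>" "eqv (S t q) r" "eqv (S t (AA a q)) (AA a r)"
  shows "((\<lambda>s. b (S s q) (S s q)) has_real_derivative b (AA a r) r + b r (AA a r)) (at t within {0..})"
proof -
  have "((\<lambda>s. b (S s q) (S s q)) has_real_derivative b (S t (AA a q)) (S t q) + b (S t q) (S t (AA a q))) (at t within {0..})"
    by (rule bilinear_derivative[OF b _ _ _ orbit_derivative[OF q t]])
       (use t DomAA_H0[OF q] H0_AA[OF q] in \<open>auto simp: S_H0\<close>)
  then show ?thesis using bilinear_eqv[OF b r(3,2)] bilinear_eqv[OF b r(2,3)] by simp
qed

end

section \<open>Green formulas\<close>

lemma integral_tail_tendsto:
  fixes f :: "real \<Rightarrow> real"
  assumes "f integrable_on {0..1}"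
  shows "((\<lambda>c. integral {c..1} f) \<longlongrightarrow> integral {0..1} f) (at_right 0)"
proof -
  have "continuous_on {0..1} (\<lambda>c. integral {c..1} f)"
    by (rule indefinite_integral_continuous_1'[OF assms])
  then have "((\<lambda>c. integral {c..1} f) \<longlongrightarrow> integral {0..1} f) (at 0 within {0..1})"
    by (simp add: continuous_on_def)
  then show ?thesis by (simp add: at_within_Icc_at_right)
qed

lemma eventually_at_right_0_1: "\<forall>\<^sub>F c in at_right (0::real). c \<in> {0<..1}"
  by (auto simp: eventually_at_right_field intro!: exI[of _ 1])

lemma C1_eq_integral:
  fixes f g :: "real \<Rightarrow> real"
  assumes "\<And>x. x \<in> {c..1} \<Longrightarrow> (f has_real_derivative f' x) (at x within {c..1})"
    "continuous_on {c..1} f'" "c \<le> x" "x \<le> 1"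
  shows "f x = f c + integral {c..x} f'"
proof -
  have "(f' has_integral f x - f c) {c..x}"
    using assms(3,4) by (intro fundamental_theorem_of_calculus)
     (auto simp: has_real_derivative_iff_has_vector_derivative[symmetric] intro!: DERIV_subset[OF assms(1)])
  then show ?thesis by (simp add: integral_unique)
qed

section \<open>Behaviour of domain elements near 0 and integration by parts\<close>

context degenerate begin

text \<open>A domain element is regular up to fourth order only away from 0, hence the interval
  [c, 1] throughout.\<close>

lemma DomA_facts:
  assumes u: "DomA a u" and c: "c \<in> {0<..1}"
  defines "u2 \<equiv> Dx2 u" and "u3 \<equiv> Dx3 u" and "u4 \<equiv> Dx4 u"
  shows "u4 absolutely_integrable_on {c..1}"
    "\<And>x. x \<in> {c..1} \<Longrightarrow> u3 x = u3 c + integral {c..x} u4"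
    "continuous_on {c..1} u3"
    "\<And>x. x \<in> {c..1} \<Longrightarrow> (u2 has_real_derivative u3 x) (at x within {c..1})"
    "continuous_on {c..1} u2"
    "\<And>x. x \<in> {c..1} \<Longrightarrow> (Dx u has_real_derivative u2 x) (at x within {c..1})"
proof -
  have A: "AC_loc u2" "AC_loc u3" "L2w a (\<lambda>x. a x * u4 x)" "H2w0 a u"
    using u by (auto simp: DomA_def u2_def u3_def u4_def)
  have i4: "u4 integrable_on {c..1}" and i3: "u3 integrable_on {c..1}"
    using A(1,2) c unfolding AC_loc_def u2_def u3_def u4_def by blast+
  show e3: "u3 x = u3 c + integral {c..x} u4" if "x \<in> {c..1}" for x
    using A(2) c that unfolding AC_loc_def u3_def u4_def by blast
  have e2: "u2 x = u2 c + integral {c..x} u3" if "x \<in> {c..1}" for x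
    using A(1) c that unfolding AC_loc_def u2_def u3_def by blast
  show "u4 absolutely_integrable_on {c..1}"
  proof (rule absolutely_integrable_integrable_bound[OF _ i4])
    have "(\<lambda>x. a x * u4 x) absolutely_integrable_on {0..1}"
      using A(3) L2_absolutely_integrable by (auto simp: L2w_def)
    then have "(\<lambda>x. \<bar>a x * u4 x\<bar>) integrable_on {0..1}" by (simp add: absolutely_integrable_on_def)
    then have "(\<lambda>x. \<bar>a x * u4 x\<bar>) integrable_on {c..1}"
      using c by (auto intro: integrable_on_subinterval)
    then show "(\<lambda>x. 1 / (c\<^sup>2 * a 1) * \<bar>a x * u4 x\<bar>) integrable_on {c..1}"
      by (rule integrable_on_mult_right)
    fix x assume x: "x \<in> {c..1}"
    then have x1: "x \<in> {0<..1}" "x \<in> {0..1}" using c by auto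
    \<comment> \<open>On [c, 1] the coefficient is at least c^2 a(1), so u'''' inherits
      integrability from a u''''.\<close>
    have "c\<^sup>2 \<le> x\<^sup>2" using x c by (intro power_mono) auto
    also have "x\<^sup>2 \<le> a x / a 1" using square_over_a_le[OF x1(2)] a_pos[OF x1(1)] a1_pos by (simp add: field_simps)
    finally have "1 \<le> a x / (c\<^sup>2 * a 1)" using c a1_pos by (simp add: field_simps)
    then have "1 * \<bar>u4 x\<bar> \<le> a x / (c\<^sup>2 * a 1) * \<bar>u4 x\<bar>" by (intro mult_right_mono) auto
    then show "norm (u4 x) \<le> 1 / (c\<^sup>2 * a 1) * \<bar>a x * u4 x\<bar>"
      using a_pos[OF x1(1)] by (simp add: abs_mult)
  qed
  show c3: "continuous_on {c..1} u3"
  proof -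
    have "continuous_on {c..1} (\<lambda>x. u3 c + integral {c..x} u4)"
      by (intro continuous_intros indefinite_integral_continuous_1 i4)
    then show ?thesis by (rule continuous_on_eq) (rule e3[symmetric])
  qed
  show c2: "continuous_on {c..1} u2"
  proof -
    have "continuous_on {c..1} (\<lambda>x. u2 c + integral {c..x} u3)"
      by (intro continuous_intros indefinite_integral_continuous_1 i3)
    then show ?thesis by (rule continuous_on_eq) (rule e2[symmetric])
  qed
  show "(u2 has_real_derivative u3 x) (at x within {c..1})" if "x \<in> {c..1}" for x
    by (rule continuous_AC_derivative[OF e2 c3 that])
  have h: "H1 (Dx u)" using H2w0_D(8)[OF A(4)] .
  have e1: "Dx u x = Dx u c + integral {c..x} u2" if x: "x \<in> {c..1}" for x
  proof -
    have "u2 integrable_on {0..x}"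
      using x c L2_integrable[OF H1_D(1)[OF h]] unfolding u2_def by (auto intro: integrable_on_subinterval)
    then have "integral {0..c} u2 + integral {c..x} u2 = integral {0..x} u2"
      using x c by (intro Henstock_Kurzweil_Integration.integral_combine) auto
    moreover have "Dx u x = Dx u 0 + integral {0..x} u2" "Dx u c = Dx u 0 + integral {0..c} u2"
      unfolding u2_def by (rule H1_D(2)[OF h]; use x c in force)+
    ultimately show ?thesis by linarith
  qed
  show "(Dx u has_real_derivative u2 x) (at x within {c..1})" if "x \<in> {c..1}" for x
    by (rule continuous_AC_derivative[OF e1 c2 that])
qed

text \<open>Weighted Cauchy-Schwarz for a u'''' against the indicator of [x, 1]: the integral of 1/a
  over [x, 1] is at most 1/(a(1) x). The third derivative may blow up, but only like x^(-1/2), which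
  a factor vanishing linearly at 0 overcomes.\<close>

lemma DomA_third_derivative_bound:
  assumes u: "DomA a u"
  shows "\<exists>C\<ge>0. \<forall>x\<in>{0<..1}. \<bar>Dx3 u x\<bar> \<le> C / sqrt x"
proof -
  define u3 u4 where "u3 = Dx3 u" and "u4 = Dx4 u"
  have A: "L2w a (\<lambda>x. a x * u4 x)" using u by (auto simp: DomA_def u4_def)
  define G where "G = ipw a (\<lambda>x. a x * u4 x) (\<lambda>x. a x * u4 x)"
  have G0: "0 \<le> G" unfolding G_def by (rule ipw_nonneg[OF weight_a])
  have "\<bar>u3 x\<bar> \<le> (\<bar>u3 1\<bar> + sqrt (G / a 1)) / sqrt x" if x: "x \<in> {0<..1}" for x
  proof -
    note F = DomA_facts[OF u x, folded u3_def u4_def]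
    define h where "h = (\<lambda>t. indicator {x..1} t :: real)"
    have hm: "h \<in> borel_measurable (lebesgue_on {0..1})"
      unfolding h_def by (intro measurable_restrict_space1 borel_measurable_indicator) auto
    have I: "((\<lambda>t. 1 / t\<^sup>2) has_integral (- 1 / 1 - (- 1 / x))) {x..1}"
      using x by (intro fundamental_theorem_of_calculus)
       (auto simp: has_real_derivative_iff_has_vector_derivative[symmetric] power2_eq_square intro!: derivative_eq_intros)
    have int: "((\<lambda>t. if t \<in> {x..1} then 1 / t\<^sup>2 else 0) has_integral (1 / x - 1)) {0..1}"
      using x has_integral_restrict[of "{x..1}" "{0..1}" "\<lambda>t. 1 / t\<^sup>2"] I by auto
    have bound: "\<bar>(h t)\<^sup>2 / a t\<bar> \<le> 1 / a 1 * (if t \<in> {x..1} then 1 / t\<^sup>2 else 0)" if t: "t \<in> {0..1}" for t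
    proof (cases "t \<in> {x..1}")
      case True
      then have "t \<in> {0<..1}" using x by auto
      then show ?thesis using square_over_a_le[OF t] a_pos[of t] a1_pos True by (simp add: h_def field_simps)
    next
      case False
      then have "h t = 0" by (simp add: h_def)
      then show ?thesis using False by (simp only: if_False) simp
    qed
    have hint: "(\<lambda>t. (h t)\<^sup>2 / a t) integrable_on {0..1}"
    proof (rule measurable_bounded_by_integrable_imp_integrable)
      show "(\<lambda>t. (h t)\<^sup>2 / a t) \<in> borel_measurable (lebesgue_on {0..1})"
        using weight_a hm unfolding weight_def by auto
      show "(\<lambda>t. 1 / a 1 * (if t \<in> {x..1} then 1 / t\<^sup>2 else 0)) integrable_on {0..1}"
        using int by (intro integrable_on_mult_right) auto
    qed (use bound in auto)
    have hL: "L2w a h" unfolding L2w_def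
      using hint L2_bounded[OF hm, of 1] by (auto simp: h_def indicator_def)
    have "ipw a h h \<le> integral {0..1} (\<lambda>t. 1 / a 1 * (if t \<in> {x..1} then 1 / t\<^sup>2 else 0))"
      unfolding ipw_square
      by (intro integral_le hint integrable_on_mult_right has_integral_integrable[OF int])
         (rule order_trans[OF abs_ge_self bound])
    also have "\<dots> = 1 / a 1 * (1 / x - 1)"
      unfolding Henstock_Kurzweil_Integration.integral_mult_right integral_unique[OF int] ..
    also have "\<dots> \<le> 1 / a 1 * (1 / x)" using a1_pos by (intro mult_left_mono) auto
    finally have hh: "ipw a h h \<le> 1 / (a 1 * x)" by simp
    have "ipw a (\<lambda>x. a x * u4 x) h = integral {0..1} (\<lambda>t. if t \<in> {x..1} then u4 t else 0)"
      unfolding ipw_def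
    proof (rule Henstock_Kurzweil_Integration.integral_cong)
      fix t :: real assume t: "t \<in> {0..1}"
      show "a t * u4 t * h t / a t = (if t \<in> {x..1} then u4 t else 0)"
        using a_pos[of t] t x by (auto simp: h_def)
    qed
    also have "\<dots> = integral {x..1} u4"
    proof -
      have "{x..1} \<inter> {0..1} = {x..1}" using x by auto
      then show ?thesis by (simp only: integral_restrict_Int)
    qed
    also have "\<dots> = u3 1 - u3 x" using F(2)[of 1] x by auto
    finally have "(u3 1 - u3 x)\<^sup>2 \<le> G * ipw a h h"
      using ipw_Cauchy_Schwarz[OF weight_a A hL] by (simp add: G_def)
    also have "\<dots> \<le> G * (1 / (a 1 * x))" by (intro mult_left_mono hh G0)
    finally have "sqrt ((u3 1 - u3 x)\<^sup>2) \<le> sqrt (G / a 1 / x)" by (intro real_sqrt_le_mono) (simp add: field_simps)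
    then have "\<bar>u3 1 - u3 x\<bar> \<le> sqrt (G / a 1) / sqrt x" by (simp add: real_sqrt_divide real_sqrt_mult)
    moreover have "\<bar>u3 1\<bar> \<le> \<bar>u3 1\<bar> / sqrt x"
      using x by (simp add: le_divide_eq mult_left_le)
    moreover have "\<bar>u3 x\<bar> \<le> \<bar>u3 1\<bar> + \<bar>u3 1 - u3 x\<bar>" by linarith
    ultimately show ?thesis unfolding add_divide_distrib by linarith
  qed
  moreover have "0 \<le> \<bar>u3 1\<bar> + sqrt (G / a 1)" using G0 a1_pos by simp
  ultimately show ?thesis unfolding u3_def by blast
qed

text \<open>The bound x^(-1/2) for the third derivative is integrable up to 0.\<close>

lemma DomA_second_derivative_bound:
  assumes u: "DomA a u"
  shows "\<exists>M. \<forall>x\<in>{0<..1}. \<bar>Dx2 u x\<bar> \<le> M"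
proof -
  define u2 u3 where "u2 = Dx2 u" and "u3 = Dx3 u"
  obtain C where C: "C \<ge> 0" "\<And>x. x \<in> {0<..1} \<Longrightarrow> \<bar>u3 x\<bar> \<le> C / sqrt x"
    using DomA_third_derivative_bound[OF u] unfolding u3_def by blast
  have "\<bar>u2 x\<bar> \<le> \<bar>u2 1\<bar> + 2 * C" if x: "x \<in> {0<..1}" for x
  proof -
    note F = DomA_facts[OF u x, folded u2_def u3_def]
    have I: "((\<lambda>t. C / sqrt t) has_integral (2 * C * sqrt 1 - 2 * C * sqrt x)) {x..1}"
      using x by (intro fundamental_theorem_of_calculus)
       (auto simp: has_real_derivative_iff_has_vector_derivative[symmetric] field_simps intro!: derivative_eq_intros)
    have J: "(u3 has_integral (u2 1 - u2 x)) {x..1}"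
      using x by (intro fundamental_theorem_of_calculus)
       (auto simp: has_real_derivative_iff_has_vector_derivative[symmetric] intro!: F(4))
    have "norm (integral {x..1} u3) \<le> integral {x..1} (\<lambda>t. C / sqrt t)"
      using I J x C(2) by (intro integral_norm_bound_integral) auto
    then have "\<bar>u2 1 - u2 x\<bar> \<le> 2 * C - 2 * C * sqrt x" using I J by (simp add: integral_unique)
    moreover have "0 \<le> 2 * C * sqrt x" using C(1) x by simp
    ultimately show ?thesis by linarith
  qed
  then show ?thesis unfolding u2_def by blast
qed

lemma integrable_DomA_product:
  assumes u: "DomA a u" and w: "L2w a w"
  shows "(\<lambda>x. Dx4 u x * w x) integrable_on {0..1}"
    "integral {0..1} (\<lambda>x. Dx4 u x * w x) = ipw a (\<lambda>x. a x * Dx4 u x) w"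
proof -
  define u4 where "u4 = Dx4 u"
  have A: "L2w a (\<lambda>x. a x * u4 x)" using u by (auto simp: DomA_def u4_def)
  have h: "((\<lambda>x. a x * u4 x * w x / a x) has_integral ipw a (\<lambda>x. a x * u4 x) w) {0..1}"
    by (rule has_integral_ipw[OF weight_a A w])
  have "((\<lambda>x. u4 x * w x) has_integral ipw a (\<lambda>x. a x * u4 x) w) {0..1}"
  proof (rule has_integral_spike[OF _ _ h])
    \<comment> \<open>Cancelling a fails only at 0, where a vanishes.\<close>
    show "negligible {0::real}" by simp
    fix x :: real assume "x \<in> {0..1} - {0}"
    then show "u4 x * w x = a x * u4 x * w x / a x" using a_pos[of x] by simp
  qed
  then show "(\<lambda>x. Dx4 u x * w x) integrable_on {0..1}"
    "integral {0..1} (\<lambda>x. Dx4 u x * w x) = ipw a (\<lambda>x. a x * Dx4 u x) w"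
    unfolding u4_def by (auto simp: integral_unique)
qed

text \<open>Integration by parts on [c, 1], then c to 0. At c the terms are u''' w = O(sqrt c) and
  u'' w', where u'' is bounded and w' tends to 0. The limit L is a parameter because for w = x u'
  the integral of u'' w'' is evaluated by a further identity on [c, 1].\<close>

lemma Gauss_Green:
  assumes u: "DomA a u" and wL: "L2w a w"
    and w: "\<And>c x. c \<in> {0<..1} \<Longrightarrow> x \<in> {c..1} \<Longrightarrow> (w has_real_derivative w1 x) (at x within {c..1})"
    and w1: "\<And>c x. c \<in> {0<..1} \<Longrightarrow> x \<in> {c..1} \<Longrightarrow> w1 x = w1 c + integral {c..x} w2"
    and w2: "\<And>c. c \<in> {0<..1} \<Longrightarrow> w2 absolutely_integrable_on {c..1}"
    and w0: "\<And>x. x \<in> {0<..1} \<Longrightarrow> \<bar>w x\<bar> \<le> D * x" and w10: "(w1 \<longlongrightarrow> 0) (at_right 0)"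
    and L: "((\<lambda>c. integral {c..1} (\<lambda>x. Dx2 u x * w2 x)) \<longlongrightarrow> L) (at_right 0)"
  shows "ipw a (\<lambda>x. a x * Dx4 u x) w = Dx3 u 1 * w 1 - Dx2 u 1 * w1 1 + L"
proof -
  define u2 u3 u4 where "u2 = Dx2 u" and "u3 = Dx3 u" and "u4 = Dx4 u"
  define th where "th c = u3 c * w c - u2 c * w1 c" for c
  have step: "integral {c..1} (\<lambda>x. u4 x * w x) = th 1 - th c + integral {c..1} (\<lambda>x. u2 x * w2 x)"
    if c: "c \<in> {0<..1}" for c
  proof -
    note F = DomA_facts[OF u c, folded u2_def u3_def u4_def]
    have cw1: "continuous_on {c..1} w1"
    proof -
      have "w2 integrable_on {c..1}" using w2[OF c] by (simp add: absolutely_integrable_on_def)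
      then have "continuous_on {c..1} (\<lambda>x. w1 c + integral {c..x} w2)"
        by (intro continuous_intros indefinite_integral_continuous_1)
      then show ?thesis by (rule continuous_on_eq) (rule w1[OF c, symmetric])
    qed
    have c1: "c \<le> 1" using c by simp
    have I1: "((\<lambda>x. u4 x * w x + u3 x * w1 x) has_integral (u3 1 * w 1 - u3 c * w c)) {c..1}"
      by (rule integration_by_parts_AC[OF c1 F(1) F(2) w[OF c] cw1])
    have I2: "((\<lambda>x. w2 x * u2 x + w1 x * u3 x) has_integral (w1 1 * u2 1 - w1 c * u2 c)) {c..1}"
      by (rule integration_by_parts_AC[OF c1 w2[OF c] w1[OF c] F(4) F(3)])
    have "(\<lambda>x. w2 x * u2 x) integrable_on {c..1}"
    proof -
      have "(\<lambda>x. w1 x * u3 x) integrable_on {c..1}"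
        by (intro integrable_continuous_real continuous_intros cw1 F(3))
      from integrable_diff[OF has_integral_integrable[OF I2] this] show ?thesis by simp
    qed
    then have I3: "((\<lambda>x. w2 x * u2 x) has_integral integral {c..1} (\<lambda>x. u2 x * w2 x)) {c..1}"
      by (simp add: mult.commute has_integral_integral)
    have "((\<lambda>x. (u4 x * w x + u3 x * w1 x) - (w2 x * u2 x + w1 x * u3 x) + w2 x * u2 x) has_integral
       (u3 1 * w 1 - u3 c * w c) - (w1 1 * u2 1 - w1 c * u2 c) + integral {c..1} (\<lambda>x. u2 x * w2 x)) {c..1}"
      by (intro has_integral_add has_integral_diff I1 I2 I3)
    then have "integral {c..1} (\<lambda>x. (u4 x * w x + u3 x * w1 x) - (w2 x * u2 x + w1 x * u3 x) + w2 x * u2 x)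
       = (u3 1 * w 1 - u3 c * w c) - (w1 1 * u2 1 - w1 c * u2 c) + integral {c..1} (\<lambda>x. u2 x * w2 x)"
      by (rule integral_unique)
    then show ?thesis by (simp add: th_def mult.commute)
  qed
  obtain C where C: "C \<ge> 0" "\<And>x. x \<in> {0<..1} \<Longrightarrow> \<bar>u3 x\<bar> \<le> C / sqrt x"
    using DomA_third_derivative_bound[OF u] unfolding u3_def by blast
  obtain M where M: "\<And>x. x \<in> {0<..1} \<Longrightarrow> \<bar>u2 x\<bar> \<le> M"
    using DomA_second_derivative_bound[OF u] unfolding u2_def by blast
  have th0: "(th \<longlongrightarrow> 0) (at_right 0)"
  proof (rule Lim_null_comparison)
    have "((\<lambda>c. C * D * sqrt c + M * \<bar>w1 c\<bar>) \<longlongrightarrow> C * D * sqrt 0 + M * \<bar>0\<bar>) (at_right 0)"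
      by (intro tendsto_intros w10)
    then show "((\<lambda>c. C * D * sqrt c + M * \<bar>w1 c\<bar>) \<longlongrightarrow> 0) (at_right 0)" by simp
    show "\<forall>\<^sub>F c in at_right 0. norm (th c) \<le> C * D * sqrt c + M * \<bar>w1 c\<bar>"
    proof (rule eventually_mono[OF eventually_at_right_0_1])
      fix c :: real assume c: "c \<in> {0<..1}"
      have "\<bar>u3 c * w c\<bar> \<le> (C / sqrt c) * (D * c)"
        unfolding abs_mult using C c by (intro mult_mono C(2) w0) auto
      also have "\<dots> = C * D * sqrt c" using c by (simp add: field_simps real_sqrt_mult_self flip: power2_eq_square)
      finally have "\<bar>u3 c * w c\<bar> \<le> C * D * sqrt c" .
      moreover have "\<bar>u2 c * w1 c\<bar> \<le> M * \<bar>w1 c\<bar>"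
        unfolding abs_mult by (intro mult_right_mono M c) auto
      ultimately show "norm (th c) \<le> C * D * sqrt c + M * \<bar>w1 c\<bar>" unfolding th_def real_norm_def by linarith
    qed
  qed
  have lim: "((\<lambda>c. th 1 - th c + integral {c..1} (\<lambda>x. u2 x * w2 x)) \<longlongrightarrow> th 1 - 0 + L) (at_right 0)"
    by (intro tendsto_intros th0 L[folded u2_def])
  have "((\<lambda>c. integral {c..1} (\<lambda>x. u4 x * w x)) \<longlongrightarrow> th 1 - 0 + L) (at_right 0)"
    by (rule Lim_transform_eventually[OF lim])
       (rule eventually_mono[OF eventually_at_right_0_1], simp add: step)
  moreover have "((\<lambda>c. integral {c..1} (\<lambda>x. u4 x * w x)) \<longlongrightarrow> ipw a (\<lambda>x. a x * u4 x) w) (at_right 0)"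
    using integral_tail_tendsto[OF integrable_DomA_product(1)[OF u wL]] integrable_DomA_product(2)[OF u wL]
    by (simp add: u4_def)
  ultimately have "ipw a (\<lambda>x. a x * u4 x) w = th 1 - 0 + L"
    by (intro tendsto_unique[of "at_right (0::real)"]) auto
  then show ?thesis by (simp add: th_def u2_def u3_def u4_def)
qed

lemma Gauss_Green_H2w0:
  assumes u: "DomA a u" and w: "H2w0 a w"
  shows "ipw a (\<lambda>x. a x * Dx4 u x) w
    = Dx3 u 1 * w 1 - Dx2 u 1 * Dx w 1 + ipw1 (Dx2 u) (Dx2 w)"
proof (rule Gauss_Green[OF u])
  note h = H2w0_D[OF w]
  have hu: "L2 (Dx2 u)" using u H2w0_D(6) by (auto simp: DomA_def)
  show "L2w a w" by (rule h)
  show "(w has_real_derivative Dx w x) (at x within {c..1})" if "c \<in> {0<..1}" "x \<in> {c..1}" for c x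
    using H2_derivative[OF h(1), of x] that by (auto intro: DERIV_subset)
  show "Dx w x = Dx w c + integral {c..x} (Dx2 w)" if c: "c \<in> {0<..1}" and x: "x \<in> {c..1}" for c x
  proof -
    have "Dx2 w integrable_on {0..x}"
      using x c L2_integrable[OF h(6)] by (auto intro: integrable_on_subinterval)
    then have "integral {0..c} (Dx2 w) + integral {c..x} (Dx2 w) = integral {0..x} (Dx2 w)"
      using x c by (intro Henstock_Kurzweil_Integration.integral_combine) auto
    moreover have "Dx w x = Dx w 0 + integral {0..x} (Dx2 w)" "Dx w c = Dx w 0 + integral {0..c} (Dx2 w)"
      by (rule H1_D(2)[OF h(8)]; use x c in force)+
    ultimately show ?thesis by linarith
  qed
  show "Dx2 w absolutely_integrable_on {c..1}" if "c \<in> {0<..1}" for c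
    using set_integrable_subset[OF L2_absolutely_integrable[OF h(6)], of "{c..1}"] that by auto
  show "\<bar>w x\<bar> \<le> sqrt (bending w) * x" if "x \<in> {0<..1}" for x
    using H2_zero_bounds(3)[OF h(1-3)] that by auto
  have "(Dx w \<longlongrightarrow> Dx w 0) (at 0 within {0..1})"
    using H1_continuous[OF h(8)] by (simp add: continuous_on_def)
  then show "(Dx w \<longlongrightarrow> 0) (at_right 0)" by (simp add: at_within_Icc_at_right h(3))
  show "((\<lambda>c. integral {c..1} (\<lambda>x. Dx2 u x * Dx2 w x)) \<longlongrightarrow> ipw1 (Dx2 u) (Dx2 w)) (at_right 0)"
    using integral_tail_tendsto[of "\<lambda>x. Dx2 u x * Dx2 w x"]
      integrable_weighted_product[of "\<lambda>_. 1" "Dx2 u" "Dx2 w"] hu h(6)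
    by (simp add: ipw_def)
qed

text \<open>A Pohozaev-type identity: u'' (x u')'' = (x u''^2 / 2)' + 3/2 u''^2. The term x u''^2
  drops out at 0 because u'' stays bounded.\<close>

lemma Gauss_Green_multiplier:
  assumes u: "DomA a u"
  shows "ipw a (\<lambda>x. a x * Dx4 u x) (\<lambda>x. x * Dx u x)
    = Dx3 u 1 * Dx u 1 - Dx2 u 1 * Dx u 1 - (Dx2 u 1)\<^sup>2 / 2
      + 3 / 2 * bending u"
proof -
  define u2 u3 where "u2 = Dx2 u" and "u3 = Dx3 u"
  have uw: "H2w0 a u" using u by (simp add: DomA_def)
  note h = H2w0_D[OF uw]
  note F = DomA_facts[OF u, folded u2_def u3_def]
  define B where "B = ipw1 u2 u2"
  have u2i: "(\<lambda>x. (u2 x)\<^sup>2) integrable_on {0..1}" using h(6) by (simp add: u2_def L2_def)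
  obtain M where M: "\<And>x. x \<in> {0<..1} \<Longrightarrow> \<bar>u2 x\<bar> \<le> M"
    using DomA_second_derivative_bound[OF u] unfolding u2_def by blast
  define w1 where "w1 x = Dx u x + x * u2 x" for x
  define w2 where "w2 x = 2 * u2 x + x * u3 x" for x
  have x0: "((\<lambda>c. c) \<longlongrightarrow> 0) (at_right (0::real))" by (rule tendsto_ident_at)
  have bnd: "((\<lambda>c. c * k c) \<longlongrightarrow> 0) (at_right 0)" if "\<And>x. x \<in> {0<..1} \<Longrightarrow> \<bar>k x\<bar> \<le> M'" for k and M' :: real
  proof (rule Lim_null_comparison)
    show "((\<lambda>c::real. c * M') \<longlongrightarrow> 0) (at_right 0)" by (rule tendsto_mult_left_zero[OF x0])
    show "\<forall>\<^sub>F c in at_right 0. norm (c * k c) \<le> c * M'"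
      by (rule eventually_mono[OF eventually_at_right_0_1]) (use that in \<open>auto simp: abs_mult\<close>)
  qed
  have cw2: "continuous_on {c..1} w2" if "c \<in> {0<..1}" for c
    unfolding w2_def by (intro continuous_intros F(3)[OF that] F(5)[OF that])
  have d1: "(w1 has_real_derivative w2 x) (at x within {c..1})" if "c \<in> {0<..1}" "x \<in> {c..1}" for c x
    unfolding w1_def w2_def using F(4)[OF that] F(6)[OF that] by (auto intro!: derivative_eq_intros)
  have tail: "integral {c..1} (\<lambda>x. u2 x * w2 x) = 3 / 2 * integral {c..1} (\<lambda>x. (u2 x)\<^sup>2) + (u2 1)\<^sup>2 / 2 - c * (u2 c)\<^sup>2 / 2"
    if c: "c \<in> {0<..1}" for c
  proof -
    have I: "((\<lambda>x. (u2 x)\<^sup>2 / 2 + x * (u2 x * u3 x)) has_integral (1 * (u2 1)\<^sup>2 / 2 - c * (u2 c)\<^sup>2 / 2)) {c..1}"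
      using c by (intro fundamental_theorem_of_calculus)
       (auto simp: has_real_derivative_iff_has_vector_derivative[symmetric] power2_eq_square
         intro!: derivative_eq_intros F(4)[OF c])
    have J: "((\<lambda>x. (u2 x)\<^sup>2) has_integral integral {c..1} (\<lambda>x. (u2 x)\<^sup>2)) {c..1}"
      using c integrable_on_subinterval[OF u2i, of c 1] by auto
    have "((\<lambda>x. ((u2 x)\<^sup>2 / 2 + x * (u2 x * u3 x)) + 3 / 2 * (u2 x)\<^sup>2) has_integral
       (1 * (u2 1)\<^sup>2 / 2 - c * (u2 c)\<^sup>2 / 2) + 3 / 2 * integral {c..1} (\<lambda>x. (u2 x)\<^sup>2)) {c..1}"
      by (intro has_integral_add has_integral_mult_right I J)
    moreover have "(\<lambda>x. ((u2 x)\<^sup>2 / 2 + x * (u2 x * u3 x)) + 3 / 2 * (u2 x)\<^sup>2) = (\<lambda>x. u2 x * w2 x)"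
      by (simp add: w2_def fun_eq_iff algebra_simps power2_eq_square)
    ultimately show ?thesis by (simp add: integral_unique)
  qed
  have L: "((\<lambda>c. integral {c..1} (\<lambda>x. u2 x * w2 x)) \<longlongrightarrow> 3 / 2 * B + (u2 1)\<^sup>2 / 2 - 0 / 2) (at_right 0)"
  proof (rule Lim_transform_eventually)
    show "((\<lambda>c. 3 / 2 * integral {c..1} (\<lambda>x. (u2 x)\<^sup>2) + (u2 1)\<^sup>2 / 2 - c * (u2 c)\<^sup>2 / 2) \<longlongrightarrow> 3 / 2 * B + (u2 1)\<^sup>2 / 2 - 0 / 2) (at_right 0)"
    proof (intro tendsto_intros)
      show "((\<lambda>c. integral {c..1} (\<lambda>x. (u2 x)\<^sup>2)) \<longlongrightarrow> B) (at_right 0)"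
        using integral_tail_tendsto[OF u2i] by (simp add: B_def ipw_square_one)
      show "((\<lambda>c. c * (u2 c)\<^sup>2) \<longlongrightarrow> 0) (at_right 0)"
        by (rule bnd[of _ "M\<^sup>2"]) (use M power_mono[of "\<bar>u2 _\<bar>" M 2] in auto)
    qed simp_all
    show "\<forall>\<^sub>F c in at_right 0. 3 / 2 * integral {c..1} (\<lambda>x. (u2 x)\<^sup>2) + (u2 1)\<^sup>2 / 2 - c * (u2 c)\<^sup>2 / 2
        = integral {c..1} (\<lambda>x. u2 x * w2 x)"
      by (rule eventually_mono[OF eventually_at_right_0_1]) (simp add: tail)
  qed
  have GL: "((\<lambda>c. integral {c..1} (\<lambda>x. Dx2 u x * w2 x)) \<longlongrightarrow> 3 / 2 * B + (u2 1)\<^sup>2 / 2 - 0 / 2) (at_right 0)"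
    using L unfolding u2_def .
  have "ipw a (\<lambda>x. a x * Dx4 u x) (\<lambda>x. x * Dx u x)
      = Dx3 u 1 * (1 * Dx u 1) - Dx2 u 1 * w1 1 + (3 / 2 * B + (u2 1)\<^sup>2 / 2 - 0 / 2)"
  proof (rule Gauss_Green[OF u L2w_xDx[OF uw] _ _ _ _ _ GL])
    show "((\<lambda>x. x * Dx u x) has_real_derivative w1 x) (at x within {c..1})" if "c \<in> {0<..1}" "x \<in> {c..1}" for c x
      unfolding w1_def using F(6)[OF that] by (auto intro!: derivative_eq_intros)
    show "w1 x = w1 c + integral {c..x} w2" if "c \<in> {0<..1}" "x \<in> {c..1}" for c x
      using C1_eq_integral[OF d1[OF that(1)] cw2[OF that(1)], of x] that by auto
    show "w2 absolutely_integrable_on {c..1}" if "c \<in> {0<..1}" for c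
      by (rule absolutely_integrable_continuous_real[OF cw2[OF that]])
    show "\<bar>x * Dx u x\<bar> \<le> sqrt (bending u) * x" if "x \<in> {0<..1}" for x
      using mult_left_mono[OF H2_zero_bounds(2)[OF h(1-3)], of x x] that by (simp add: abs_mult mult.commute)
    have "(Dx u \<longlongrightarrow> Dx u 0) (at 0 within {0..1})"
      using H1_continuous[OF h(8)] by (simp add: continuous_on_def)
    then have "(Dx u \<longlongrightarrow> 0) (at_right 0)" by (simp add: at_within_Icc_at_right h(3))
    from tendsto_add[OF this bnd[of u2 M, OF M]] show "(w1 \<longlongrightarrow> 0) (at_right 0)" by (simp add: w1_def[abs_def])
  qed
  then show ?thesis by (simp add: w1_def B_def u2_def algebra_simps power2_eq_square)
qed

text \<open>z'' is affine, so the bending term too integrates to values at 1 and no interior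
  integral survives.\<close>

lemma Gauss_Green_cubic:
  fixes c1 c2 :: real
  assumes u: "DomA a u"
  defines "z \<equiv> \<lambda>x. c1 * x\<^sup>2 + c2 * x ^ 3"
  shows "ipw a (\<lambda>x. a x * Dx4 u x) z
    = Dx3 u 1 * (c1 + c2) - Dx2 u 1 * (2 * c1 + 3 * c2)
      + (Dx u 1 * (2 * c1 + 6 * c2) - u 1 * (6 * c2))"
    and "H2w0 a z"
    and "\<And>x. x \<in> {0..1} \<Longrightarrow> Dx z x = 2 * c1 * x + 3 * c2 * x\<^sup>2"
    and "\<And>x. x \<in> {0..1} \<Longrightarrow> Dx2 z x = 2 * c1 + 6 * c2 * x"
proof -
  have uw: "H2w0 a u" using u by (simp add: DomA_def)
  note h = H2w0_D[OF uw]
  have d1: "(z has_real_derivative 2 * c1 * x + 3 * c2 * x\<^sup>2) (at x within {0..1})" for x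
    unfolding z_def by (auto intro!: derivative_eq_intros)
  have d2: "((\<lambda>x. 2 * c1 * x + 3 * c2 * x\<^sup>2) has_real_derivative 2 * c1 + 6 * c2 * x) (at x within {0..1})" for x
    by (auto intro!: derivative_eq_intros)
  have cc: "continuous_on {0..1} (\<lambda>x. 2 * c1 + 6 * c2 * x)" by (intro continuous_intros)
  note Z = H2_C2[OF d1 d2 cc]
  show zw: "H2w0 a z" unfolding H2w0_iff using Z by (simp add: z_def)
  show D1: "Dx z x = 2 * c1 * x + 3 * c2 * x\<^sup>2" if "x \<in> {0..1}" for x using Z that by simp
  show D2: "Dx2 z x = 2 * c1 + 6 * c2 * x" if "x \<in> {0..1}" for x using Z that by simp
  have ud: "(u has_real_derivative Dx u x) (at x within {0..1})" if "x \<in> {0..1}" for x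
    by (rule H2_derivative[OF h(1) that])
  have "((\<lambda>x. Dx2 u x * (2 * c1 + 6 * c2 * x) + Dx u x * (6 * c2)) has_integral
     (Dx u 1 * (2 * c1 + 6 * c2 * 1) - Dx u 0 * (2 * c1 + 6 * c2 * 0))) {0..1}"
    by (rule integration_by_parts_AC[OF _ L2_absolutely_integrable[OF h(6)]])
       (auto intro!: H1_D(2)[OF h(8)] derivative_eq_intros)
  moreover have "((\<lambda>x. Dx u x * (6 * c2)) has_integral (u 1 * (6 * c2) - u 0 * (6 * c2))) {0..1}"
    by (intro fundamental_theorem_of_calculus)
       (auto simp: has_real_derivative_iff_has_vector_derivative[symmetric] intro!: derivative_eq_intros ud)
  ultimately have "((\<lambda>x. Dx2 u x * (2 * c1 + 6 * c2 * x) + Dx u x * (6 * c2) - Dx u x * (6 * c2)) has_integral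
     (Dx u 1 * (2 * c1 + 6 * c2 * 1) - Dx u 0 * (2 * c1 + 6 * c2 * 0)) - (u 1 * (6 * c2) - u 0 * (6 * c2))) {0..1}"
    by (rule has_integral_diff)
  then have "integral {0..1} (\<lambda>x. Dx2 u x * (2 * c1 + 6 * c2 * x)) = Dx u 1 * (2 * c1 + 6 * c2) - u 1 * (6 * c2)"
    using h(2,3) by (simp add: integral_unique)
  moreover have "ipw1 (Dx2 u) (Dx2 z) = integral {0..1} (\<lambda>x. Dx2 u x * (2 * c1 + 6 * c2 * x))"
    unfolding ipw_def by (rule Henstock_Kurzweil_Integration.integral_cong) (simp add: D2)
  ultimately show "ipw a (\<lambda>x. a x * Dx4 u x) z
    = Dx3 u 1 * (c1 + c2) - Dx2 u 1 * (2 * c1 + 3 * c2)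
      + (Dx u 1 * (2 * c1 + 6 * c2) - u 1 * (6 * c2))"
    using Gauss_Green_H2w0[OF u zw] D1[of 1] by (simp add: z_def)
qed

text \<open>The derivative of v^2 x / a is 2 v x v' / a + (v^2 / a) (1 - x a' / a), and x a' <= K a.
  It is an inequality also because the term -v(c)^2 c / a(c) at the left end is dropped by its sign
  before c tends to 0.\<close>

lemma ipw_multiplier_le:
  assumes v: "H2w0 a v"
  shows "2 * ipw a v (\<lambda>x. x * Dx v x) \<le> (v 1)\<^sup>2 / a 1 - (1 - K) * ipw a v v"
proof -
  note h = H2w0_D[OF v]
  obtain a' where *: "continuous_on {0<..1} a' \<and> (\<forall>x\<in>{0<..1}.
     (a has_real_derivative a' x) (at x within {0<..1}) \<and> x * \<bar>a' x\<bar> \<le> K * a x)"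
    using a_derivative by blast
  define f where "f = (\<lambda>x. 2 * (v x * (x * Dx v x) / a x) + (1 - K) * (v x * v x / a x))"
  have f: "(f has_integral 2 * ipw a v (\<lambda>x. x * Dx v x) + (1 - K) * ipw a v v) {0..1}"
    unfolding f_def by (intro has_integral_add has_integral_mult_right has_integral_ipw weight_a h L2w_xDx v)
  have le: "integral {c..1} f \<le> (v 1)\<^sup>2 / a 1" if c: "c \<in> {0<..1}" for c
  proof -
    define g where "g x = 2 * (v x * (x * Dx v x) / a x) + v x * v x / a x * (1 - x * a' x / a x)" for x
    have d: "((\<lambda>x. (v x)\<^sup>2 * x / a x) has_real_derivative g x) (at x within {c..1})" if x: "x \<in> {c..1}" for x
    proof -
      have x1: "x \<in> {0<..1}" "x \<in> {0..1}" using x c by auto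
      have "(a has_real_derivative a' x) (at x within {0<..1})" using * x1 by blast
      then have da: "(a has_real_derivative a' x) (at x within {c..1})"
        by (rule DERIV_subset) (use c in auto)
      have dv: "(v has_real_derivative Dx v x) (at x within {c..1})"
        by (rule DERIV_subset[OF H2_derivative[OF h(1) x1(2)]]) (use c in auto)
      have ax: "a x \<noteq> 0" using a_pos[OF x1(1)] by simp
      show ?thesis
        unfolding g_def using ax
        by (auto intro!: derivative_eq_intros da dv simp: field_simps power2_eq_square)
    qed
    have I: "(g has_integral ((v 1)\<^sup>2 * 1 / a 1 - (v c)\<^sup>2 * c / a c)) {c..1}"
      using c by (intro fundamental_theorem_of_calculus)
       (auto simp: has_real_derivative_iff_has_vector_derivative[symmetric] intro!: d)
    have "integral {c..1} f \<le> integral {c..1} g"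
    proof (rule integral_le)
      show "f integrable_on {c..1}" using f c by (auto intro: integrable_on_subinterval)
      show "g integrable_on {c..1}" using I by auto
      fix x assume x: "x \<in> {c..1}"
      then have x1: "x \<in> {0<..1}" using c by auto
      have "x * a' x \<le> x * \<bar>a' x\<bar>" using x1 by (intro mult_left_mono) auto
      also have "\<dots> \<le> K * a x" using * x1 by blast
      finally have "x * a' x / a x \<le> K" using a_pos[OF x1] by (simp add: divide_le_eq)
      moreover have "0 \<le> v x * v x / a x" using a_pos[OF x1] by simp
      ultimately have "(1 - K) * (v x * v x / a x) \<le> (1 - x * a' x / a x) * (v x * v x / a x)"
        by (intro mult_right_mono) auto
      then show "f x \<le> g x" by (simp add: f_def g_def mult.commute)
    qed
    also have "\<dots> = (v 1)\<^sup>2 * 1 / a 1 - (v c)\<^sup>2 * c / a c" using I by (rule integral_unique)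
    also have "\<dots> \<le> (v 1)\<^sup>2 / a 1" using c a_pos[OF c] by simp
    finally show ?thesis .
  qed
  have "((\<lambda>c. integral {c..1} f) \<longlongrightarrow> integral {0..1} f) (at_right 0)"
    by (rule integral_tail_tendsto) (use f in auto)
  then have "integral {0..1} f \<le> (v 1)\<^sup>2 / a 1"
    by (rule tendsto_upperbound) (rule eventually_mono[OF eventually_at_right_0_1], rule le, simp_all)
  then show ?thesis using f by (simp add: integral_unique)
qed

end

section \<open>The dissipation inequality\<close>

text \<open>Coefficient algebra for z = c1 x^2 + c2 x^3: s = z(1), r = z'(1), \<open>Bz\<close> is
  the integral of z''^2, and l, m are the boundary data. The identity for l s + m r is the weak
  formulation tested with z itself; combined with Cauchy-Schwarz it bounds z by its data.\<close>

lemma clamped_cubic_bounds: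
  fixes \<beta> \<gamma> c1 c2 :: real
  assumes "0 \<le> \<beta>" "0 \<le> \<gamma>"
  defines "l \<equiv> \<beta> * (c1 + c2) - 6 * c2" and "m \<equiv> \<gamma> * (2 * c1 + 3 * c2) + (2 * c1 + 6 * c2)"
    and "s \<equiv> c1 + c2" and "r \<equiv> 2 * c1 + 3 * c2" and "Bz \<equiv> 4 * c1\<^sup>2 + 12 * c1 * c2 + 12 * c2\<^sup>2"
  shows "s\<^sup>2 \<le> Bz" "r\<^sup>2 \<le> Bz" "l * s + m * r = Bz + \<beta> * s\<^sup>2 + \<gamma> * r\<^sup>2"
    "Bz \<le> 2 * (l\<^sup>2 + m\<^sup>2)"
    "\<mu> > 0 \<Longrightarrow> \<mu> * (s\<^sup>2 + r\<^sup>2) \<le> Bz + \<beta> * s\<^sup>2 + \<gamma> * r\<^sup>2 \<Longrightarrow> \<mu>\<^sup>2 * (s\<^sup>2 + r\<^sup>2) \<le> l\<^sup>2 + m\<^sup>2"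
proof -
  \<comment> \<open>Completing the square; 8/3 = 11 - 25/3 is what remains of the coefficient of
    c2^2.\<close>
  have "Bz - s\<^sup>2 = 3 * (c1 + 5/3 * c2)\<^sup>2 + 8/3 * c2\<^sup>2"
    by (simp add: Bz_def s_def power2_eq_square algebra_simps)
  moreover have "0 \<le> 3 * (c1 + 5/3 * c2)\<^sup>2 + 8/3 * c2\<^sup>2" by simp
  ultimately show sB: "s\<^sup>2 \<le> Bz" by linarith
  have "Bz - r\<^sup>2 = 3 * c2\<^sup>2" by (simp add: Bz_def r_def power2_eq_square algebra_simps)
  moreover have "0 \<le> 3 * c2\<^sup>2" by simp
  ultimately show rB: "r\<^sup>2 \<le> Bz" by linarith
  show Q: "l * s + m * r = Bz + \<beta> * s\<^sup>2 + \<gamma> * r\<^sup>2"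
    by (simp add: Bz_def r_def s_def l_def m_def power2_eq_square algebra_simps)
  define Q where "Q = Bz + \<beta> * s\<^sup>2 + \<gamma> * r\<^sup>2"
  define q where "q = s\<^sup>2 + r\<^sup>2"
  have q0: "0 \<le> q" by (simp add: q_def)
  have CS: "Q\<^sup>2 \<le> (l\<^sup>2 + m\<^sup>2) * q"
  proof -
    have "(l\<^sup>2 + m\<^sup>2) * q - (l * s + m * r)\<^sup>2 = (l * r - m * s)\<^sup>2"
      by (simp add: q_def power2_eq_square algebra_simps)
    moreover have "0 \<le> (l * r - m * s)\<^sup>2" by simp
    ultimately show ?thesis unfolding Q_def Q[symmetric] by linarith
  qed
  show main: "\<mu>\<^sup>2 * (s\<^sup>2 + r\<^sup>2) \<le> l\<^sup>2 + m\<^sup>2" if mu: "\<mu> > 0" "\<mu> * (s\<^sup>2 + r\<^sup>2) \<le> Bz + \<beta> * s\<^sup>2 + \<gamma> * r\<^sup>2" for \<mu>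
  proof (cases "q = 0")
    case False
    with q0 have q: "q > 0" by simp
    have "(\<mu> * q)\<^sup>2 \<le> Q\<^sup>2" using mu q by (intro power_mono) (auto simp: q_def Q_def)
    also note CS
    finally have "(\<mu>\<^sup>2 * q) * q \<le> (l\<^sup>2 + m\<^sup>2) * q" by (simp add: power2_eq_square mult_ac)
    then show ?thesis using q by (simp add: q_def)
  qed (simp add: q_def)
  \<comment> \<open>From Q^2 <= (l^2 + m^2) q and q <= 2 Bz <= 2 Q; afterwards one factor Q is
    cancelled.\<close>
  have "Q * Q \<le> (2 * (l\<^sup>2 + m\<^sup>2)) * Q"
  proof -
    have "q \<le> 2 * Bz" using sB rB by (simp add: q_def)
    also have "\<dots> \<le> 2 * Q" using assms(1,2) by (simp add: Q_def)
    finally have "(l\<^sup>2 + m\<^sup>2) * q \<le> (l\<^sup>2 + m\<^sup>2) * (2 * Q)" by (intro mult_left_mono) auto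
    then show ?thesis using CS by (simp add: power2_eq_square algebra_simps)
  qed
  then have "Q \<le> 2 * (l\<^sup>2 + m\<^sup>2)"
    by (cases "Q > 0") (auto intro: order_trans[of Q 0])
  moreover have "Bz \<le> Q" using assms(1,2) by (simp add: Q_def)
  ultimately show "Bz \<le> 2 * (l\<^sup>2 + m\<^sup>2)" by linarith
qed

lemma Young_real: "d > 0 \<Longrightarrow> x * y \<le> d * x\<^sup>2 + 1 / (4 * d) * y\<^sup>2" for x y d :: real
proof -
  assume d: "d > 0"
  have "0 \<le> d * (x - y / (2 * d))\<^sup>2" using d by simp
  also have "\<dots> = d * x\<^sup>2 - x * y + 1 / (4 * d) * y\<^sup>2"
    using d by (simp add: field_simps power2_eq_square)
  finally show ?thesis by linarith
qed

lemma ipw_minus_left: "ipw w (\<lambda>x. - f x) g = - ipw w f g"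
  by (simp add: ipw_def)

context beam begin

section \<open>The cubic lift of the boundary values\<close>

text \<open>Cramer's rule for the two conditions at 1 on c1 x^2 + c2 x^3. The determinant \<beta>
  \<gamma> + 4 \<beta> + 12 \<gamma> + 12 is positive, and the explicit formula makes the
  coefficients visibly linear in (l, m), as a bilinear form requires.\<close>

definition zc1 :: "real \<Rightarrow> real \<Rightarrow> real" where
  "zc1 l m = ((3 * \<gamma> + 6) * l - (\<beta> - 6) * m) / (\<beta> * \<gamma> + 4 * \<beta> + 12 * \<gamma> + 12)"

definition zc2 :: "real \<Rightarrow> real \<Rightarrow> real" where
  "zc2 l m = (\<beta> * m - (2 * \<gamma> + 2) * l) / (\<beta> * \<gamma> + 4 * \<beta> + 12 * \<gamma> + 12)"

definition lift :: "real \<Rightarrow> real \<Rightarrow> real \<Rightarrow> real" where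
  "lift l m = (\<lambda>x. zc1 l m * x\<^sup>2 + zc2 l m * x ^ 3)"

lemma lift_boundary:
  "\<beta> * (zc1 l m + zc2 l m) - 6 * zc2 l m = l"
  "\<gamma> * (2 * zc1 l m + 3 * zc2 l m) + (2 * zc1 l m + 6 * zc2 l m) = m"
proof -
  define D where "D = \<beta> * \<gamma> + 4 * \<beta> + 12 * \<gamma> + 12"
  have "0 \<le> \<beta> * \<gamma>" using beta_nonneg gamma_nonneg by simp
  then have D: "0 < D" unfolding D_def using beta_nonneg gamma_nonneg by linarith
  define n1 n2 where "n1 = (3 * \<gamma> + 6) * l - (\<beta> - 6) * m" and "n2 = \<beta> * m - (2 * \<gamma> + 2) * l"
  have c: "zc1 l m = n1 / D" "zc2 l m = n2 / D"
    by (simp_all add: zc1_def zc2_def D_def n1_def n2_def)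
  have "\<beta> * (zc1 l m + zc2 l m) - 6 * zc2 l m = (\<beta> * (n1 + n2) - 6 * n2) / D"
    unfolding c using D by (simp add: field_simps)
  also have "\<dots> = (D * l) / D" by (simp add: D_def n1_def n2_def algebra_simps)
  finally show "\<beta> * (zc1 l m + zc2 l m) - 6 * zc2 l m = l" using D by simp
  have "\<gamma> * (2 * zc1 l m + 3 * zc2 l m) + (2 * zc1 l m + 6 * zc2 l m)
    = (\<gamma> * (2 * n1 + 3 * n2) + (2 * n1 + 6 * n2)) / D"
    unfolding c using D by (simp add: field_simps)
  also have "\<dots> = (D * m) / D" by (simp add: D_def n1_def n2_def algebra_simps)
  finally show "\<gamma> * (2 * zc1 l m + 3 * zc2 l m) + (2 * zc1 l m + 6 * zc2 l m) = m" using D by simp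
qed

lemma lift_lin: "lift (l + c * l') (m + c * m') x = lift l m x + c * lift l' m' x"
  by (simp add: lift_def zc1_def zc2_def algebra_simps add_divide_distrib diff_divide_distrib)

text \<open>The weighted norm goes through Hardy-Poincare to the bending integral of the cubic,
  whose bound by twice the squared data is uniform in \<beta> and \<gamma>.\<close>

lemma lift_H2w0: "H2w0 a (lift l m)" and lift_ipw_le: "ipw a (lift l m) (lift l m) \<le> CHP a * (2 * (l\<^sup>2 + m\<^sup>2))"
proof -
  define c1 c2 where "c1 = zc1 l m" and "c2 = zc2 l m"
  have zd: "lift l m = (\<lambda>x. c1 * x\<^sup>2 + c2 * x ^ 3)" by (simp add: lift_def c1_def c2_def)
  have d1: "(lift l m has_real_derivative 2 * c1 * x + 3 * c2 * x\<^sup>2) (at x within {0..1})" for x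
    unfolding zd by (auto intro!: derivative_eq_intros)
  have d2: "((\<lambda>x. 2 * c1 * x + 3 * c2 * x\<^sup>2) has_real_derivative 2 * c1 + 6 * c2 * x) (at x within {0..1})" for x
    by (auto intro!: derivative_eq_intros)
  have cc: "continuous_on {0..1} (\<lambda>x. 2 * c1 + 6 * c2 * x)" by (intro continuous_intros)
  note Z = H2_C2[OF d1 d2 cc]
  show zw: "H2w0 a (lift l m)" unfolding H2w0_iff using Z by (simp add: zd)
  have "((\<lambda>x. (2 * c1 + 6 * c2 * x)\<^sup>2) has_integral
      ((4 * c1\<^sup>2 * 1 + 12 * c1 * c2 * 1\<^sup>2 + 12 * c2\<^sup>2 * 1 ^ 3) - (4 * c1\<^sup>2 * 0 + 12 * c1 * c2 * 0\<^sup>2 + 12 * c2\<^sup>2 * 0 ^ 3))) {0..1}"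
    by (rule fundamental_theorem_of_calculus)
       (auto simp: has_real_derivative_iff_has_vector_derivative[symmetric] power2_eq_square algebra_simps intro!: derivative_eq_intros)
  then have "integral {0..1} (\<lambda>x. (2 * c1 + 6 * c2 * x)\<^sup>2) = 4 * c1\<^sup>2 + 12 * c1 * c2 + 12 * c2\<^sup>2"
    by (simp add: integral_unique)
  moreover have "bending (lift l m) = integral {0..1} (\<lambda>x. (2 * c1 + 6 * c2 * x)\<^sup>2)"
    unfolding ipw_square_one by (rule Henstock_Kurzweil_Integration.integral_cong) (use Z in simp)
  ultimately have Bz: "bending (lift l m) = 4 * c1\<^sup>2 + 12 * c1 * c2 + 12 * c2\<^sup>2" by simp
  note h = H2w0_D[OF zw]
  have "ipw a (lift l m) (lift l m) \<le> CHP a * ipw1 (Dx (lift l m)) (Dx (lift l m))"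
    by (rule Hardy_Poincare[OF h(5)])
  also have "\<dots> \<le> CHP a * (4 * c1\<^sup>2 + 12 * c1 * c2 + 12 * c2\<^sup>2)"
    using H2_zero_bounds(4)[OF h(1-3), of 0] Bz by (intro mult_left_mono CHP_nonneg) auto
  also have "\<dots> \<le> CHP a * (2 * (l\<^sup>2 + m\<^sup>2))"
    using clamped_cubic_bounds(4)[OF beta_nonneg gamma_nonneg, of c1 c2] lift_boundary[of l m]
    by (intro mult_left_mono CHP_nonneg) (simp add: c1_def c2_def)
  finally show "ipw a (lift l m) (lift l m) \<le> CHP a * (2 * (l\<^sup>2 + m\<^sup>2))" .
qed

text \<open>This is 1 / max(\<beta>, 1) + 1 / max(\<gamma>, 1). In terms of it \<open>Cdelta\<close>
  is 1 - 2 \<delta> kap and \<open>nu\<close> is 1 / (2 kap), so \<delta> < \<open>nu\<close> says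
  precisely that \<open>Cdelta\<close> is positive.\<close>

definition kap :: real where
  "kap = (if \<beta> > 1 \<and> \<gamma> > 1 then 1/\<beta> + 1/\<gamma> else if \<beta> \<le> 1 \<and> \<gamma> > 1 then 1 + 1/\<gamma>
     else if \<beta> > 1 \<and> \<gamma> \<le> 1 then 1/\<beta> + 1 else 2)"

lemma Cdelta_kap: "Cdelta \<beta> \<gamma> \<delta> = 1 - 2 * \<delta> * kap"
  by (simp add: Cdelta_def kap_def)

lemma Cdelta_pos:
  assumes "\<delta> < nu \<beta> \<gamma>" shows "0 < Cdelta \<beta> \<gamma> \<delta>"
proof -
  have "nu \<beta> \<gamma> * (2 * kap) = 1"
  proof -
    have q: "x * y / (2 * (x + y)) * (2 * (1 / x + 1 / y)) = 1" if "x > 0" "y > 0" for x y :: real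
    proof -
      have "1 / x + 1 / y = (x + y) / (x * y)" using that by (simp add: field_simps)
      then show ?thesis using that by simp
    qed
    show ?thesis
      unfolding nu_def kap_def using q[of \<beta> \<gamma>] q[of 1 \<gamma>] q[of \<beta> 1] by auto
  qed
  moreover have "0 < kap" unfolding kap_def by (auto intro!: add_pos_pos)
  then have "\<delta> * (2 * kap) < nu \<beta> \<gamma> * (2 * kap)" using assms by (intro mult_strict_right_mono) auto
  ultimately show ?thesis by (simp add: Cdelta_kap mult_ac)
qed

text \<open>A coercivity constant \<mu> with \<mu> (s^2 + r^2) <= Bz + \<beta> s^2 + \<gamma> r^2
  gives s^2 + r^2 <= (l^2 + m^2) / \<mu>^2. A parameter above 1 controls its own boundary value,
  otherwise \<open>Bz\<close> does; this is the origin of the case split in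
  \<open>Cdelta\<close>.\<close>

lemma lift_boundary_values_le:
  "(zc1 l m + zc2 l m)\<^sup>2 + (2 * zc1 l m + 3 * zc2 l m)\<^sup>2 \<le> 2 * kap * (l\<^sup>2 + m\<^sup>2)"
proof -
  define s r Bz where "s = zc1 l m + zc2 l m" and "r = 2 * zc1 l m + 3 * zc2 l m"
    and "Bz = 4 * (zc1 l m)\<^sup>2 + 12 * zc1 l m * zc2 l m + 12 * (zc2 l m)\<^sup>2"
  note C = clamped_cubic_bounds[OF beta_nonneg gamma_nonneg, where ?c1.0 = "zc1 l m" and ?c2.0 = "zc2 l m", unfolded lift_boundary, folded s_def r_def Bz_def]
  have Bz0: "0 \<le> Bz" using order_trans[OF zero_le_power2 C(1)] .
  have q: "\<mu>\<^sup>2 * (s\<^sup>2 + r\<^sup>2) \<le> l\<^sup>2 + m\<^sup>2" if "\<mu> > 0" "\<mu> * (s\<^sup>2 + r\<^sup>2) \<le> Bz + \<beta> * s\<^sup>2 + \<gamma> * r\<^sup>2" for \<mu>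
    using C(5)[OF that] .
  have b0: "0 \<le> \<beta> * s\<^sup>2" "0 \<le> \<gamma> * r\<^sup>2" using beta_nonneg gamma_nonneg by auto
  have "s\<^sup>2 + r\<^sup>2 \<le> 2 * kap * (l\<^sup>2 + m\<^sup>2)"
  proof -
    consider (1) "\<beta> > 1" "\<gamma> > 1" | (2) "\<beta> \<le> 1" "\<gamma> > 1" | (3) "\<beta> > 1" "\<gamma> \<le> 1" | (4) "\<beta> \<le> 1" "\<gamma> \<le> 1" by linarith
    then show ?thesis
    proof cases
      case 1
      \<comment> \<open>As \<mu> > 1, 1/\<mu>^2 is at most 1/\<mu>, and 1/\<mu> is one of the two
        summands of \<open>kap\<close>.\<close>
      define \<mu> where "\<mu> = min \<beta> \<gamma>"
      have mu: "\<mu> > 1" "\<mu> \<le> \<beta>" "\<mu> \<le> \<gamma>" using 1 by (auto simp: \<mu>_def)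
      have "\<mu> * s\<^sup>2 + \<mu> * r\<^sup>2 \<le> \<beta> * s\<^sup>2 + \<gamma> * r\<^sup>2" using mu by (intro add_mono mult_right_mono) auto
      then have "\<mu>\<^sup>2 * (s\<^sup>2 + r\<^sup>2) \<le> l\<^sup>2 + m\<^sup>2" using mu Bz0 by (intro q) (auto simp: distrib_left)
      then have "s\<^sup>2 + r\<^sup>2 \<le> 1 / \<mu>\<^sup>2 * (l\<^sup>2 + m\<^sup>2)" using mu by (simp add: field_simps)
      also have "\<dots> \<le> 2 * kap * (l\<^sup>2 + m\<^sup>2)"
      proof (rule mult_right_mono)
        have "1 / \<mu>\<^sup>2 \<le> 1 / \<mu>" using mu by (simp add: field_simps power2_eq_square)
        also have "\<dots> \<le> 1 / \<beta> + 1 / \<gamma>" using 1 by (auto simp: \<mu>_def min_def)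
        also have "\<dots> \<le> 2 * kap"
        proof -
          have "kap = 1 / \<beta> + 1 / \<gamma>" using 1 by (simp add: kap_def)
          moreover have "0 < 1 / \<beta>" "0 < 1 / \<gamma>" using 1 by auto
          ultimately show ?thesis by linarith
        qed
        finally show "1 / \<mu>\<^sup>2 \<le> 2 * kap" .
      qed simp
      finally show ?thesis .
    next
      case 2
      have "1 * r\<^sup>2 \<le> \<gamma> * r\<^sup>2" using 2 by (intro mult_right_mono) auto
      then have "1\<^sup>2 * (s\<^sup>2 + r\<^sup>2) \<le> l\<^sup>2 + m\<^sup>2" using C(1) b0 by (intro q) auto
      also have "\<dots> \<le> 2 * kap * (l\<^sup>2 + m\<^sup>2)" using 2 mult_right_mono[of 1 "2 * kap" "l\<^sup>2 + m\<^sup>2"] by (simp add: kap_def)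
      finally show ?thesis by simp
    next
      case 3
      have "1 * s\<^sup>2 \<le> \<beta> * s\<^sup>2" using 3 by (intro mult_right_mono) auto
      then have "1\<^sup>2 * (s\<^sup>2 + r\<^sup>2) \<le> l\<^sup>2 + m\<^sup>2" using C(2) b0 by (intro q) auto
      also have "\<dots> \<le> 2 * kap * (l\<^sup>2 + m\<^sup>2)" using 3 mult_right_mono[of 1 "2 * kap" "l\<^sup>2 + m\<^sup>2"] by (simp add: kap_def)
      finally show ?thesis by simp
    next
      case 4
      \<comment> \<open>\<open>Bz\<close> has to dominate both s^2 and r^2 here, which halves \<mu>;
        then 1/\<mu>^2 = 4 = 2 kap.\<close>
      have "(1/2)\<^sup>2 * (s\<^sup>2 + r\<^sup>2) \<le> l\<^sup>2 + m\<^sup>2" using C(1,2) b0 by (intro q) auto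
      then show ?thesis using 4 by (simp add: kap_def power2_eq_square)
    qed
  qed
  then show ?thesis by (simp add: s_def r_def)
qed

lemma ip_bounds:
  assumes "p \<in> H0 a"
  shows "ip p p = bending (fst p) + ipw a (snd p) (snd p)
       + \<beta> * (fst p 1)\<^sup>2 + \<gamma> * (Dx (fst p) 1)\<^sup>2"
    and "bending (fst p) + ipw a (snd p) (snd p) \<le> ip p p"
    and "0 \<le> bending (fst p)" "0 \<le> ipw a (snd p) (snd p)"
    and "(fst p 1)\<^sup>2 \<le> bending (fst p)"
    and "(Dx (fst p) 1)\<^sup>2 \<le> bending (fst p)"
    and "ipw1 (Dx (fst p)) (Dx (fst p)) \<le> bending (fst p)"
proof -
  note h = H2w0_D[OF H0_D(1)[OF assms]]
  show e: "ip p p = bending (fst p) + ipw a (snd p) (snd p)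
       + \<beta> * (fst p 1)\<^sup>2 + \<gamma> * (Dx (fst p) 1)\<^sup>2"
    by (simp add: ip_def power2_eq_square)
  have "0 \<le> \<beta> * (fst p 1)\<^sup>2" "0 \<le> \<gamma> * (Dx (fst p) 1)\<^sup>2" using beta_nonneg gamma_nonneg by auto
  then show "bending (fst p) + ipw a (snd p) (snd p) \<le> ip p p"
    unfolding e by linarith
  show B0: "0 \<le> bending (fst p)" "0 \<le> ipw a (snd p) (snd p)"
    by (auto intro: ipw_nonneg weight_a)
  note b = H2_zero_bounds[OF h(1-3), of 1]
  show "(Dx (fst p) 1)\<^sup>2 \<le> bending (fst p)" using b(1) by simp
  have "\<bar>fst p 1\<bar>\<^sup>2 \<le> (sqrt (bending (fst p)))\<^sup>2"
    using b(3) by (intro power_mono) auto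
  then show "(fst p 1)\<^sup>2 \<le> bending (fst p)" using B0(1) by simp
  show "ipw1 (Dx (fst p)) (Dx (fst p)) \<le> bending (fst p)" using b(4) by simp
qed

text \<open>Two routes to a boundary value: through the bending integral, giving 2 E, and through
  its own term in the energy, giving (2/b) E; \<open>Cb\<close> takes the better one.\<close>

lemma Cb_le:
  assumes "0 \<le> b" "x \<le> 2 * E" "b / 2 * x \<le> E" "0 \<le> E"
  shows "x \<le> Cb b * E"
proof (cases "b = 0")
  case False
  with assms(1) have b: "b > 0" by simp
  then have "x \<le> 2 / b * E" using assms(3) by (simp add: field_simps)
  then show ?thesis using assms(2) False by (simp add: Cb_def min_def)
qed (use assms in \<open>simp add: Cb_def\<close>)

lemma boundary_le_energy:
  assumes "p \<in> H0 a"
  shows "(fst p 1)\<^sup>2 \<le> Cb \<beta> * (ip p p / 2)" "(Dx (fst p) 1)\<^sup>2 \<le> Cb \<gamma> * (ip p p / 2)"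
proof -
  note b = ip_bounds[OF assms]
  have nn: "0 \<le> \<beta> * (fst p 1)\<^sup>2" "0 \<le> \<gamma> * (Dx (fst p) 1)\<^sup>2" using beta_nonneg gamma_nonneg by auto
  show "(fst p 1)\<^sup>2 \<le> Cb \<beta> * (ip p p / 2)"
    by (rule Cb_le[OF beta_nonneg]) (use b nn in linarith)+
  show "(Dx (fst p) 1)\<^sup>2 \<le> Cb \<gamma> * (ip p p / 2)"
    by (rule Cb_le[OF gamma_nonneg]) (use b nn in linarith)+
qed

section \<open>The forms that make up the Lyapunov functional\<close>

lemma bounded_bilinear_form_zero: "bounded_bilinear_form (\<lambda>p q. 0)"
  unfolding bounded_bilinear_form_def by (auto intro!: exI[of _ 0])

text \<open>Common pattern of the forms that pair the velocity of one argument with a linear image T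
  of the other; the analytic input is the bound of that image by the energy.\<close>

lemma bounded_bilinear_form_ipw:
  assumes L: "\<And>p. p \<in> H0 a \<Longrightarrow> L2w a (T p)"
    and lin: "\<And>p q c x. p \<in> H0 a \<Longrightarrow> q \<in> H0 a \<Longrightarrow> x \<in> {0..1} \<Longrightarrow> T (lc p c q) x = T p x + c * T q x"
    and C: "C \<ge> 0" "\<And>p. p \<in> H0 a \<Longrightarrow> ipw a (T p) (T p) \<le> C * ip p p"
  shows "bounded_bilinear_form (\<lambda>p q. ipw a (snd p) (T q))"
  unfolding bounded_bilinear_form_def
proof (intro conjI ballI allI exI[of _ "sqrt C"])
  fix p q r c assume h: "p \<in> H0 a" "q \<in> H0 a" "r \<in> H0 a"
  show "ipw a (snd (lc p c q)) (T r) = ipw a (snd p) (T r) + c * ipw a (snd q) (T r)"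
    using h by (simp add: ipw_lin_left weight_a H0_D L)
  have "ipw a (snd r) (T (lc p c q)) = ipw a (snd r) (\<lambda>x. T p x + c * T q x)"
    by (rule ipw_cong[of "{}"]) (use lin h in auto)
  then show "ipw a (snd r) (T (lc p c q)) = ipw a (snd r) (T p) + c * ipw a (snd r) (T q)"
    using h by (simp add: ipw_lin_right weight_a H0_D L)
next
  show "0 \<le> sqrt C" using C by simp
  fix p q assume h: "p \<in> H0 a" "q \<in> H0 a"
  have "(ipw a (snd p) (T q))\<^sup>2 \<le> ipw a (snd p) (snd p) * ipw a (T q) (T q)"
    using h by (intro ipw_Cauchy_Schwarz weight_a H0_D L)
  also have "\<dots> \<le> ip p p * (C * ip q q)"
    using h ip_bounds[OF h(1)] ip_nonneg[of p] by (intro mult_mono C ipw_nonneg weight_a) auto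
  also have "\<dots> = (sqrt C * N p * N q)\<^sup>2" using C by (simp add: power_mult_distrib N_square)
  finally have "\<bar>ipw a (snd p) (T q)\<bar> \<le> \<bar>sqrt C * N p * N q\<bar>" by (simp only: abs_le_square_iff)
  then show "\<bar>ipw a (snd p) (T q)\<bar> \<le> sqrt C * N p * N q"
    using C N_nonneg[of p] N_nonneg[of q] by (simp add: abs_mult)
qed

definition multiplier_form :: "pr \<Rightarrow> pr \<Rightarrow> real" where "multiplier_form p q = ipw a (snd p) (\<lambda>x. x * Dx (fst q) x)"
definition product_form :: "pr \<Rightarrow> pr \<Rightarrow> real" where "product_form p q = ipw a (snd p) (fst q)"
definition lift_form :: "pr \<Rightarrow> pr \<Rightarrow> real" where "lift_form p q = ipw a (snd p) (lift (fst q 1) (Dx (fst q) 1))"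
definition slope_form :: "pr \<Rightarrow> pr \<Rightarrow> real" where "slope_form p q = Dx (fst p) 1 * Dx (fst q) 1"

lemma ipw_fst_bounds:
  assumes p: "p \<in> H0 a"
  shows "ipw a (\<lambda>x. x * Dx (fst p) x) (\<lambda>x. x * Dx (fst p) x) \<le> 1 / a 1 * bending (fst p)"
    and "ipw a (fst p) (fst p) \<le> CHP a * bending (fst p)"
proof -
  note b = ip_bounds[OF p] and h = H0_D(1)[OF p]
  have "1 / a 1 * ipw1 (Dx (fst p)) (Dx (fst p)) \<le> 1 / a 1 * bending (fst p)"
    using a1_pos b(7) by (intro mult_left_mono) auto
  then show "ipw a (\<lambda>x. x * Dx (fst p) x) (\<lambda>x. x * Dx (fst p) x) \<le> 1 / a 1 * bending (fst p)"
    using ipw_xDx_le[OF h] by linarith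
  have "CHP a * ipw1 (Dx (fst p)) (Dx (fst p)) \<le> CHP a * bending (fst p)"
    by (intro mult_left_mono b(7) CHP_nonneg)
  then show "ipw a (fst p) (fst p) \<le> CHP a * bending (fst p)"
    using Hardy_Poincare[OF H2w0_D(5)[OF h]] by linarith
qed

lemma bounded_bilinear_forms:
  "bounded_bilinear_form multiplier_form" "bounded_bilinear_form product_form" "bounded_bilinear_form lift_form" "bounded_bilinear_form slope_form"
proof -
  have B: "bending (fst p) \<le> ip p p" if "p \<in> H0 a" for p
    using ip_bounds(2,4)[OF that] by linarith
  show "bounded_bilinear_form multiplier_form"
    unfolding multiplier_form_def[abs_def]
  proof (rule bounded_bilinear_form_ipw[where C = "1 / a 1"])
    fix p assume p: "p \<in> H0 a"
    show "L2w a (\<lambda>x. x * Dx (fst p) x)" by (rule L2w_xDx[OF H0_D(1)[OF p]])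
    have "1 / a 1 * bending (fst p) \<le> 1 / a 1 * ip p p"
      using a1_pos by (intro mult_left_mono B p) auto
    then show "ipw a (\<lambda>x. x * Dx (fst p) x) (\<lambda>x. x * Dx (fst p) x) \<le> 1 / a 1 * ip p p"
      using ipw_fst_bounds(1)[OF p] by linarith
  next
    fix p q c and x :: real assume "p \<in> H0 a" "q \<in> H0 a" "x \<in> {0..1}"
    from Dx_lc[OF this, of c] show "x * Dx (fst (lc p c q)) x = x * Dx (fst p) x + c * (x * Dx (fst q) x)"
      by (simp add: algebra_simps)
  qed (use a1_pos in simp)
  show "bounded_bilinear_form product_form"
    unfolding product_form_def[abs_def]
  proof (rule bounded_bilinear_form_ipw[where C = "CHP a"])
    fix p assume p: "p \<in> H0 a"
    show "L2w a (fst p)" by (rule H2w0_D(4)[OF H0_D(1)[OF p]])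
    have "CHP a * bending (fst p) \<le> CHP a * ip p p"
      by (intro mult_left_mono B p CHP_nonneg)
    then show "ipw a (fst p) (fst p) \<le> CHP a * ip p p"
      using ipw_fst_bounds(2)[OF p] by linarith
  qed (simp_all add: CHP_nonneg)
  show "bounded_bilinear_form lift_form"
    unfolding lift_form_def[abs_def]
  proof (rule bounded_bilinear_form_ipw[where C = "CHP a * 4"])
    fix p assume p: "p \<in> H0 a"
    show "L2w a (lift (fst p 1) (Dx (fst p) 1))" by (rule H2w0_D(4)[OF lift_H2w0])
    have "2 * ((fst p 1)\<^sup>2 + (Dx (fst p) 1)\<^sup>2) \<le> 4 * ip p p"
      using order_trans[OF ip_bounds(5)[OF p] B[OF p]] order_trans[OF ip_bounds(6)[OF p] B[OF p]] by simp
    from mult_left_mono[OF this CHP_nonneg] show "ipw a (lift (fst p 1) (Dx (fst p) 1)) (lift (fst p 1) (Dx (fst p) 1)) \<le> CHP a * 4 * ip p p"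
      using lift_ipw_le[of "fst p 1" "Dx (fst p) 1"] by linarith
  next
    fix p q c and x :: real assume "p \<in> H0 a" "q \<in> H0 a"
    from Dx_lc[OF this, of 1 c]
    show "lift (fst (lc p c q) 1) (Dx (fst (lc p c q)) 1) x = lift (fst p 1) (Dx (fst p) 1) x + c * lift (fst q 1) (Dx (fst q) 1) x"
      by (simp add: lift_lin)
  qed (simp add: CHP_nonneg)
  have D: "\<bar>Dx (fst p) 1\<bar> \<le> N p" if "p \<in> H0 a" for p
  proof -
    have "(Dx (fst p) 1)\<^sup>2 \<le> (N p)\<^sup>2" using ip_bounds(6)[OF that] B[OF that] by (simp add: N_square)
    then have "\<bar>Dx (fst p) 1\<bar> \<le> \<bar>N p\<bar>" by (simp only: abs_le_square_iff)
    then show ?thesis using N_nonneg[of p] by simp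
  qed
  show "bounded_bilinear_form slope_form"
    unfolding bounded_bilinear_form_def
  proof (intro conjI ballI allI exI[of _ 1])
    fix p q r c assume h: "p \<in> H0 a" "q \<in> H0 a" "r \<in> H0 a"
    from Dx_lc[OF h(1,2), of 1 c]
    show "slope_form (lc p c q) r = slope_form p r + c * slope_form q r" "slope_form r (lc p c q) = slope_form r p + c * slope_form r q"
      by (simp_all add: slope_form_def algebra_simps)
  next
    fix p q assume h: "p \<in> H0 a" "q \<in> H0 a"
    show "\<bar>slope_form p q\<bar> \<le> 1 * N p * N q"
      unfolding slope_form_def abs_mult using D[OF h(1)] D[OF h(2)] N_nonneg[of p] by (simp add: mult_mono)
  qed simp
qed

text \<open>Kept as a form in two arguments, because the product rule differentiates each of them
  separately. The leading 0 gives the sum the nested shape that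
  \<open>bounded_bilinear_form_add\<close> expects; \<rho> is the multiple of the energy
  \<open>ip p p / 2\<close>.\<close>

definition lyapunov :: "real \<Rightarrow> real \<Rightarrow> pr \<Rightarrow> pr \<Rightarrow> real" where
  "lyapunov k \<rho> p q = 0 + 2 * multiplier_form p q + (- (K / 2)) * product_form p q + k * lift_form p q + (1 - K / 4) * slope_form p q + \<rho> / 2 * ip p q"

lemma bounded_bilinear_form_lyapunov: "bounded_bilinear_form (lyapunov k \<rho>)"
  unfolding lyapunov_def[abs_def]
  by (intro bounded_bilinear_form_add bounded_bilinear_form_zero bounded_bilinear_forms bounded_bilinear_form_ip)

lemma DomAA_D:
  assumes "r \<in> DomAA a \<beta> \<gamma>"
  shows "DomA a (fst r)" "H2w0 a (snd r)"
    "Dx3 (fst r) 1 = \<beta> * fst r 1 + snd r 1"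
    "Dx2 (fst r) 1 = - \<gamma> * Dx (fst r) 1 - Dx (snd r) 1"
  using assms by (auto simp: DomAA_def)

lemma AA_simps [simp]: "fst (AA a r) = snd r"
  "snd (AA a r) = (\<lambda>x. - (a x * Dx4 (fst r) x))"
  by (simp_all add: AA_def)

text \<open>Green's formula cancels the interior terms, and the boundary conditions turn what
  remains at 1 into minus a sum of squares.\<close>

lemma ip_AA:
  assumes r: "r \<in> DomAA a \<beta> \<gamma>"
  shows "ip r (AA a r) = - ((snd r 1)\<^sup>2 + (Dx (snd r) 1)\<^sup>2)"
proof -
  note d = DomAA_D[OF r]
  have "ipw a (snd r) (snd (AA a r)) = - ipw a (\<lambda>x. a x * Dx4 (fst r) x) (snd r)"
    by (simp add: ipw_commute[of a "snd r"] ipw_minus_left)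
  then show ?thesis
    unfolding ip_def Gauss_Green_H2w0[OF d(1,2)] by (simp add: d(3,4) algebra_simps power2_eq_square)
qed

text \<open>The conditions on z are dual to those on the displacement, so Green's formula yields
  -(u(1)^2 + u'(1)^2) exactly, apart from products of the velocity trace with z(1) and z'(1). Young
  with weight \<delta> splits these products, and the bound of z(1), z'(1) by \<open>kap\<close>
  lowers the coefficient from 1 to \<open>Cdelta\<close>.\<close>

lemma lift_form_dissipation:
  assumes r: "r \<in> DomAA a \<beta> \<gamma>" and dl: "\<delta> > 0"
  shows "lift_form (AA a r) r + lift_form r (AA a r) \<le> - Cdelta \<beta> \<gamma> \<delta> * ((fst r 1)\<^sup>2 + (Dx (fst r) 1)\<^sup>2)
    + 1 / (4 * \<delta>) * (1 + 2 * CHP a) * ((snd r 1)\<^sup>2 + (Dx (snd r) 1)\<^sup>2) + \<delta> * ipw a (snd r) (snd r)"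
proof -
  note d = DomAA_D[OF r]
  define l m e th where "l = fst r 1" and "m = Dx (fst r) 1" and "e = snd r 1" and "th = Dx (snd r) 1"
  define c1 c2 where "c1 = zc1 l m" and "c2 = zc2 l m"
  define s q where "s = c1 + c2" and "q = 2 * c1 + 3 * c2"
  have bc: "\<beta> * s - 6 * c2 = l" "\<gamma> * q + (2 * c1 + 6 * c2) = m"
    using lift_boundary[of l m] by (simp_all add: s_def q_def c1_def c2_def)
  have "lift_form (AA a r) r = - ipw a (\<lambda>x. a x * Dx4 (fst r) x) (\<lambda>x. c1 * x\<^sup>2 + c2 * x ^ 3)"
    by (simp add: lift_form_def ipw_minus_left lift_def c1_def c2_def l_def m_def)
  also have "\<dots> = - ((\<beta> * l + e) * s - (- \<gamma> * m - th) * q + (m * (2 * c1 + 6 * c2) - l * (6 * c2)))"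
    unfolding Gauss_Green_cubic(1)[OF d(1)] d(3,4) by (simp add: l_def m_def e_def th_def s_def q_def)
  \<comment> \<open>Regrouped so that the two boundary conditions of z appear as the factors of l
    and m.\<close>
  also have "\<dots> = - (l * (\<beta> * s - 6 * c2) + m * (\<gamma> * q + (2 * c1 + 6 * c2)) + e * s + th * q)"
    by (simp add: algebra_simps)
  also have "\<dots> = - (l\<^sup>2 + m\<^sup>2 + e * s + th * q)" unfolding bc by (simp add: power2_eq_square)
  finally have A: "lift_form (AA a r) r = - (l\<^sup>2 + m\<^sup>2 + e * s + th * q)" .
  have "(- s) * e \<le> \<delta> * (- s)\<^sup>2 + 1 / (4 * \<delta>) * e\<^sup>2" "(- q) * th \<le> \<delta> * (- q)\<^sup>2 + 1 / (4 * \<delta>) * th\<^sup>2"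
    by (rule Young_real[OF dl])+
  then have Y: "- (e * s + th * q) \<le> \<delta> * (s\<^sup>2 + q\<^sup>2) + 1 / (4 * \<delta>) * (e\<^sup>2 + th\<^sup>2)"
    by (simp add: algebra_simps)
  have "\<delta> * (s\<^sup>2 + q\<^sup>2) \<le> \<delta> * (2 * kap * (l\<^sup>2 + m\<^sup>2))"
    using lift_boundary_values_le[of l m] dl by (intro mult_left_mono) (auto simp: s_def q_def c1_def c2_def)
  then have 1: "lift_form (AA a r) r \<le> - Cdelta \<beta> \<gamma> \<delta> * (l\<^sup>2 + m\<^sup>2) + 1 / (4 * \<delta>) * (e\<^sup>2 + th\<^sup>2)"
    using A Y by (simp add: Cdelta_kap algebra_simps)
  \<comment> \<open>The time derivative of z is the lift of the velocity trace (e, th). Pairing it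
    with the velocity leaves \<delta> times the kinetic term.\<close>
  have "lift_form r (AA a r) = ipw a (snd r) (lift e th)" by (simp add: lift_form_def e_def th_def)
  also have "\<dots> \<le> \<delta> * ipw a (snd r) (snd r) + 1 / (4 * \<delta>) * ipw a (lift e th) (lift e th)"
    using ipw_Young[OF weight_a H2w0_D(4)[OF d(2)] H2w0_D(4)[OF lift_H2w0] dl, of e th] by linarith
  also have "\<dots> \<le> \<delta> * ipw a (snd r) (snd r) + 1 / (4 * \<delta>) * (CHP a * (2 * (e\<^sup>2 + th\<^sup>2)))"
    using dl by (intro add_left_mono mult_left_mono lift_ipw_le) auto
  finally have 2: "lift_form r (AA a r) \<le> \<delta> * ipw a (snd r) (snd r) + 1 / (4 * \<delta>) * (CHP a * (2 * (e\<^sup>2 + th\<^sup>2)))" .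
  define i where "i = 1 / (4 * \<delta>)"
  show ?thesis using 1 2
    unfolding l_def[symmetric] m_def[symmetric] e_def[symmetric] th_def[symmetric] i_def[symmetric]
    by (simp add: algebra_simps)
qed

text \<open>\<open>Pc\<close> collects what the estimates b1 to b4 leave of u(1)^2 and u'(1)^2,
  together with \<epsilon> \<beta> / 2 and \<epsilon> \<gamma> / 2, which arise because B and V are
  completed to the full energy by its boundary terms. \<open>varrho\<close> bounds the coefficients
  of the velocity traces.\<close>

lemma multiplier_dissipation:
  assumes r: "r \<in> DomAA a \<beta> \<gamma>" and eps: "0 < \<epsilon>" "\<epsilon> \<le> 2 - K"
  shows "2 * (multiplier_form (AA a r) r + multiplier_form r (AA a r)) - K / 2 * (product_form (AA a r) r + product_form r (AA a r))
      + (1 - K / 4) * (slope_form (AA a r) r + slope_form r (AA a r))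
    \<le> - \<epsilon> * (ip r r / 2) + Pc a \<beta> \<gamma> \<epsilon> * ((fst r 1)\<^sup>2 + (Dx (fst r) 1)\<^sup>2)
      + varrho a * ((snd r 1)\<^sup>2 + (Dx (snd r) 1)\<^sup>2)"
proof -
  note d = DomAA_D[OF r] and r0 = DomAA_H0[OF r]
  note K = K_bounds
  define l m e th where "l = fst r 1" and "m = Dx (fst r) 1" and "e = snd r 1" and "th = Dx (snd r) 1"
  define B V where "B = bending (fst r)" and "V = ipw a (snd r) (snd r)"
  have B0: "0 \<le> B" "0 \<le> V" using ip_bounds(3,4)[OF r0] by (simp_all add: B_def V_def)
  have uw: "H2w0 a (fst r)" using d(1) by (simp add: DomA_def)
  define u3 u2 where "u3 = \<beta> * l + e" and "u2 = - \<gamma> * m - th"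
  have F1: "2 * (multiplier_form (AA a r) r + multiplier_form r (AA a r)) \<le> - 2 * u3 * m + 2 * u2 * m + u2\<^sup>2 - 3 * B + e\<^sup>2 / a 1 - (1 - K) * V"
  proof -
    have "multiplier_form (AA a r) r = - (u3 * m - u2 * m - u2\<^sup>2 / 2 + 3 / 2 * B)"
      by (simp add: multiplier_form_def ipw_minus_left Gauss_Green_multiplier[OF d(1)] d(3,4) u3_def u2_def B_def l_def m_def e_def th_def)
    moreover have "2 * multiplier_form r (AA a r) \<le> e\<^sup>2 / a 1 - (1 - K) * V"
      using ipw_multiplier_le[OF d(2)] by (simp add: multiplier_form_def e_def V_def)
    ultimately show ?thesis by (simp add: algebra_simps)
  qed
  have F2: "product_form (AA a r) r + product_form r (AA a r) = - (u3 * l - u2 * m + B) + V"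
    by (simp add: product_form_def ipw_minus_left Gauss_Green_H2w0[OF d(1) uw] d(3,4) u3_def u2_def B_def V_def l_def m_def e_def th_def)
  have F4: "slope_form (AA a r) r + slope_form r (AA a r) = 2 * m * th"
    by (simp add: slope_form_def m_def th_def)
  have b1: "- 2 * \<beta> * l * m \<le> \<beta> * l\<^sup>2 + \<beta> * m\<^sup>2"
  proof -
    have "0 \<le> \<beta> * (l + m)\<^sup>2" using beta_nonneg by simp
    then show ?thesis by (simp add: power2_eq_square algebra_simps)
  qed
  have b2: "- 2 * m * e \<le> m\<^sup>2 + e\<^sup>2" using zero_le_power2[of "m + e"] by (simp add: power2_eq_square algebra_simps)
  have b3: "(\<gamma> * m + th)\<^sup>2 \<le> 2 * \<gamma>\<^sup>2 * m\<^sup>2 + 2 * th\<^sup>2"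
    using zero_le_power2[of "\<gamma> * m - th"] by (simp add: power2_eq_square algebra_simps)
  have b4: "K / 2 * (l * e) \<le> K / 4 * l\<^sup>2 + K / 4 * e\<^sup>2"
  proof -
    have "0 \<le> K / 4 * (l - e)\<^sup>2" using K by simp
    then show ?thesis by (simp add: power2_eq_square algebra_simps)
  qed
  have b5: "0 \<le> (2 - K / 2) * (\<gamma> * m\<^sup>2)" using K gamma_nonneg by (intro mult_nonneg_nonneg) auto
  have b6: "\<epsilon> / 2 * B \<le> (3 - K / 2) * B" "\<epsilon> / 2 * V \<le> (1 - K / 2) * V"
    using eps K B0 by (intro mult_right_mono; simp)+
  have "2 * (multiplier_form (AA a r) r + multiplier_form r (AA a r)) - K / 2 * (product_form (AA a r) r + product_form r (AA a r))
      + (1 - K / 4) * (slope_form (AA a r) r + slope_form r (AA a r))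
    \<le> - 2 * u3 * m + 2 * u2 * m + u2\<^sup>2 - 3 * B + e\<^sup>2 / a 1 - (1 - K) * V
      - K / 2 * (- (u3 * l - u2 * m + B) + V) + (1 - K / 4) * (2 * m * th)"
    using F1 unfolding F2 F4 by linarith
  \<comment> \<open>The products m th cancel exactly: -2 + K/2 from the multiplier and product forms
    against 2 (1 - K/4) from the slope form.\<close>
  also have "\<dots> = - 2 * \<beta> * l * m - 2 * m * e - (2 - K / 2) * (\<gamma> * m\<^sup>2) + (\<gamma> * m + th)\<^sup>2 + K / 2 * (\<beta> * l\<^sup>2)
      + K / 2 * (l * e) + e\<^sup>2 / a 1 - (3 - K / 2) * B - (1 - K / 2) * V"
    unfolding u3_def u2_def by (simp add: power2_eq_square algebra_simps)
  also have "\<dots> \<le> (\<beta> * l\<^sup>2 + \<beta> * m\<^sup>2) + (m\<^sup>2 + e\<^sup>2) + (2 * \<gamma>\<^sup>2 * m\<^sup>2 + 2 * th\<^sup>2) + K / 2 * (\<beta> * l\<^sup>2)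
      + (K / 4 * l\<^sup>2 + K / 4 * e\<^sup>2) + e\<^sup>2 / a 1 - \<epsilon> / 2 * B - \<epsilon> / 2 * V"
    using b1 b2 b3 b4 b5 b6 by linarith
  also have "\<dots> = - \<epsilon> * (ip r r / 2) + (K * \<beta> / 2 + K / 4 + \<beta> + \<epsilon> * \<beta> / 2) * l\<^sup>2
      + (\<beta> + 1 + 2 * \<gamma>\<^sup>2 + \<epsilon> * \<gamma> / 2) * m\<^sup>2 + (K / 4 + 1 + 1 / a 1) * e\<^sup>2 + 2 * th\<^sup>2"
    unfolding ip_bounds(1)[OF r0] B_def[symmetric] V_def[symmetric] l_def[symmetric] m_def[symmetric]
    by (simp add: algebra_simps add_divide_distrib diff_divide_distrib)
  also have "\<dots> \<le> - \<epsilon> * (ip r r / 2) + Pc a \<beta> \<gamma> \<epsilon> * l\<^sup>2 + Pc a \<beta> \<gamma> \<epsilon> * m\<^sup>2 + varrho a * e\<^sup>2 + varrho a * th\<^sup>2"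
  proof -
    have p: "0 \<le> K * \<beta>" "0 \<le> \<epsilon> * \<beta>" "0 \<le> \<epsilon> * \<gamma>" "0 \<le> \<gamma>\<^sup>2" using K eps beta_nonneg gamma_nonneg by auto
    have "K * \<beta> / 2 + K / 4 + \<beta> + \<epsilon> * \<beta> / 2 \<le> Pc a \<beta> \<gamma> \<epsilon>" "\<beta> + 1 + 2 * \<gamma>\<^sup>2 + \<epsilon> * \<gamma> / 2 \<le> Pc a \<beta> \<gamma> \<epsilon>"
      unfolding Pc_def using p K eps beta_nonneg gamma_nonneg by linarith+
    moreover have "K / 4 + 1 + 1 / a 1 \<le> varrho a" "2 \<le> varrho a" by (simp_all add: varrho_def)
    ultimately show ?thesis by (intro add_mono mult_right_mono order_refl) auto
  qed
  finally show ?thesis unfolding l_def[symmetric] m_def[symmetric] e_def[symmetric] th_def[symmetric]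
    by (simp add: algebra_simps)
qed

lemma Pc_pos: "0 < \<epsilon> \<Longrightarrow> 0 < Pc a \<beta> \<gamma> \<epsilon>"
proof -
  assume e: "0 < \<epsilon>"
  have "0 \<le> K * \<beta>" "0 \<le> \<epsilon> * \<beta>" "0 \<le> \<epsilon> * \<gamma>" "0 \<le> \<gamma>\<^sup>2" using K_bounds e beta_nonneg gamma_nonneg by auto
  then show ?thesis unfolding Pc_def using K_bounds beta_nonneg by linarith
qed

section \<open>Choice of the coefficients and comparison with the stated constants\<close>

text \<open>Chosen so that its product with \<open>Cdelta\<close> is \<open>Pc\<close>, which
  cancels u(1)^2 + u'(1)^2; \<open>Cone\<close> is twice this number. \<open>energy_coeff\<close> is
  then what cancels the velocity traces, including those produced by the lift.\<close>

definition lift_coeff :: "real \<Rightarrow> real \<Rightarrow> real" where "lift_coeff \<epsilon> \<delta> = Pc a \<beta> \<gamma> \<epsilon> / Cdelta \<beta> \<gamma> \<delta>"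
definition energy_coeff :: "real \<Rightarrow> real \<Rightarrow> real" where "energy_coeff \<epsilon> \<delta> = varrho a + lift_coeff \<epsilon> \<delta> * (1 / (4 * \<delta>) * (1 + 2 * CHP a))"

lemma lyapunov_dissipation:
  assumes r: "r \<in> DomAA a \<beta> \<gamma>" and eps: "0 < \<epsilon>" "\<epsilon> \<le> 2 - K" and dl: "0 < \<delta>" "\<delta> < nu \<beta> \<gamma>"
  shows "lyapunov (lift_coeff \<epsilon> \<delta>) (energy_coeff \<epsilon> \<delta>) (AA a r) r + lyapunov (lift_coeff \<epsilon> \<delta>) (energy_coeff \<epsilon> \<delta>) r (AA a r)
    \<le> - (\<epsilon> - \<delta> * Cone a \<beta> \<gamma> \<epsilon> \<delta>) * (ip r r / 2)"
proof -
  define k where "k = lift_coeff \<epsilon> \<delta>"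
  define Y W where "Y = (fst r 1)\<^sup>2 + (Dx (fst r) 1)\<^sup>2" and "W = (snd r 1)\<^sup>2 + (Dx (snd r) 1)\<^sup>2"
  have Cd: "0 < Cdelta \<beta> \<gamma> \<delta>" by (rule Cdelta_pos[OF dl(2)])
  have k0: "0 \<le> k" using Cd Pc_pos[OF eps(1)] by (simp add: k_def lift_coeff_def)
  have kCd: "k * Cdelta \<beta> \<gamma> \<delta> = Pc a \<beta> \<gamma> \<epsilon>" using Cd by (simp add: k_def lift_coeff_def)
  have V: "ipw a (snd r) (snd r) \<le> ip r r"
    using ip_bounds(2,3)[OF DomAA_H0[OF r]] by linarith
  have "k * (lift_form (AA a r) r + lift_form r (AA a r)) \<le> k * (- Cdelta \<beta> \<gamma> \<delta> * Y + 1 / (4 * \<delta>) * (1 + 2 * CHP a) * W + \<delta> * ipw a (snd r) (snd r))"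
    using lift_form_dissipation[OF r dl(1)] k0 by (intro mult_left_mono) (simp_all add: Y_def W_def)
  also have "\<dots> \<le> k * (- Cdelta \<beta> \<gamma> \<delta> * Y + 1 / (4 * \<delta>) * (1 + 2 * CHP a) * W + \<delta> * ip r r)"
    using V k0 dl by (intro mult_left_mono add_left_mono) auto
  also have "\<dots> = - (k * Cdelta \<beta> \<gamma> \<delta>) * Y + k * (1 / (4 * \<delta>) * (1 + 2 * CHP a)) * W + k * \<delta> * ip r r"
    by (simp add: algebra_simps)
  also have "\<dots> = - Pc a \<beta> \<gamma> \<epsilon> * Y + k * (1 / (4 * \<delta>) * (1 + 2 * CHP a)) * W + k * \<delta> * ip r r"
    unfolding kCd ..
  finally have 3: "k * (lift_form (AA a r) r + lift_form r (AA a r)) \<le> - Pc a \<beta> \<gamma> \<epsilon> * Y + k * (1 / (4 * \<delta>) * (1 + 2 * CHP a)) * W + k * \<delta> * ip r r" .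
  have 12: "2 * (multiplier_form (AA a r) r + multiplier_form r (AA a r)) - K / 2 * (product_form (AA a r) r + product_form r (AA a r))
      + (1 - K / 4) * (slope_form (AA a r) r + slope_form r (AA a r)) \<le> - \<epsilon> * (ip r r / 2) + Pc a \<beta> \<gamma> \<epsilon> * Y + varrho a * W"
    using multiplier_dissipation[OF r eps] by (simp add: Y_def W_def)
  have ip: "ip (AA a r) r = - W" "ip r (AA a r) = - W" using ip_AA[OF r] ip_commute[of r] by (simp_all add: W_def)
  have C2: "Cone a \<beta> \<gamma> \<epsilon> \<delta> = 2 * k" by (simp add: Cone_def k_def lift_coeff_def)

  have "lyapunov k (energy_coeff \<epsilon> \<delta>) (AA a r) r + lyapunov k (energy_coeff \<epsilon> \<delta>) r (AA a r)
     = (2 * (multiplier_form (AA a r) r + multiplier_form r (AA a r)) - K / 2 * (product_form (AA a r) r + product_form r (AA a r))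
      + (1 - K / 4) * (slope_form (AA a r) r + slope_form r (AA a r))) + k * (lift_form (AA a r) r + lift_form r (AA a r)) - energy_coeff \<epsilon> \<delta> * W"
    unfolding lyapunov_def ip by (simp add: algebra_simps)
  also have "\<dots> \<le> (- \<epsilon> * (ip r r / 2) + Pc a \<beta> \<gamma> \<epsilon> * Y + varrho a * W)
      + (- Pc a \<beta> \<gamma> \<epsilon> * Y + k * (1 / (4 * \<delta>) * (1 + 2 * CHP a)) * W + k * \<delta> * ip r r) - energy_coeff \<epsilon> \<delta> * W"
    by (intro diff_right_mono add_mono 12 3)
  \<comment> \<open>Y and W have cancelled by the choice of the two coefficients; the remainder in
    \<open>ip r r\<close> is the only loss.\<close>
  also have "\<dots> = - \<epsilon> * (ip r r / 2) + k * \<delta> * ip r r"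
    by (simp add: energy_coeff_def k_def algebra_simps)
  also have "\<dots> = - (\<epsilon> - \<delta> * Cone a \<beta> \<gamma> \<epsilon> \<delta>) * (ip r r / 2)"
    unfolding C2 by (simp add: algebra_simps)
  finally show ?thesis unfolding k_def .
qed

text \<open>The two bounds differ on purpose: the slope term and the energy term are nonnegative, so
  they cost something only in the upper bound, and \<open>Ctwo\<close> has to count them
  once.\<close>

lemma lyapunov_bounds:
  assumes p: "p \<in> H0 a" and k: "0 \<le> k"
  shows "lyapunov k \<rho> p p \<le> (2 * vartheta a + Cb \<gamma> / 2 * (2 - K / 2) + k * (1 + CHP a * (Cb \<beta> + Cb \<gamma>)) + \<rho>) * (ip p p / 2)"
    and "- (2 * vartheta a + k * (1 + CHP a * (Cb \<beta> + Cb \<gamma>))) * (ip p p / 2) + \<rho> * (ip p p / 2) \<le> lyapunov k \<rho> p p"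
proof -
  define E where "E = ip p p / 2"
  define B V where "B = bending (fst p)" and "V = ipw a (snd p) (snd p)"
  note b = ip_bounds[OF p, folded B_def V_def]
  note h = H0_D[OF p] and K = K_bounds
  have BV: "B + V \<le> 2 * E" using b(2) by (simp add: E_def)
  have Y1: "2 * \<bar>multiplier_form p p\<bar> \<le> V + 1 / a 1 * B"
    using ipw_Young[OF weight_a h(2) L2w_xDx[OF h(1)], of "1/2"] ipw_fst_bounds(1)[OF p]
    by (simp add: multiplier_form_def V_def B_def)
  have Y2: "K / 2 * \<bar>product_form p p\<bar> \<le> K / 4 * V + K / 4 * (CHP a * B)"
  proof -
    have "\<bar>product_form p p\<bar> \<le> 1/2 * V + 1/2 * (CHP a * B)"
      using ipw_Young[OF weight_a h(2) H2w0_D(4)[OF h(1)], of "1/2"] ipw_fst_bounds(2)[OF p]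
      by (simp add: product_form_def V_def B_def)
    then have "K / 2 * \<bar>product_form p p\<bar> \<le> K / 2 * (1/2 * V + 1/2 * (CHP a * B))" using K by (intro mult_left_mono) auto
    then show ?thesis by (simp add: algebra_simps)
  qed
  have th: "\<bar>2 * multiplier_form p p + (- (K / 2)) * product_form p p\<bar> \<le> 2 * vartheta a * E"
  proof -
    have "\<bar>2 * multiplier_form p p + (- (K / 2)) * product_form p p\<bar> \<le> 2 * \<bar>multiplier_form p p\<bar> + K / 2 * \<bar>product_form p p\<bar>"
      using abs_triangle_ineq[of "2 * multiplier_form p p" "(- (K / 2)) * product_form p p"] K by (simp add: abs_mult)
    also have "\<dots> \<le> (1 + K / 4) * V + (1 / a 1 + K / 4 * CHP a) * B"
      using Y1 Y2 by (simp add: algebra_simps)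
    \<comment> \<open>\<open>vartheta\<close> is a maximum so that one number dominates the
      coefficients of both the kinetic and the bending term.\<close>
    also have "\<dots> \<le> vartheta a * V + vartheta a * B"
    proof (intro add_mono mult_right_mono b(3,4))
      show "1 + K / 4 \<le> vartheta a" by (simp add: vartheta_def)
      have "1 / a 1 \<le> 4 / a 1" using a1_pos by (simp add: divide_right_mono)
      moreover have "K / 4 * CHP a \<le> K * CHP a" using K CHP_nonneg by (intro mult_right_mono) auto
      ultimately show "1 / a 1 + K / 4 * CHP a \<le> vartheta a" unfolding vartheta_def by linarith
    qed
    also have "\<dots> = vartheta a * (B + V)" by (simp add: algebra_simps)
    also have "\<dots> \<le> vartheta a * (2 * E)"
    proof (rule mult_left_mono[OF BV])
      have "1 + K / 4 \<le> vartheta a" by (simp add: vartheta_def)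
      then show "0 \<le> vartheta a" using K by linarith
    qed
    finally show ?thesis by simp
  qed
  have Y3: "\<bar>lift_form p p\<bar> \<le> (1 + CHP a * (Cb \<beta> + Cb \<gamma>)) * E"
  proof -
    define l m where "l = fst p 1" and "m = Dx (fst p) 1"
    have "\<bar>lift_form p p\<bar> \<le> 1/2 * V + 1/2 * ipw a (lift l m) (lift l m)"
      using ipw_Young[OF weight_a h(2) H2w0_D(4)[OF lift_H2w0], of "1/2" l m] by (simp add: lift_form_def V_def l_def m_def)
    also have "\<dots> \<le> E + CHP a * (l\<^sup>2 + m\<^sup>2)" using lift_ipw_le[of l m] BV b(3) by linarith
    also have "\<dots> \<le> E + CHP a * (Cb \<beta> * E + Cb \<gamma> * E)"
      using boundary_le_energy[OF p] by (intro add_left_mono mult_left_mono add_mono CHP_nonneg) (simp_all add: E_def l_def m_def)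
    finally show ?thesis by (simp add: algebra_simps)
  qed
  have Y3': "\<bar>k * lift_form p p\<bar> \<le> k * (1 + CHP a * (Cb \<beta> + Cb \<gamma>)) * E"
    using mult_left_mono[OF Y3 k] k by (simp add: abs_mult mult.assoc)
  have Y4: "0 \<le> (1 - K / 4) * slope_form p p" "(1 - K / 4) * slope_form p p \<le> Cb \<gamma> / 2 * (2 - K / 2) * E"
  proof -
    have slope_form: "slope_form p p = (Dx (fst p) 1)\<^sup>2" by (simp add: slope_form_def power2_eq_square)
    show "0 \<le> (1 - K / 4) * slope_form p p" using K unfolding slope_form by (intro mult_nonneg_nonneg) auto
    have "(1 - K / 4) * slope_form p p \<le> (1 - K / 4) * (Cb \<gamma> * E)"
      unfolding slope_form using boundary_le_energy(2)[OF p] K by (intro mult_left_mono) (auto simp: E_def)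
    then show "(1 - K / 4) * slope_form p p \<le> Cb \<gamma> / 2 * (2 - K / 2) * E" by (simp add: algebra_simps)
  qed
  have X: "lyapunov k \<rho> p p = (2 * multiplier_form p p + (- (K / 2)) * product_form p p) + k * lift_form p p + (1 - K / 4) * slope_form p p + \<rho> * E"
    by (simp add: lyapunov_def E_def)
  have "lyapunov k \<rho> p p \<le> 2 * vartheta a * E + k * (1 + CHP a * (Cb \<beta> + Cb \<gamma>)) * E + Cb \<gamma> / 2 * (2 - K / 2) * E + \<rho> * E"
    unfolding X using th Y3' Y4 by linarith
  then show "lyapunov k \<rho> p p \<le> (2 * vartheta a + Cb \<gamma> / 2 * (2 - K / 2) + k * (1 + CHP a * (Cb \<beta> + Cb \<gamma>)) + \<rho>) * (ip p p / 2)"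
    unfolding E_def[symmetric] distrib_right by linarith
  have eq: "- (x + y) * E + z = - (x * E) - y * E + z" for x y z by (simp add: algebra_simps)
  have "- (2 * vartheta a * E) - k * (1 + CHP a * (Cb \<beta> + Cb \<gamma>)) * E + \<rho> * E \<le> lyapunov k \<rho> p p"
    unfolding X using th Y3' Y4 by linarith
  then show "- (2 * vartheta a + k * (1 + CHP a * (Cb \<beta> + Cb \<gamma>))) * (ip p p / 2) + \<rho> * (ip p p / 2) \<le> lyapunov k \<rho> p p"
    unfolding E_def[symmetric] eq .
qed

text \<open>The oscillation of X costs the upper bound at the earlier time plus the lower bound at
  the later one: \<open>vartheta\<close> and the lift bound occur twice, everything else once. The
  doubled lift bound and the part of \<open>energy_coeff\<close> with 1/\<delta> fit into
  \<open>Cthree\<close>.\<close>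

lemma Ctwo_ge:
  assumes eps: "0 < \<epsilon>" and dl: "0 < \<delta>" "\<delta> < nu \<beta> \<gamma>"
  shows "0 \<le> lift_coeff \<epsilon> \<delta>" "0 \<le> energy_coeff \<epsilon> \<delta>"
    "(2 * vartheta a + Cb \<gamma> / 2 * (2 - K / 2) + lift_coeff \<epsilon> \<delta> * (1 + CHP a * (Cb \<beta> + Cb \<gamma>)) + energy_coeff \<epsilon> \<delta>)
     + (2 * vartheta a + lift_coeff \<epsilon> \<delta> * (1 + CHP a * (Cb \<beta> + Cb \<gamma>))) \<le> Ctwo a \<beta> \<gamma> \<epsilon> \<delta>"
    "0 < Ctwo a \<beta> \<gamma> \<epsilon> \<delta>"
proof -
  define k where "k = lift_coeff \<epsilon> \<delta>"
  have Cd: "0 < Cdelta \<beta> \<gamma> \<delta>" by (rule Cdelta_pos[OF dl(2)])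
  show k0: "0 \<le> lift_coeff \<epsilon> \<delta>" using Cd Pc_pos[OF eps] by (simp add: lift_coeff_def)
  note K = K_bounds and H = CHP_nonneg
  have C0: "0 \<le> Cb \<beta>" "0 \<le> Cb \<gamma>" using beta_nonneg gamma_nonneg by (simp_all add: Cb_def)
  have HC: "0 \<le> CHP a * (Cb \<beta> + Cb \<gamma>)" using C0 H by simp
  have v: "2 \<le> varrho a" by (simp add: varrho_def)
  have q: "0 \<le> 1 / (4 * \<delta>) * (1 + 2 * CHP a)" using dl H by simp
  show r0: "0 \<le> energy_coeff \<epsilon> \<delta>" unfolding energy_coeff_def using mult_nonneg_nonneg[OF k0 q] v by linarith
  have C3: "Cthree a \<beta> \<gamma> \<epsilon> \<delta> = k * (2 + 2 * (4 * CHP a + 1) * (Cb \<beta> + Cb \<gamma>) + (1/\<delta>) * (8 * CHP a + 3))"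
    by (simp add: Cthree_def k_def lift_coeff_def)
  have eq: "k * (2 * x + y) = 2 * (k * x) + k * y" for x y by (simp add: algebra_simps)
  have "k * (2 * (1 + CHP a * (Cb \<beta> + Cb \<gamma>)) + 1 / (4 * \<delta>) * (1 + 2 * CHP a))
      \<le> k * (2 + 2 * (4 * CHP a + 1) * (Cb \<beta> + Cb \<gamma>) + (1/\<delta>) * (8 * CHP a + 3))"
  proof (rule mult_left_mono)
    have sum_le: "2 * (1 + x) + y \<le> 2 + 2 * z + w" if "x \<le> z" "y \<le> w" for x y z w :: real
      using that by simp
    have "CHP a * (Cb \<beta> + Cb \<gamma>) \<le> (4 * CHP a + 1) * (Cb \<beta> + Cb \<gamma>)" using C0 H by (intro mult_right_mono) auto
    moreover have "1 / (4 * \<delta>) * (1 + 2 * CHP a) \<le> (1/\<delta>) * (8 * CHP a + 3)"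
      using dl H by (intro mult_mono) (auto simp: field_simps)
    ultimately show "2 * (1 + CHP a * (Cb \<beta> + Cb \<gamma>)) + 1 / (4 * \<delta>) * (1 + 2 * CHP a)
      \<le> 2 + 2 * (4 * CHP a + 1) * (Cb \<beta> + Cb \<gamma>) + (1/\<delta>) * (8 * CHP a + 3)"
      unfolding mult.assoc by (rule sum_le)
  qed (use k0 in \<open>simp add: k_def\<close>)
  then have le: "2 * (k * (1 + CHP a * (Cb \<beta> + Cb \<gamma>))) + k * (1 / (4 * \<delta>) * (1 + 2 * CHP a)) \<le> Cthree a \<beta> \<gamma> \<epsilon> \<delta>"
    unfolding C3 eq .
  then show "(2 * vartheta a + Cb \<gamma> / 2 * (2 - K / 2) + lift_coeff \<epsilon> \<delta> * (1 + CHP a * (Cb \<beta> + Cb \<gamma>)) + energy_coeff \<epsilon> \<delta>)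
     + (2 * vartheta a + lift_coeff \<epsilon> \<delta> * (1 + CHP a * (Cb \<beta> + Cb \<gamma>))) \<le> Ctwo a \<beta> \<gamma> \<epsilon> \<delta>"
    unfolding Ctwo_def energy_coeff_def k_def[symmetric] by linarith
  have "0 \<le> Cthree a \<beta> \<gamma> \<epsilon> \<delta>"
    unfolding C3 using k0 C0 H dl by (intro mult_nonneg_nonneg add_nonneg_nonneg) (auto simp: k_def)
  moreover have "1 + K / 4 \<le> vartheta a" by (simp add: vartheta_def)
  moreover have "0 \<le> Cb \<gamma> / 2 * (2 - K / 2)" using C0 K by (intro mult_nonneg_nonneg) auto
  ultimately show "0 < Ctwo a \<beta> \<gamma> \<epsilon> \<delta>" unfolding Ctwo_def using v K by linarith
qed

end

section \<open>Density of the domain\<close>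

text \<open>Truncation, approximation by continuous functions, Stone-Weierstrass. The bounded weight
  passes uniform closeness on to the weighted norm; h is square integrable only against the weight,
  so it may be large near 0.\<close>

lemma weighted_L2_polynomial_approximation:
  fixes h w :: "real \<Rightarrow> real"
  assumes w: "w \<in> borel_measurable (lebesgue_on {0..1})" "\<And>x. x \<in> {0..1} \<Longrightarrow> 0 \<le> w x" "\<And>x. x \<in> {0..1} \<Longrightarrow> w x \<le> W"
    and h: "h \<in> borel_measurable (lebesgue_on {0..1})" "(\<lambda>x. (h x)\<^sup>2 * w x) integrable_on {0..1}"
    and e: "0 < e"
  shows "\<exists>p. real_polynomial_function p \<and> (\<lambda>x. (h x - p x)\<^sup>2 * w x) integrable_on {0..1} \<and>
    integral {0..1} (\<lambda>x. (h x - p x)\<^sup>2 * w x) < e"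
proof -
  have W: "0 \<le> W" using w(2,3)[of 0] by auto
  define cl where "cl m x = max (- m) (min m x)" for m x :: real
  have clm: "(\<lambda>x. cl m (f x)) \<in> borel_measurable M" if "f \<in> borel_measurable M" for m f and M :: "real measure"
    unfolding cl_def using that by measurable
  have cl_le: "\<bar>cl m y\<bar> \<le> m" if "0 \<le> m" for m y using that by (auto simp: cl_def)
  have cl_diff: "\<bar>y - cl m y\<bar> \<le> \<bar>y\<bar>" if "0 \<le> m" for m y using that by (auto simp: cl_def max_def min_def)
  have sqi: "(\<lambda>x. (f x)\<^sup>2 * w x) integrable_on {0..1}"
    if f: "f \<in> borel_measurable (lebesgue_on {0..1})" and b: "\<And>x. x \<in> {0..1} \<Longrightarrow> \<bar>f x\<bar> \<le> B" for f B
  proof (rule measurable_bounded_by_integrable_imp_integrable)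
    show "(\<lambda>x. (f x)\<^sup>2 * w x) \<in> borel_measurable (lebesgue_on {0..1})" using f w(1) by auto
    fix x :: real assume x: "x \<in> {0..1}"
    have "(f x)\<^sup>2 \<le> B\<^sup>2" using power_mono[OF b[OF x], of 2] by simp
    then show "norm ((f x)\<^sup>2 * w x) \<le> B\<^sup>2 * W" using w(2,3)[OF x] by (simp add: mult_mono)
  qed auto
  \<comment> \<open>Three errors of at most e/12, each with the factor 3 from (u + v + z)^2 <= 3
    (u^2 + v^2 + z^2), add up to at most 3e/4.\<close>
  have e12: "0 < e / 12" using e by simp
  have i1: "(\<lambda>x. (h x - cl (real m) (h x))\<^sup>2 * w x) integrable_on {0..1}" for m
  proof (rule measurable_bounded_by_integrable_imp_integrable[OF _ h(2)])
    show "(\<lambda>x. (h x - cl (real m) (h x))\<^sup>2 * w x) \<in> borel_measurable (lebesgue_on {0..1})"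
      using h(1) w(1) clm[OF h(1), of "real m"] by auto
    fix x :: real assume x: "x \<in> {0..1}"
    have "(h x - cl (real m) (h x))\<^sup>2 \<le> (h x)\<^sup>2" using cl_diff[of "real m" "h x"] by (simp add: abs_le_square_iff)
    then show "norm ((h x - cl (real m) (h x))\<^sup>2 * w x) \<le> (h x)\<^sup>2 * w x" using w(2)[OF x] by (simp add: mult_right_mono)
  qed auto
  have "(\<lambda>m. integral {0..1} (\<lambda>x. (h x - cl (real m) (h x))\<^sup>2 * w x)) \<longlonglongrightarrow> integral {0..1} (\<lambda>x::real. 0)"
  proof (rule dominated_convergence(2)[OF i1 h(2)])
    fix m and x :: real assume x: "x \<in> {0..1}"
    have "(h x - cl (real m) (h x))\<^sup>2 \<le> (h x)\<^sup>2" using cl_diff[of "real m" "h x"] by (simp add: abs_le_square_iff)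
    then show "norm ((h x - cl (real m) (h x))\<^sup>2 * w x) \<le> (h x)\<^sup>2 * w x" using w(2)[OF x] by (simp add: mult_right_mono)
  next
    fix x :: real
    obtain n where n: "\<bar>h x\<bar> \<le> real n" using real_arch_simple by blast
    have "\<forall>\<^sub>F m in sequentially. (h x - cl (real m) (h x))\<^sup>2 * w x = 0"
      using eventually_ge_at_top[of n]
    proof eventually_elim
      case (elim m)
      then have "\<bar>h x\<bar> \<le> real m" using n by linarith
      then have "cl (real m) (h x) = h x" by (auto simp: cl_def)
      then show ?case by simp
    qed
    then show "(\<lambda>m. (h x - cl (real m) (h x))\<^sup>2 * w x) \<longlonglongrightarrow> 0" by (rule tendsto_eventually)
  qed
  from order_tendstoD(2)[OF this, of "e / 12"] e12
  obtain n where n: "integral {0..1} (\<lambda>x. (h x - cl (real n) (h x))\<^sup>2 * w x) < e / 12"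
    by (auto simp: eventually_sequentially)
  define m where "m = real n"
  have m0: "0 \<le> m" by (simp add: m_def)
  define g where "g x = cl m (h x)" for x
  have gm: "g \<in> borel_measurable (lebesgue_on {0..1})" unfolding g_def by (rule clm[OF h(1)])
  then have "g measurable_on {0..1}" by (simp add: measurable_on_iff_borel_measurable)
  then obtain N G where N: "negligible N" and G: "\<And>n. continuous_on UNIV (G n)"
    and lim: "\<And>x. x \<notin> N \<Longrightarrow> (\<lambda>n. G n x) \<longlonglongrightarrow> (if x \<in> {0..1} then g x else 0)"
    unfolding measurable_on_def by blast
  \<comment> \<open>Measurability supplies continuous functions that converge off a null set, but
    without a bound. Clamping them to [-m, m] gives a dominating constant and keeps the limit, since
    g already lies in that range.\<close>
  define G' where "G' n x = cl m (G n x)" for n x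
  have cG': "continuous_on {0..1} (G' n)" for n
    unfolding G'_def cl_def by (intro continuous_intros continuous_on_subset[OF G]) auto
  have G'm: "G' n \<in> borel_measurable (lebesgue_on {0..1})" for n
    by (rule continuous_imp_measurable_on_sets_lebesgue[OF cG']) auto
  have G'b: "\<bar>G' n x\<bar> \<le> m" "\<bar>g x\<bar> \<le> m" for n x by (auto simp: G'_def g_def cl_le m0)
  have gG: "\<bar>g x - G' n x\<bar> \<le> 2 * m" for n x using G'b(1)[of n x] G'b(2)[of x] by linarith
  have i2: "(\<lambda>x. (g x - G' n x)\<^sup>2 * w x) integrable_on {0..1}" for n
    by (rule sqi[of _ "2 * m"]) (use gm G'm gG in auto)
  \<comment> \<open>Set to 0 on N so that convergence holds at every point.\<close>
  define D where "D n x = (if x \<in> N then 0 else (g x - G' n x)\<^sup>2 * w x)" for n x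
  have iD: "D n integrable_on {0..1}" for n
    by (rule integrable_spike[OF i2[of n] N]) (simp add: D_def)
  have "(\<lambda>n. integral {0..1} (D n)) \<longlonglongrightarrow> integral {0..1} (\<lambda>x::real. 0)"
  proof (rule dominated_convergence(2)[OF iD])
    show "(\<lambda>x. (2 * m)\<^sup>2 * W) integrable_on {0..1::real}" by (rule integrable_const_ivl)
    fix n and x :: real assume x: "x \<in> {0..1}"
    have "(g x - G' n x)\<^sup>2 \<le> (2 * m)\<^sup>2" using power_mono[OF gG[of x n], of 2] by simp
    then have "(g x - G' n x)\<^sup>2 * w x \<le> (2 * m)\<^sup>2 * W" using w(2,3)[OF x] by (intro mult_mono) auto
    then show "norm (D n x) \<le> (2 * m)\<^sup>2 * W" using w(2)[OF x] W by (simp add: D_def)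
  next
    fix x :: real assume x: "x \<in> {0..1}"
    show "(\<lambda>n. D n x) \<longlonglongrightarrow> 0"
    proof (cases "x \<in> N")
      case False
      have "(\<lambda>n. G n x) \<longlonglongrightarrow> g x" using lim[OF False] x by simp
      then have "(\<lambda>n. G' n x) \<longlonglongrightarrow> cl m (g x)" unfolding G'_def cl_def by (intro tendsto_intros)
      moreover have "cl m (g x) = g x" using m0 by (auto simp: g_def cl_def)
      ultimately have "(\<lambda>n. (g x - G' n x)\<^sup>2 * w x) \<longlonglongrightarrow> (g x - g x)\<^sup>2 * w x" by (intro tendsto_intros) auto
      then show ?thesis using False by (simp add: D_def)
    qed (simp add: D_def)
  qed
  from order_tendstoD(2)[OF this, of "e / 12"] e12
  obtain j where j: "integral {0..1} (D j) < e / 12" by (auto simp: eventually_sequentially)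
  have "integral {0..1} (\<lambda>x. (g x - G' j x)\<^sup>2 * w x) = integral {0..1} (D j)"
    by (rule integral_spike[OF N]) (simp add: D_def)
  with j have J: "integral {0..1} (\<lambda>x. (g x - G' j x)\<^sup>2 * w x) < e / 12" by simp
  \<comment> \<open>W + 1 in place of W keeps the quotient meaningful when W = 0.\<close>
  define \<eta> where "\<eta> = sqrt (e / 12 / (W + 1))"
  have eta: "0 < \<eta>" "\<eta>\<^sup>2 * W \<le> e / 12"
  proof -
    show "0 < \<eta>" using e W by (simp add: \<eta>_def)
    have "\<eta>\<^sup>2 * W = e / 12 * (W / (W + 1))" using e W by (simp add: \<eta>_def)
    also have "\<dots> \<le> e / 12 * 1" using e W by (intro mult_left_mono) auto
    finally show "\<eta>\<^sup>2 * W \<le> e / 12" by simp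
  qed
  obtain p where p: "real_polynomial_function p" "\<And>x. x \<in> {0..1} \<Longrightarrow> \<bar>G' j x - p x\<bar> < \<eta>"
    using Stone_Weierstrass_real_polynomial_function[OF compact_Icc cG' eta(1)] by blast
  have pc: "continuous_on {0..1} p"
    using p(1) by (intro differentiable_imp_continuous_on differentiable_on_real_polynomial_function)
  have pm: "p \<in> borel_measurable (lebesgue_on {0..1})"
    by (rule continuous_imp_measurable_on_sets_lebesgue[OF pc]) auto
  have Gp: "(\<lambda>x. (G' j x - p x)\<^sup>2 * w x) integrable_on {0..1}"
    by (rule sqi[of _ \<eta>]) (use G'm pm p(2) less_imp_le in auto)
  have "integral {0..1} (\<lambda>x. (G' j x - p x)\<^sup>2 * w x) \<le> integral {0..1} (\<lambda>x::real. e / 12)"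
  proof (rule integral_le[OF Gp])
    fix x :: real assume x: "x \<in> {0..1}"
    have "(G' j x - p x)\<^sup>2 \<le> \<eta>\<^sup>2" using power_mono[OF less_imp_le[OF p(2)[OF x]], of 2] by simp
    then have "(G' j x - p x)\<^sup>2 * w x \<le> \<eta>\<^sup>2 * W" using w(2,3)[OF x] by (intro mult_mono) auto
    then show "(G' j x - p x)\<^sup>2 * w x \<le> e / 12" using eta(2) by linarith
  qed auto
  then have P: "integral {0..1} (\<lambda>x. (G' j x - p x)\<^sup>2 * w x) \<le> e / 12" by simp
  define R where "R = (\<lambda>x. 3 * ((h x - g x)\<^sup>2 * w x + (g x - G' j x)\<^sup>2 * w x + (G' j x - p x)\<^sup>2 * w x))"
  have i1': "(\<lambda>x. (h x - g x)\<^sup>2 * w x) integrable_on {0..1}"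
    using i1[of n] by (simp add: g_def m_def)
  have HR: "(R has_integral 3 * (integral {0..1} (\<lambda>x. (h x - g x)\<^sup>2 * w x)
      + integral {0..1} (\<lambda>x. (g x - G' j x)\<^sup>2 * w x) + integral {0..1} (\<lambda>x. (G' j x - p x)\<^sup>2 * w x))) {0..1}"
    unfolding R_def by (intro has_integral_mult_right has_integral_add integrable_integral i1' i2 Gp)
  have le: "(h x - p x)\<^sup>2 * w x \<le> R x" if x: "x \<in> {0..1}" for x
  proof -
    have t: "(u + v + z)\<^sup>2 \<le> 3 * (u\<^sup>2 + v\<^sup>2 + z\<^sup>2)" for u v z :: real
    proof -
      have "0 \<le> (u - v)\<^sup>2 + (v - z)\<^sup>2 + (u - z)\<^sup>2" by simp
      then show ?thesis by (simp add: power2_eq_square algebra_simps)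
    qed
    have "(h x - p x)\<^sup>2 \<le> 3 * ((h x - g x)\<^sup>2 + (g x - G' j x)\<^sup>2 + (G' j x - p x)\<^sup>2)"
      using t[of "h x - g x" "g x - G' j x" "G' j x - p x"] by simp
    then have "(h x - p x)\<^sup>2 * w x \<le> 3 * ((h x - g x)\<^sup>2 + (g x - G' j x)\<^sup>2 + (G' j x - p x)\<^sup>2) * w x"
      using w(2)[OF x] by (intro mult_right_mono)
    then show ?thesis by (simp add: R_def algebra_simps)
  qed
  have ih: "(\<lambda>x. (h x - p x)\<^sup>2 * w x) integrable_on {0..1}"
  proof (rule measurable_bounded_by_integrable_imp_integrable)
    show "(\<lambda>x. (h x - p x)\<^sup>2 * w x) \<in> borel_measurable (lebesgue_on {0..1})" using h(1) pm w(1) by auto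
    show "R integrable_on {0..1}" using HR by auto
    show "norm ((h x - p x)\<^sup>2 * w x) \<le> R x" if "x \<in> {0..1}" for x using le[OF that] w(2)[OF that] by simp
  qed auto
  have "integral {0..1} (\<lambda>x. (h x - p x)\<^sup>2 * w x) \<le> integral {0..1} R"
    using HR by (intro integral_le ih le) auto
  also have "\<dots> < e"
    using n J P e unfolding integral_unique[OF HR] distrib_left g_def m_def by linarith
  finally show ?thesis using p(1) ih by blast
qed

lemma AC_loc_C1:
  assumes "\<And>x. x \<in> {0..1} \<Longrightarrow> g x = f x" "\<And>x. x \<in> {0..1} \<Longrightarrow> (f has_real_derivative f' x) (at x within {0..1})"
    "continuous_on {0..1} f'"
  shows "AC_loc g" "\<And>x. x \<in> {0..1} \<Longrightarrow> Dx g x = f' x"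
proof -
  show D: "Dx g x = f' x" if "x \<in> {0..1}" for x
    using Dx_cong[of g f x] assms(1) Dx_eqI[OF that assms(2)[OF that]] that by simp
  show "AC_loc g" unfolding AC_loc_def
  proof (intro ballI conjI)
    fix c :: real assume c: "c \<in> {0<..1}"
    have "f' integrable_on {c..1}"
      using c by (intro integrable_continuous_real continuous_on_subset[OF assms(3)]) auto
    then show "Dx g integrable_on {c..1}"
      by (rule integrable_spike[of _ _ "{}"]) (use c D in auto)
    fix x assume x: "x \<in> {c..1}"
    have "(f' has_integral f x - f c) {c..x}"
      using x c by (intro fundamental_theorem_of_calculus)
       (auto simp: has_real_derivative_iff_has_vector_derivative[symmetric] intro!: DERIV_subset[OF assms(2)])
    moreover have "integral {c..x} (Dx g) = integral {c..x} f'"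
      using x c by (intro Henstock_Kurzweil_Integration.integral_cong D) auto
    ultimately show "g x = g c + integral {c..x} (Dx g)" using assms(1) x c by (simp add: integral_unique)
  qed
qed

context degenerate begin

text \<open>The weighted condition on the fourth derivative holds because (a u'''')^2 / a = a
  u''''^2 is continuous.\<close>

lemma DomA_C4:
  assumes d: "\<And>x. x \<in> {0..1} \<Longrightarrow> (u has_real_derivative u1 x) (at x within {0..1})"
    "\<And>x. x \<in> {0..1} \<Longrightarrow> (u1 has_real_derivative u2 x) (at x within {0..1})"
    "\<And>x. x \<in> {0..1} \<Longrightarrow> (u2 has_real_derivative u3 x) (at x within {0..1})"
    "\<And>x. x \<in> {0..1} \<Longrightarrow> (u3 has_real_derivative u4 x) (at x within {0..1})"
    and c: "continuous_on {0..1} u4" and z: "u 0 = 0" "u1 0 = 0"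
  shows "DomA a u" "\<And>x. x \<in> {0..1} \<Longrightarrow> Dx2 u x = u2 x"
proof -
  have c3: "continuous_on {0..1} u3" using d(4) by (rule DERIV_continuous_on)
  have c2: "continuous_on {0..1} u2" using d(3) by (rule DERIV_continuous_on)
  have H: "H2 u" and D1: "\<And>x. x \<in> {0..1} \<Longrightarrow> Dx u x = u1 x" and D2: "\<And>x. x \<in> {0..1} \<Longrightarrow> Dx2 u x = u2 x"
    by (rule H2_C2[OF d(1,2) c2]; assumption)+
  have A2: "AC_loc (Dx2 u)" and D3: "\<And>x. x \<in> {0..1} \<Longrightarrow> Dx3 u x = u3 x"
    by (rule AC_loc_C1[OF D2 d(3) c3]; assumption)+
  have A3: "AC_loc (Dx3 u)" and D4: "\<And>x. x \<in> {0..1} \<Longrightarrow> Dx4 u x = u4 x"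
    by (rule AC_loc_C1[OF D3 d(4) c]; assumption)+
  have "L2w a (\<lambda>x. a x * u4 x)" unfolding L2w_def
  proof
    show "L2 (\<lambda>x. a x * u4 x)" by (intro L2_continuous continuous_intros a_continuous c)
    have "(\<lambda>x. a x * (u4 x)\<^sup>2) integrable_on {0..1}"
      by (intro integrable_continuous_real continuous_intros a_continuous c)
    moreover have "(\<lambda>x. (a x * u4 x)\<^sup>2 / a x) = (\<lambda>x. a x * (u4 x)\<^sup>2)"
      by (simp add: fun_eq_iff power2_eq_square)
    ultimately show "(\<lambda>x. (a x * u4 x)\<^sup>2 / a x) integrable_on {0..1}" by simp
  qed
  then have "L2w a (\<lambda>x. a x * Dx4 u x)"
    by (rule L2w_cong[of _ _ "{}"]) (use D4 in auto)
  then show "DomA a u" using A2 A3 H D1[of 0] z unfolding DomA_def H2w0_iff by simp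
  show "\<And>x. x \<in> {0..1} \<Longrightarrow> Dx2 u x = u2 x" by (rule D2)
qed

text \<open>Approximate u'' by a polynomial and integrate twice from 0, which preserves the
  conditions at 0. Nothing is imposed at 1, as the velocity will take up those conditions.\<close>

lemma DomA_dense:
  assumes u: "H2w0 a u" and e: "0 < e"
  shows "\<exists>z. DomA a z \<and> bending (\<lambda>x. u x + (-1) * z x) < e"
proof -
  note h = H2w0_D[OF u]
  have "\<exists>p. real_polynomial_function p \<and> (\<lambda>x. (Dx2 u x - p x)\<^sup>2 * 1) integrable_on {0..1} \<and>
    integral {0..1} (\<lambda>x. (Dx2 u x - p x)\<^sup>2 * 1) < e"
    by (rule weighted_L2_polynomial_approximation[where W = 1]) (use h(6) e in \<open>auto simp: L2_iff_borel\<close>)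
  then obtain p where p: "real_polynomial_function p" "integral {0..1} (\<lambda>x. (Dx2 u x - p x)\<^sup>2) < e" by auto
  obtain p1 where p1: "real_polynomial_function p1" "\<And>x. (p has_real_derivative p1 x) (at x)"
    using has_real_derivative_polynomial_function[OF p(1)] by blast
  obtain p2 where p2: "real_polynomial_function p2" "\<And>x. (p1 has_real_derivative p2 x) (at x)"
    using has_real_derivative_polynomial_function[OF p1(1)] by blast
  have c2: "continuous_on {0..1} p2"
    using p2(1) by (intro differentiable_imp_continuous_on differentiable_on_real_polynomial_function)
  have cp: "continuous_on {0..1} p"
    using p(1) by (intro differentiable_imp_continuous_on differentiable_on_real_polynomial_function)
  define z1 where "z1 x = integral {0..x} p" for x
  define z where "z x = integral {0..x} z1" for x
  have d1: "(z1 has_real_derivative p x) (at x within {0..1})" if "x \<in> {0..1}" for x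
    unfolding z1_def using integral_has_real_derivative[OF cp that] .
  have c1: "continuous_on {0..1} z1" using d1 by (rule DERIV_continuous_on)
  have d0: "(z has_real_derivative z1 x) (at x within {0..1})" if "x \<in> {0..1}" for x
    unfolding z_def using integral_has_real_derivative[OF c1 that] .
  have dp: "(p has_real_derivative p1 x) (at x within {0..1})" "(p1 has_real_derivative p2 x) (at x within {0..1})" for x
    using p1(2) p2(2) by (auto intro: has_field_derivative_at_within)
  have Z: "DomA a z" and D2: "\<And>x. x \<in> {0..1} \<Longrightarrow> Dx2 z x = p x"
    by (rule DomA_C4[OF d0 d1 dp(1) dp(2) c2]; simp add: z_def z1_def)+
  have "H2w0 a z" using Z by (simp add: DomA_def)
  from H2_lin(2)[OF h(1) H2w0_D(1)[OF this], of "-1"] obtain N where N: "negligible N"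
    "\<And>x. x \<in> {0..1} - N \<Longrightarrow> Dx2 (\<lambda>x. u x + (-1) * z x) x = Dx2 u x + (-1) * Dx2 z x" by blast
  have "bending (\<lambda>x. u x + (-1) * z x)
      = ipw1 (\<lambda>x. Dx2 u x - p x) (\<lambda>x. Dx2 u x - p x)"
    by (rule ipw_cong[OF N(1)]) (use N(2) D2 in auto)
  also have "\<dots> < e" using p(2) by (simp add: ipw_square_one)
  finally show ?thesis using Z by blast
qed

text \<open>The corrector s x^n + t x^(2n) adjusts value and slope at 1; its coefficients stay bounded
  as n grows, so it is negligible in the weighted norm.\<close>

lemma H2w0_dense:
  assumes v: "L2w a v" and e: "0 < e"
  shows "\<exists>z. H2w0 a z \<and> z 1 = \<alpha> \<and> Dx z 1 = b \<and> ipw a (\<lambda>x. v x + (-1) * z x) (\<lambda>x. v x + (-1) * z x) < e"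
proof -
  \<comment> \<open>Writing v = x^2 h turns the weight 1/a into the bounded weight x^4 / a, and x^2
    q satisfies the conditions at 0 for every polynomial q.\<close>
  define w where "w x = x ^ 4 / a x" for x
  define h where "h x = v x / x\<^sup>2" for x
  have idm: "(\<lambda>x. x) \<in> borel_measurable (lebesgue_on {0..1::real})"
    by (intro continuous_imp_measurable_on_sets_lebesgue continuous_intros) auto
  have hw: "(h x)\<^sup>2 * w x = (v x)\<^sup>2 / a x" for x
    by (cases "x = 0") (simp_all add: h_def w_def a_zero power_divide)
  have "\<exists>p. real_polynomial_function p \<and> (\<lambda>x. (h x - p x)\<^sup>2 * w x) integrable_on {0..1} \<and>
    integral {0..1} (\<lambda>x. (h x - p x)\<^sup>2 * w x) < e / 4"
  proof (rule weighted_L2_polynomial_approximation[where W = "1 / a 1"])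
    show "w \<in> borel_measurable (lebesgue_on {0..1})" unfolding w_def
      using idm weight_a unfolding weight_def by (intro borel_measurable_divide borel_measurable_power) auto
    show "h \<in> borel_measurable (lebesgue_on {0..1})" unfolding h_def
      using idm v unfolding L2w_def L2_iff_borel by (intro borel_measurable_divide borel_measurable_power) auto
    show "(\<lambda>x. (h x)\<^sup>2 * w x) integrable_on {0..1}" using v by (simp add: hw L2w_def)
    fix x :: real assume x: "x \<in> {0..1}"
    show "0 \<le> w x" using a_nonneg[OF x] x by (simp add: w_def)
    have "w x = x\<^sup>2 * (x\<^sup>2 / a x)" by (simp add: w_def flip: power_add)
    also have "\<dots> \<le> 1 * (1 / a 1)"
      using x a_nonneg[OF x] by (intro mult_mono square_over_a_le power_le_one) auto
    finally show "w x \<le> 1 / a 1" by simp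
  qed (use e in simp)
  then obtain q where q: "real_polynomial_function q" "(\<lambda>x. (h x - q x)\<^sup>2 * w x) integrable_on {0..1}"
    "integral {0..1} (\<lambda>x. (h x - q x)\<^sup>2 * w x) < e / 4" by blast
  obtain q1 where q1: "real_polynomial_function q1" "\<And>x. (q has_real_derivative q1 x) (at x)"
    using has_real_derivative_polynomial_function[OF q(1)] by blast
  obtain q2 where q2: "real_polynomial_function q2" "\<And>x. (q1 has_real_derivative q2 x) (at x)"
    using has_real_derivative_polynomial_function[OF q1(1)] by blast
  have qc: "continuous_on {0..1} q" "continuous_on {0..1} q1" "continuous_on {0..1} q2"
    using q(1) q1(1) q2(1) by (intro differentiable_imp_continuous_on differentiable_on_real_polynomial_function; simp)+
  \<comment> \<open>A and B measure by how much value and slope of x^2 q at 1 miss \<alpha> and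
    b.\<close>
  define A where "A = \<alpha> - q 1"
  define B where "B = b - 2 * q 1 - q1 1"
  \<comment> \<open>Bounds |s| + |t| for every n, so the weighted square norm of the corrector is at
    most D^2 / (a(1) (2n - 1)), which the choice of \<open>n0\<close> makes small.\<close>
  define D where "D = 3 * \<bar>A\<bar> + 2 * \<bar>B\<bar>"
  obtain n0 :: nat where n0: "4 * D\<^sup>2 / (a 1 * e) < real n0" using reals_Archimedean2 by blast
  \<comment> \<open>At least 2, so that x^n vanishes at 0 together with its derivative.\<close>
  define n where "n = n0 + 2"
  have n2: "n \<ge> 2" by (simp add: n_def)
  define s where "s = 2 * A - B / real n"
  define t where "t = B / real n - A"
  have st: "s + t = A" "real n * s + real (2 * n) * t = B"
    using n2 by (simp_all add: s_def t_def field_simps)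
  have Bn: "\<bar>B / real n\<bar> \<le> \<bar>B\<bar>" using n2 by (simp add: divide_le_eq mult_right_le_one_le mult_le_cancel_left1)
  have stD: "\<bar>s\<bar> + \<bar>t\<bar> \<le> D" using Bn unfolding s_def t_def D_def by linarith
  define z where "z x = x\<^sup>2 * q x + s * x ^ n + t * x ^ (2 * n)" for x
  define z1 where "z1 x = 2 * x * q x + x\<^sup>2 * q1 x + s * (real n * x ^ (n - 1)) + t * (real (2 * n) * x ^ (2 * n - 1))" for x
  define z2 where "z2 x = 2 * q x + 4 * x * q1 x + x\<^sup>2 * q2 x + s * (real n * (real (n - 1) * x ^ (n - 1 - 1)))
    + t * (real (2 * n) * (real (2 * n - 1) * x ^ (2 * n - 1 - 1)))" for x
  have dq: "(q has_real_derivative q1 x) (at x within {0..1})" "(q1 has_real_derivative q2 x) (at x within {0..1})" for x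
    using q1(2) q2(2) by (auto intro: has_field_derivative_at_within)
  have d1: "(z has_real_derivative z1 x) (at x within {0..1})" for x
    unfolding z_def z1_def by (auto intro!: derivative_eq_intros dq)
  have d2: "(z1 has_real_derivative z2 x) (at x within {0..1})" for x
    unfolding z1_def z2_def by (auto intro!: derivative_eq_intros dq simp: algebra_simps)
  have c2: "continuous_on {0..1} z2" unfolding z2_def by (intro continuous_intros qc)
  have H: "H2 z" and D1: "\<And>x. x \<in> {0..1} \<Longrightarrow> Dx z x = z1 x"
    by (rule H2_C2[OF d1 d2 c2]; assumption)+
  have z0: "0 ^ n = (0::real)" "0 ^ (2 * n) = (0::real)" "0 ^ (n - 1) = (0::real)" "0 ^ (2 * n - 1) = (0::real)"
    using n2 by (auto simp: power_0_left)
  have zw: "H2w0 a z" unfolding H2w0_iff using H D1[of 0] by (simp add: z_def z1_def z0 del: One_nat_def)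
  have e1: "z 1 = \<alpha>" using st(1) by (simp add: z_def A_def)
  have e2: "Dx z 1 = b" using D1[of 1] st(2) by (simp add: z1_def B_def mult.commute)
  define C where "C x = 2 * ((h x - q x)\<^sup>2 * w x) + 2 * D\<^sup>2 / a 1 * x ^ (2 * n - 2)" for x
  have I: "((\<lambda>x. x ^ (2 * n - 2)) has_integral (1 ^ (2 * n - 1) / real (2 * n - 1) - 0 ^ (2 * n - 1) / real (2 * n - 1))) {0..1::real}"
  proof (rule fundamental_theorem_of_calculus)
    fix x :: real
    have "((\<lambda>x. x ^ (2 * n - 1) / real (2 * n - 1)) has_real_derivative (real (2 * n - 1) * x ^ (2 * n - 1 - 1)) / real (2 * n - 1)) (at x within {0..1})"
      by (auto intro!: derivative_eq_intros)
    moreover have "2 * n - 1 - 1 = 2 * n - 2" "real (2 * n - 1) \<noteq> 0" using n2 by auto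
    ultimately show "((\<lambda>x. x ^ (2 * n - 1) / real (2 * n - 1)) has_vector_derivative x ^ (2 * n - 2)) (at x within {0..1})"
      by (simp only: has_real_derivative_iff_has_vector_derivative[symmetric] nonzero_mult_div_cancel_left not_False_eq_True)
  qed simp
  then have I': "((\<lambda>x. x ^ (2 * n - 2)) has_integral 1 / real (2 * n - 1)) {0..1::real}"
    unfolding z0 power_one by (simp only: div_0 diff_0_right)
  have IC: "(C has_integral 2 * integral {0..1} (\<lambda>x. (h x - q x)\<^sup>2 * w x) + 2 * D\<^sup>2 / a 1 * (1 / real (2 * n - 1))) {0..1}"
    unfolding C_def by (intro has_integral_add has_integral_mult_right integrable_integral q(2) I')
  have le: "(v x + (-1) * z x)\<^sup>2 / a x \<le> C x" if x: "x \<in> {0..1}" for x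
  proof (cases "x = 0")
    case True
    then show ?thesis using a1_pos by (simp add: C_def a_zero w_def)
  next
    case False
    then have x1: "x \<in> {0<..1}" using x by auto
    define P where "P = v x - x\<^sup>2 * q x"
    define Rr where "Rr = s * x ^ n + t * x ^ (2 * n)"
    have PP: "P\<^sup>2 / a x = (h x - q x)\<^sup>2 * w x"
    proof -
      have "P = x\<^sup>2 * (h x - q x)" using False by (simp add: P_def h_def field_simps)
      then show ?thesis by (simp add: w_def power_mult_distrib flip: power_mult)
    qed
    have "\<bar>Rr\<bar> \<le> \<bar>s\<bar> * x ^ n + \<bar>t\<bar> * x ^ n"
    proof -
      have "x ^ (2 * n) \<le> x ^ n" using x by (intro power_decreasing) auto
      then have "\<bar>t\<bar> * x ^ (2 * n) \<le> \<bar>t\<bar> * x ^ n" by (intro mult_left_mono) auto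
      moreover have "\<bar>Rr\<bar> \<le> \<bar>s\<bar> * x ^ n + \<bar>t\<bar> * x ^ (2 * n)"
        unfolding Rr_def using x abs_triangle_ineq[of "s * x ^ n" "t * x ^ (2 * n)"] by (simp add: abs_mult)
      ultimately show ?thesis by linarith
    qed
    also have "\<dots> \<le> D * x ^ n" using stD x by (simp add: mult_right_mono flip: distrib_right)
    finally have "Rr\<^sup>2 \<le> (D * x ^ n)\<^sup>2" using power_mono[of "\<bar>Rr\<bar>" "D * x ^ n" 2] by simp
    also have "\<dots> = D\<^sup>2 * (x ^ (2 * n - 2) * x\<^sup>2)"
    proof -
      have "n * 2 = (2 * n - 2) + 2" using n2 by simp
      then have "x ^ (n * 2) = x ^ (2 * n - 2) * x\<^sup>2" by (metis power_add)
      then show ?thesis by (simp add: power_mult_distrib flip: power_mult)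
    qed
    finally have "Rr\<^sup>2 / a x \<le> D\<^sup>2 * x ^ (2 * n - 2) * (x\<^sup>2 / a x)"
      using a_pos[OF x1] by (simp add: divide_right_mono mult.assoc)
    also have "\<dots> \<le> D\<^sup>2 * x ^ (2 * n - 2) * (1 / a 1)"
      using x by (intro mult_left_mono square_over_a_le) auto
    finally have RR: "Rr\<^sup>2 / a x \<le> D\<^sup>2 / a 1 * x ^ (2 * n - 2)" by simp
    have "(v x + (-1) * z x)\<^sup>2 = (P - Rr)\<^sup>2" by (simp add: P_def Rr_def z_def algebra_simps)
    also have "\<dots> \<le> 2 * P\<^sup>2 + 2 * Rr\<^sup>2"
      using zero_le_power2[of "P + Rr"] by (simp add: power2_eq_square algebra_simps)
    finally have "(v x + (-1) * z x)\<^sup>2 / a x \<le> (2 * P\<^sup>2 + 2 * Rr\<^sup>2) / a x"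
      using a_pos[OF x1] by (intro divide_right_mono) auto
    also have "\<dots> = 2 * (P\<^sup>2 / a x) + 2 * (Rr\<^sup>2 / a x)" by (simp add: add_divide_distrib)
    also have "\<dots> \<le> C x" unfolding C_def PP using RR by simp
    finally show ?thesis .
  qed
  have vz: "L2w a (\<lambda>x. v x + (-1) * z x)" by (rule L2w_lin[OF weight_a v H2w0_D(4)[OF zw]])
  have "ipw a (\<lambda>x. v x + (-1) * z x) (\<lambda>x. v x + (-1) * z x) \<le> integral {0..1} C"
    unfolding ipw_square using vz IC le by (intro integral_le) (auto simp: L2w_def)
  also have "\<dots> = 2 * integral {0..1} (\<lambda>x. (h x - q x)\<^sup>2 * w x) + 2 * D\<^sup>2 / a 1 * (1 / real (2 * n - 1))"
    using IC by (rule integral_unique)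
  also have "\<dots> < e"
  proof -
    have "4 * D\<^sup>2 / (a 1 * e) < real (2 * n - 1)" using n0 by (simp add: n_def)
    then have "4 * D\<^sup>2 < real (2 * n - 1) * (a 1 * e)" using a1_pos e by (simp add: divide_less_eq)
    then have "2 * D\<^sup>2 / a 1 * (1 / real (2 * n - 1)) < e / 2"
      using a1_pos n2 by (simp add: field_simps)
    moreover have "2 * integral {0..1} (\<lambda>x. (h x - q x)\<^sup>2 * w x) < e / 2" using q(3) by simp
    ultimately have "2 * integral {0..1} (\<lambda>x. (h x - q x)\<^sup>2 * w x) + 2 * D\<^sup>2 / a 1 * (1 / real (2 * n - 1)) < e / 2 + e / 2"
      by (intro add_strict_mono)
    then show ?thesis by (simp only: field_sum_of_halves)
  qed
  finally show ?thesis using zw e1 e2 by blast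
qed

end

context beam begin

text \<open>The conditions at 1 couple displacement and velocity, but the velocity is measured in
  weighted L2, where value and slope at 1 are free. The displacement is therefore approximated
  first, and the traces of the velocity are then prescribed to fit it.\<close>

lemma DomAA_dense:
  assumes p: "p \<in> H0 a" and e: "0 < e"
  shows "\<exists>q\<in>DomAA a \<beta> \<gamma>. N (psub p q) < e"
proof -
  \<comment> \<open>The factor 1 + \<beta> + \<gamma> pays for the two boundary terms of the norm,
    each controlled by the bending integral.\<close>
  define e' where "e' = e\<^sup>2 / (2 * (1 + \<beta> + \<gamma>))"
  have bg: "0 < 1 + \<beta> + \<gamma>" using beta_nonneg gamma_nonneg by simp
  have e': "0 < e'" "0 < e\<^sup>2 / 2" using e bg by (simp_all add: e'_def)
  obtain u where u: "DomA a u"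
    "bending (\<lambda>x. fst p x + (-1) * u x) < e'"
    using DomA_dense[OF H0_D(1)[OF p] e'(1)] by blast
  obtain v where v: "H2w0 a v" "v 1 = Dx3 u 1 - \<beta> * u 1" "Dx v 1 = - \<gamma> * Dx u 1 - Dx2 u 1"
    "ipw a (\<lambda>x. snd p x + (-1) * v x) (\<lambda>x. snd p x + (-1) * v x) < e\<^sup>2 / 2"
    using H2w0_dense[OF H0_D(2)[OF p] e'(2)] by blast
  have q: "(u, v) \<in> DomAA a \<beta> \<gamma>" using u(1) v by (simp add: DomAA_def)
  define r where "r = lc p (-1) (u, v)"
  have r: "r \<in> H0 a" unfolding r_def by (intro H0_lc p DomAA_H0 q)
  define Br where "Br = bending (fst r)"
  note b = ip_bounds[OF r, folded Br_def]
  have Br: "Br < e'" using u(2) by (simp add: Br_def r_def)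
  have Vr: "ipw a (snd r) (snd r) < e\<^sup>2 / 2" using v(4) by (simp add: r_def)
  have "\<beta> * (fst r 1)\<^sup>2 \<le> \<beta> * Br" "\<gamma> * (Dx (fst r) 1)\<^sup>2 \<le> \<gamma> * Br"
    using b(5,6) beta_nonneg gamma_nonneg by (auto intro: mult_left_mono)
  then have "ip r r \<le> (1 + \<beta> + \<gamma>) * Br + ipw a (snd r) (snd r)"
    unfolding b(1) by (simp add: algebra_simps)
  also have "\<dots> < (1 + \<beta> + \<gamma>) * e' + e\<^sup>2 / 2"
    using Vr mult_strict_left_mono[OF Br bg] by linarith
  also have "(1 + \<beta> + \<gamma>) * e' = e\<^sup>2 / 2" using bg by (simp add: e'_def field_simps)
  finally have "(N r)\<^sup>2 < e\<^sup>2" by (simp add: N_square)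
  then have "N r < e" using e by (intro power_less_imp_less_base[of "N r" 2 e]) auto
  then show ?thesis using q by (auto simp: r_def psub_lc)
qed

end

section \<open>Exponential decay\<close>

text \<open>With a finite horizon t: exp(r/M) times the integral of E over [r, t] decreases in r.
  E(t) is at most the mean of E over the last M units of time, and this shift by M produces the 1 in
  the exponent. For t < M the factor already exceeds 1.\<close>

lemma integral_inequality_imp_exponential_decay:
  fixes E X X' :: "real \<Rightarrow> real"
  assumes E0: "\<And>t. 0 \<le> t \<Longrightarrow> 0 \<le> E t"
    and mono: "\<And>s t. 0 \<le> s \<Longrightarrow> s \<le> t \<Longrightarrow> E t \<le> E s"
    and cont: "continuous_on {0..} E"
    and X: "\<And>t. 0 \<le> t \<Longrightarrow> (X has_real_derivative X' t) (at t within {0..})"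
    and X': "\<And>t. 0 \<le> t \<Longrightarrow> X' t \<le> - \<kappa> * E t"
    and osc: "\<And>s t. 0 \<le> s \<Longrightarrow> s \<le> t \<Longrightarrow> X s - X t \<le> C * E s"
    and pos: "0 < \<kappa>" "0 < C" and t: "0 \<le> t"
  shows "E t \<le> E 0 * exp (1 - t / (C / \<kappa>))"
proof -
  define M where "M = C / \<kappa>"
  have M: "0 < M" using pos by (simp add: M_def)
  show ?thesis
  proof (cases "t < M")
    case True
    then have "1 \<le> exp (1 - t / M)" using M by simp
    then have "E 0 * 1 \<le> E 0 * exp (1 - t / M)" using E0[of 0] by (intro mult_left_mono) auto
    then show ?thesis using mono[of 0 t] t unfolding M_def by linarith
  next
    case False
    have ct: "continuous_on {0..t} E" using cont by (rule continuous_on_subset) auto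
    define H where "H s = integral {0..s} E" for s
    have Hd: "(H has_real_derivative E s) (at s within {0..t})" if "s \<in> {0..t}" for s
      unfolding H_def[abs_def] using integral_has_real_derivative[OF ct that] .
    have Hc: "continuous_on {0..t} H" using Hd by (rule DERIV_continuous_on)
    have Hd': "DERIV H s :> E s" if "0 < s" "s < t" for s
      using Hd[of s] that at_within_interior[of s "{0..t}"] by simp
    have Xc: "continuous_on {0..t} X"
    proof (rule DERIV_continuous_on)
      fix s assume "s \<in> {0..t}"
      then show "(X has_real_derivative X' s) (at s within {0..t})" by (intro DERIV_subset[OF X]) auto
    qed
    have Xd': "DERIV X s :> X' s" if "0 < s" for s
      using X[of s] that at_within_interior[of s "{0..}"] by simp
    have I: "H t - H s \<le> M * E s" if s: "0 \<le> s" "s \<le> t" for s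
    proof -
      \<comment> \<open>Monotonicity of X + \<kappa> H replaces an integration of X'.\<close>
      have "X t + \<kappa> * H t \<le> X s + \<kappa> * H s"
      proof (rule DERIV_nonpos_imp_decreasing_open[OF s(2)])
        fix r assume r: "s < r" "r < t"
        then have "DERIV (\<lambda>r. X r + \<kappa> * H r) r :> X' r + \<kappa> * E r"
          using s Xd'[of r] Hd'[of r] by (auto intro!: derivative_eq_intros)
        moreover have "X' r + \<kappa> * E r \<le> 0" using X'[of r] r s by simp
        ultimately show "\<exists>y. DERIV (\<lambda>r. X r + \<kappa> * H r) r :> y \<and> y \<le> 0" by blast
      next
        show "continuous_on {s..t} (\<lambda>r. X r + \<kappa> * H r)"
          by (intro continuous_intros continuous_on_subset[OF Xc] continuous_on_subset[OF Hc]) (use s in auto)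
      qed
      then have "\<kappa> * (H t - H s) \<le> C * E s" using osc[OF s] by (simp add: algebra_simps)
      then show ?thesis using pos by (simp add: M_def field_simps)
    qed
    \<comment> \<open>At this point exp(T/M) = exp(t/M - 1).\<close>
    define T where "T = t - M"
    have T: "0 \<le> T" "T \<le> t" using False M by (auto simp: T_def)
    have "exp (T / M) * (H t - H T) \<le> exp (0 / M) * (H t - H 0)"
    proof (rule DERIV_nonpos_imp_decreasing_open[OF T(1)])
      fix r assume r: "0 < r" "r < T"
      then have rt: "r < t" using T by simp
      have "DERIV (\<lambda>r. exp (r / M) * (H t - H r)) r :> exp (r / M) * (1 / M) * (H t - H r) - exp (r / M) * E r"
        using Hd'[OF r(1) rt] M by (auto intro!: derivative_eq_intros simp: field_simps)
      moreover have "exp (r / M) * (1 / M) * (H t - H r) - exp (r / M) * E r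
          = exp (r / M) * ((H t - H r) / M - E r)" by (simp add: algebra_simps)
      moreover have "(H t - H r) / M \<le> E r" using I[of r] r rt M by (simp add: field_simps)
      then have "exp (r / M) * ((H t - H r) / M - E r) \<le> 0" by (intro mult_nonneg_nonpos) auto
      ultimately show "\<exists>y. DERIV (\<lambda>r. exp (r / M) * (H t - H r)) r :> y \<and> y \<le> 0"
        by (intro exI[of _ "exp (r / M) * (1 / M) * (H t - H r) - exp (r / M) * E r"]) simp
    next
      show "continuous_on {0..T} (\<lambda>r. exp (r / M) * (H t - H r))"
        by (intro continuous_intros continuous_on_subset[OF Hc]) (use T M in auto)
    qed
    also have "\<dots> \<le> M * E 0" using I[of 0] t by simp
    finally have 1: "exp (T / M) * (H t - H T) \<le> M * E 0" .
    have "M * E t \<le> H t - H T"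
    proof -
      have i: "E integrable_on {0..t}" by (rule integrable_continuous_real[OF ct])
      have "H T + integral {T..t} E = H t"
        unfolding H_def by (rule Henstock_Kurzweil_Integration.integral_combine[OF T i])
      moreover have "integral {T..t} (\<lambda>_. E t) \<le> integral {T..t} E"
        using T mono by (intro integral_le integrable_on_subinterval[OF i]) auto
      moreover have "integral {T..t} (\<lambda>_. E t) = M * E t" using M by (simp add: T_def)
      ultimately show ?thesis by linarith
    qed
    then have "exp (T / M) * (M * E t) \<le> exp (T / M) * (H t - H T)" by (rule mult_left_mono) simp
    then have "exp (T / M) * (M * E t) \<le> M * E 0" using 1 by (rule order_trans)
    then have "exp (T / M) * E t \<le> E 0" using M by (simp add: mult.left_commute)
    then have "E t \<le> E 0 / exp (T / M)" by (simp add: field_simps)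
    also have "\<dots> = E 0 * exp (- (T / M))" by (simp add: exp_minus field_simps)
    also have "- (T / M) = 1 - t / M" using M by (simp add: T_def field_simps)
    finally show ?thesis by (simp add: M_def)
  qed
qed

section \<open>Decay along strong and mild solutions\<close>

context beam_semigroup begin

lemma N_decreasing:
  assumes "p \<in> H0 a" "0 \<le> s" "s \<le> t" shows "N (S t p) \<le> N (S s p)"
proof -
  have "N (S t p) = N (S (t - s) (S s p))" using eqv_N[OF S_add[of "t - s" s p]] assms by simp
  also have "\<dots> \<le> N (S s p)" using assms by (intro S_contraction S_H0) auto
  finally show ?thesis .
qed

lemma strong_decay:
  assumes q: "q \<in> DomAA a \<beta> \<gamma>" and eps: "0 < \<epsilon>" "\<epsilon> \<le> 2 - K" and dl: "0 < \<delta>" "\<delta> < nu \<beta> \<gamma>"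
    and small: "\<delta> * Cone a \<beta> \<gamma> \<epsilon> \<delta> < \<epsilon>" and t: "0 \<le> t"
  shows "(N (S t q))\<^sup>2 \<le> (N (S 0 q))\<^sup>2 * exp (1 - t / Mc a \<beta> \<gamma> \<epsilon> \<delta>)"
proof -
  note q0 = DomAA_H0[OF q]
  define E where "E s = ip (S s q) (S s q) / 2" for s
  define k \<rho> where "k = lift_coeff \<epsilon> \<delta>" and "\<rho> = energy_coeff \<epsilon> \<delta>"
  define X where "X s = lyapunov k \<rho> (S s q) (S s q)" for s
  define \<kappa> where "\<kappa> = \<epsilon> - \<delta> * Cone a \<beta> \<gamma> \<epsilon> \<delta>"
  note C = Ctwo_ge[OF eps(1) dl, folded k_def \<rho>_def]
  have SH: "S s q \<in> H0 a" if "0 \<le> s" for s using that q0 by (rule S_H0)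
  have EN: "E s = (N (S s q))\<^sup>2 / 2" for s by (simp add: E_def N_square)
  have mono: "E t \<le> E s" if "0 \<le> s" "s \<le> t" for s t
    unfolding EN using N_decreasing[OF q0 that] N_nonneg by (simp add: power_mono)
  have E0: "0 \<le> E s" for s by (simp add: E_def ip_nonneg)
  \<comment> \<open>A domain element at distance zero from the orbit at each time; Green's formulas
    apply to it and the forms do not distinguish it from S(s) q.\<close>
  have "\<forall>s\<in>{0..}. \<exists>r. r \<in> DomAA a \<beta> \<gamma> \<and> eqv (S s q) r \<and> eqv (S s (AA a q)) (AA a r)"
    using orbit_in_domain[OF q] by (metis atLeast_iff)
  then obtain R where R: "\<And>s. 0 \<le> s \<Longrightarrow> R s \<in> DomAA a \<beta> \<gamma>" "\<And>s. 0 \<le> s \<Longrightarrow> eqv (S s q) (R s)"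
    "\<And>s. 0 \<le> s \<Longrightarrow> eqv (S s (AA a q)) (AA a (R s))" by (metis atLeast_iff)
  have dE: "(E has_real_derivative (ip (AA a (R s)) (R s) + ip (R s) (AA a (R s))) / 2) (at s within {0..})" if s: "0 \<le> s" for s
    unfolding E_def by (intro DERIV_cdivide orbit_form_derivative[OF q s bounded_bilinear_form_ip R(1-3)[OF s]])
  have dX: "(X has_real_derivative lyapunov k \<rho> (AA a (R s)) (R s) + lyapunov k \<rho> (R s) (AA a (R s))) (at s within {0..})" if s: "0 \<le> s" for s
    unfolding X_def by (rule orbit_form_derivative[OF q s bounded_bilinear_form_lyapunov R(1-3)[OF s]])
  have "E t \<le> E 0 * exp (1 - t / (Ctwo a \<beta> \<gamma> \<epsilon> \<delta> / \<kappa>))"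
  proof (rule integral_inequality_imp_exponential_decay[OF E0 mono _ dX _ _ _ C(4) t])
    show "continuous_on {0..} E" by (rule DERIV_continuous_on[OF dE]) auto
    show "0 < \<kappa>" using small by (simp add: \<kappa>_def)
    show "lyapunov k \<rho> (AA a (R s)) (R s) + lyapunov k \<rho> (R s) (AA a (R s)) \<le> - \<kappa> * E s" if s: "0 \<le> s" for s
    proof -
      have Es: "E s = ip (R s) (R s) / 2" unfolding EN using eqv_N[OF R(2)[OF s]] by (simp add: N_square)
      show ?thesis unfolding Es \<kappa>_def k_def \<rho>_def by (rule lyapunov_dissipation[OF R(1)[OF s] eps dl])
    qed
    fix s t :: real assume st: "0 \<le> s" "s \<le> t"
    define A1 A2 where "A1 = 2 * vartheta a + Cb \<gamma> / 2 * (2 - K / 2) + k * (1 + CHP a * (Cb \<beta> + Cb \<gamma>)) + \<rho>"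
      and "A2 = 2 * vartheta a + k * (1 + CHP a * (Cb \<beta> + Cb \<gamma>))"
    have A2: "0 \<le> A2"
    proof -
      have "1 + K / 4 \<le> vartheta a" by (simp add: vartheta_def)
      moreover have "0 \<le> Cb \<beta>" "0 \<le> Cb \<gamma>" using beta_nonneg gamma_nonneg by (simp_all add: Cb_def)
      ultimately show ?thesis unfolding A2_def using K_bounds CHP_nonneg C(1)
        by (intro add_nonneg_nonneg mult_nonneg_nonneg) auto
    qed
    have "X s \<le> A1 * E s"
      using lyapunov_bounds(1)[OF SH[OF st(1)] C(1), of \<rho>] by (simp add: X_def E_def A1_def)
    moreover have "- A2 * E t + \<rho> * E t \<le> X t"
      using lyapunov_bounds(2)[OF SH C(1), of t \<rho>] st by (simp add: X_def E_def A2_def)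
    moreover have "0 \<le> \<rho> * E t" using C(2) E0 by simp
    moreover have "A2 * E t \<le> A2 * E s" using A2 mono[OF st] by (rule mult_left_mono[rotated])
    \<comment> \<open>In the lower bound at t the nonnegative energy term is discarded, and the rest
      costs at most A2 E(s) because E decreases.\<close>
    ultimately have "X s - X t \<le> A1 * E s + A2 * E s" by simp
    also have "\<dots> \<le> Ctwo a \<beta> \<gamma> \<epsilon> \<delta> * E s"
      using mult_right_mono[OF C(3) E0[of s]] by (simp add: A1_def A2_def algebra_simps)
    finally show "X s - X t \<le> Ctwo a \<beta> \<gamma> \<epsilon> \<delta> * E s" .
  qed
  then show ?thesis by (simp add: EN Mc_def \<kappa>_def)
qed

text \<open>The density argument is run on the norm rather than its square, so that errors add by
  the triangle inequality; g is the square root of the decay factor.\<close>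

lemma mild_decay:
  assumes p: "p \<in> H0 a" and eps: "0 < \<epsilon>" "\<epsilon> \<le> 2 - K" and dl: "0 < \<delta>" "\<delta> < nu \<beta> \<gamma>"
    and small: "\<delta> * Cone a \<beta> \<gamma> \<epsilon> \<delta> < \<epsilon>" and t: "0 \<le> t"
  shows "(N (S t p))\<^sup>2 \<le> (N (S 0 p))\<^sup>2 * exp (1 - t / Mc a \<beta> \<gamma> \<epsilon> \<delta>)"
proof -
  define g where "g = sqrt (exp (1 - t / Mc a \<beta> \<gamma> \<epsilon> \<delta>))"
  have g: "0 \<le> g" "g\<^sup>2 = exp (1 - t / Mc a \<beta> \<gamma> \<epsilon> \<delta>)" by (simp_all add: g_def)
  have N0: "N (S 0 r) = N r" if "r \<in> H0 a" for r using eqv_N[OF S_0[OF that]] .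
  have "N (S t p) \<le> N p * g"
  proof (rule field_le_epsilon)
    fix e :: real assume e: "0 < e"
    \<comment> \<open>Makes the total error d g + d equal to e.\<close>
    define d where "d = e / (1 + g)"
    have d: "0 < d" using e g(1) by (simp add: d_def)
    obtain q where q: "q \<in> DomAA a \<beta> \<gamma>" "N (psub p q) < d" using DomAA_dense[OF p d] by blast
    note q0 = DomAA_H0[OF q(1)]
    have "(N (S t q))\<^sup>2 \<le> (N q * g)\<^sup>2"
      using strong_decay[OF q(1) eps dl small t] N0[OF q0] by (simp add: power_mult_distrib g(2))
    then have 1: "N (S t q) \<le> N q * g"
      by (rule power2_le_imp_le) (simp add: N_nonneg g(1))
    have "N q \<le> N p + d"
      using N_le_psub[OF q0 p] N_psub_commute[OF p q0] q(2) by linarith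
    then have 2: "N q * g \<le> (N p + d) * g" using g(1) by (rule mult_right_mono)
    have "N (S t p) \<le> N (S t q) + N (psub (S t p) (S t q))"
      by (rule N_le_psub[OF S_H0[OF t p] S_H0[OF t q0]])
    moreover have "N (psub (S t p) (S t q)) \<le> d"
    proof -
      have "N (psub (S t p) (S t q)) = N (S t (psub p q))"
        using eqv_N[OF S_lc[OF t p q0, of "-1"]] by (simp add: psub_lc)
      also have "\<dots> \<le> N (psub p q)" by (intro S_contraction t H0_psub p q0)
      finally show ?thesis using q(2) by simp
    qed
    ultimately have "N (S t p) \<le> (N p + d) * g + d" using 1 2 by linarith
    also have "\<dots> = N p * g + d * (1 + g)" by (simp add: algebra_simps)
    also have "d * (1 + g) = e" using g(1) by (simp add: d_def)
    finally show "N (S t p) \<le> N p * g + e" .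
  qed
  then have "(N (S t p))\<^sup>2 \<le> (N p * g)\<^sup>2" by (rule power_mono) (rule N_nonneg)
  then show ?thesis by (simp add: power_mult_distrib g(2) N0[OF p])
qed

lemma Energy_eq:
  assumes "S t p \<in> H0 a"
  shows "Energy a \<beta> \<gamma> (\<lambda>s. fst (S s p)) (\<lambda>s. snd (S s p)) t = (N (S t p))\<^sup>2 / 2"
proof -
  note h = H0_D[OF assms]
  have "integral {0..1} (\<lambda>x. (snd (S t p) x)\<^sup>2 / a x + (Dx2 (fst (S t p)) x)\<^sup>2)
     = ipw a (snd (S t p)) (snd (S t p)) + bending (fst (S t p))"
    unfolding ipw_square[of a] ipw_square_one using h(2,4)
    by (intro Henstock_Kurzweil_Integration.integral_add) (auto simp: L2w_def L2_def)
  then show ?thesis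
    unfolding Energy_def N_square ip_bounds(1)[OF assms] by simp
qed

end

theorem theorem3p2:
  fixes a :: "real \<Rightarrow> real" and \<beta> \<gamma> \<epsilon>0 \<delta> t :: real
    and S :: "real \<Rightarrow> pr \<Rightarrow> pr" and y0 y1 :: "real \<Rightarrow> real"
    and y yt :: "real \<Rightarrow> real \<Rightarrow> real"
  assumes deg: "WD a \<or> SD a"
    and beta: "\<beta> \<ge> 0" and gamma: "\<gamma> \<ge> 0"
    and sg: "gen_contr_semigroup a \<beta> \<gamma> S"
    and init: "(y0, y1) \<in> H0 a"
    and y_def: "\<And>s. y s = fst (S s (y0, y1))"
    and yt_def: "\<And>s. yt s = snd (S s (y0, y1))"
    and eps: "\<epsilon>0 > 0" "\<epsilon>0 \<le> 2 - Kc a"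
    and tpos: "t > 0"
    and delta: "0 < \<delta>" "\<delta> < min (nu \<beta> \<gamma>) (\<epsilon>0 / Cone a \<beta> \<gamma> \<epsilon>0 \<delta>)"
  shows "Energy a \<beta> \<gamma> y yt t \<le> Energy a \<beta> \<gamma> y yt 0 * exp (1 - t / Mc a \<beta> \<gamma> \<epsilon>0 \<delta>)"
proof -
  interpret beam_semigroup a \<beta> \<gamma> S
    by unfold_locales (use deg beta gamma sg in auto)
  have dl: "0 < \<delta>" "\<delta> < nu \<beta> \<gamma>" "\<delta> < \<epsilon>0 / Cone a \<beta> \<gamma> \<epsilon>0 \<delta>" using delta by auto
  \<comment> \<open>\<open>Cone\<close> itself depends on \<delta>, but \<delta> < \<open>nu\<close>
    makes it positive, so the bound on \<delta> can be multiplied out; this says that the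
    denominator of \<open>Mc\<close> is positive.\<close>
  have "0 < Cone a \<beta> \<gamma> \<epsilon>0 \<delta>"
    using Cdelta_pos[OF dl(2)] Pc_pos[OF eps(1)] by (simp add: Cone_def)
  then have small: "\<delta> * Cone a \<beta> \<gamma> \<epsilon>0 \<delta> < \<epsilon>0" using dl(3) by (simp add: less_divide_eq)
  have yy: "y = (\<lambda>s. fst (S s (y0, y1)))" "yt = (\<lambda>s. snd (S s (y0, y1)))"
    by (simp_all add: fun_eq_iff y_def yt_def)
  have E: "Energy a \<beta> \<gamma> y yt s = (N (S s (y0, y1)))\<^sup>2 / 2" if "0 \<le> s" for s
    unfolding yy by (rule Energy_eq[OF S_H0[OF that init]])
  show ?thesis
    using mild_decay[OF init eps dl(1,2) small, of t] tpos by (simp add: E)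
qed

end
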